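(* Let $\mathcal{H}$ be a finite-dimensional Hilbert space and $U$ a unitary on $\mathcal{H}$. Let $|\phi^{\mathrm{in}}_1\rangle,\dots,|\phi^{\mathrm{in}}_K\rangle$ be unit vectors spanning a subspace $\mathcal{H}_{\mathrm{in}}$ of dimension $d$, such that the algebra generated by $\{|\phi^{\mathrm{in}}_k\rangle\langle\phi^{\mathrm{in}}_k|\}_{k=1}^K$ is the full matrix algebra of operators supported on $\mathcal{H}_{\mathrm{in}}$, and let $|\phi^{\mathrm{out}}_k\rangle=U|\phi^{\mathrm{in}}_k\rangle$. For a qubit $a$ define the controlled reflections $R^{\mathrm{in/out}}_a(k)=|0\rangle\langle0|_a\otimes I+|1\rangle\langle1|_a\otimes e^{i\pi|\phi^{\mathrm{in/out}}_k\rangle\langle\phi^{\mathrm{in/out}}_k|}$ and $W^{\mathrm{in/out}}_a(k)=R^{\mathrm{in/out}}_a(k)H_aR^{\mathrm{in/out}}_a(1)$, with $H_a$ the Hadamard gate on $a$. Consider the procedure: (i) choose $k_1,\dots,k_T$ independently and uniformly from $\{1,\dots,K\}$, prepare qubits $a_1,\dots,a_T$ in $|-\rangle$ and apply successively $W^{\mathrm{in}}_{a_1}(k_1),\dots,W^{\mathrm{in}}_{a_T}(k_T)$ (each to the system and the indicated qubit); (ii) prepare a qubit $c$ in $|-\rangle$, apply $R^{\mathrm{in}}_c(1)$, then a Hadamard on $c$, and measure $c$ in the computational basis; (iii) replace the system state by $|\phi^{\mathrm{out}}_1\rangle$; (iv) apply successively $W^{\mathrm{out}}_{a_T}(k_T)^\dagger,\dots,W^{\mathrm{out}}_{a_1}(k_1)^\dagger$.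 Let $\mathcal{E}_U$ be the channel describing its overall effect on the system when the measurement outcome is ignored. Let $\mathcal{D}(X)=K^{-1}\sum_{k=1}^Ke^{i\pi|\phi^{\mathrm{in}}_k\rangle\langle\phi^{\mathrm{in}}_k|}Xe^{i\pi|\phi^{\mathrm{in}}_k\rangle\langle\phi^{\mathrm{in}}_k|}$, regarded as a linear map on operators supported on $\mathcal{H}_{\mathrm{in}}$, and let $\lambda_{\mathcal{D}}$ be its eigenvalue of second largest magnitude. If $\epsilon_{\mathrm{id}}>0$ and $$T\ge\frac{d\,\log(8\epsilon_{\mathrm{id}}^{-2}d)}{1-|\lambda_{\mathcal{D}}|},$$ then for every state $\rho$ with support contained in $\mathcal{H}_{\mathrm{in}}$, $\|U\rho U^\dagger-\mathcal{E}_U(\rho)\|_1\le\epsilon_{\mathrm{id}}$.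
   Context: $\|\cdot\|_1$ is the trace norm (sum of singular values). $|\pm\rangle=(|0\rangle\pm|1\rangle)/\sqrt2$; the Hadamard gate maps $|0\rangle\mapsto|+\rangle$, $|1\rangle\mapsto|-\rangle$. $e^{i\pi|\phi\rangle\langle\phi|}=I-2|\phi\rangle\langle\phi|$. The controlled reflections are assumed to be implemented perfectly. $\log$ is the natural logarithm. *)

theory Defs
  imports "Jordan_Normal_Form.Schur_Decomposition" "Jordan_Normal_Form.VS_Connect"
    "HOL-Computational_Algebra.Polynomial"
begin

definition cspan_vec :: "nat \<Rightarrow> complex vec set \<Rightarrow> complex vec set" where
  "cspan_vec n S = LinearCombinations.module.span (class_ring :: complex ring) (module_vec TYPE(complex) n) S"

definition cdim_vec :: "nat \<Rightarrow> complex vec set \<Rightarrow> nat" where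
  "cdim_vec n W = vectorspace.dim (class_ring :: complex ring)
      ((module_vec TYPE(complex) n)\<lparr>carrier := W\<rparr>)"

definition cspan_mat :: "nat \<Rightarrow> complex mat set \<Rightarrow> complex mat set" where
  "cspan_mat n S = LinearCombinations.module.span (class_ring :: complex ring) (module_mat TYPE(complex) n n) S"

definition cdim_mat :: "nat \<Rightarrow> complex mat set \<Rightarrow> nat" where
  "cdim_mat n W = vectorspace.dim (class_ring :: complex ring)
      ((module_mat TYPE(complex) n n)\<lparr>carrier := W\<rparr>)"

definition unitary_mat :: "nat \<Rightarrow> complex mat \<Rightarrow> bool" where
  "unitary_mat n U \<longleftrightarrow> U \<in> carrier_mat n n \<and> U * mat_adjoint U = 1\<^sub>m n \<and> mat_adjoint U * U = 1\<^sub>m n"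

definition is_unit_vec :: "nat \<Rightarrow> complex vec \<Rightarrow> bool" where
  "is_unit_vec n v \<longleftrightarrow> v \<in> carrier_vec n \<and> v \<bullet>c v = 1"

definition mtrace :: "complex mat \<Rightarrow> complex" where
  "mtrace A = (\<Sum>i<dim_row A. A $$ (i,i))"

definition density_op :: "nat \<Rightarrow> complex mat \<Rightarrow> bool" where
  "density_op n \<rho> \<longleftrightarrow> \<rho> \<in> carrier_mat n n \<and> mat_adjoint \<rho> = \<rho> \<and>
     (\<forall>v \<in> carrier_vec n. 0 \<le> Re ((\<rho> *\<^sub>v v) \<bullet>c v)) \<and> mtrace \<rho> = 1"

text \<open>Operators supported on a subspace W: X = P X P with P the projector onto W,
  i.e. range of X and of its adjoint contained in W.\<close>
definition supported_on :: "nat \<Rightarrow> complex vec set \<Rightarrow> complex mat \<Rightarrow> bool" where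
  "supported_on n W X \<longleftrightarrow> X \<in> carrier_mat n n \<and>
     (\<forall>v \<in> carrier_vec n. X *\<^sub>v v \<in> W \<and> mat_adjoint X *\<^sub>v v \<in> W)"

definition ketbra :: "complex vec \<Rightarrow> complex mat" where
  "ketbra v = mat (dim_vec v) (dim_vec v) (\<lambda>(i,j). v $ i * cnj (v $ j))"

text \<open>e^{i pi |v><v|} = I - 2 |v><v|\<close>
definition refl_op :: "complex vec \<Rightarrow> complex mat" where
  "refl_op v = 1\<^sub>m (dim_vec v) - 2 \<cdot>\<^sub>m ketbra v"

definition gen_algebra :: "nat \<Rightarrow> complex mat set \<Rightarrow> complex mat set" where
  "gen_algebra n S = cspan_mat n
     {foldr (\<lambda>A B. A * B) As (1\<^sub>m n) | As. As \<noteq> [] \<and> set As \<subseteq> S}"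

text \<open>Sum of the singular values, i.e. of the square roots of the eigenvalues of A^dagger A,
  counted with (algebraic) multiplicity.\<close>
definition trace_norm :: "complex mat \<Rightarrow> real" where
  "trace_norm A = (let p = char_poly (mat_adjoint A * A) in
     (\<Sum>\<mu> \<in> {\<mu>. poly p \<mu> = 0}. real (order \<mu> p) * sqrt (cmod \<mu>)))"

definition op_eigenvalue :: "nat \<Rightarrow> complex mat set \<Rightarrow> (complex mat \<Rightarrow> complex mat) \<Rightarrow> complex \<Rightarrow> bool" where
  "op_eigenvalue n L D \<mu> \<longleftrightarrow> (\<exists>X \<in> L. X \<noteq> 0\<^sub>m n n \<and> D X = \<mu> \<cdot>\<^sub>m X)"

definition op_eigenspace :: "complex mat set \<Rightarrow> (complex mat \<Rightarrow> complex mat) \<Rightarrow> complex \<Rightarrow> complex mat set" where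
  "op_eigenspace L D \<mu> = {X \<in> L. D X = \<mu> \<cdot>\<^sub>m X}"

definition count_eig_ge :: "nat \<Rightarrow> complex mat set \<Rightarrow> (complex mat \<Rightarrow> complex mat) \<Rightarrow> real \<Rightarrow> nat" where
  "count_eig_ge n L D r = (\<Sum>\<mu> \<in> {\<mu>. op_eigenvalue n L D \<mu> \<and> r \<le> cmod \<mu>}.
       cdim_mat n (op_eigenspace L D \<mu>))"

text \<open>Magnitude of the eigenvalue of second largest magnitude (eigenvalues listed with
  multiplicity and sorted by decreasing modulus); 0 if there is no second eigenvalue.\<close>
definition second_eig_mag :: "nat \<Rightarrow> complex mat set \<Rightarrow> (complex mat \<Rightarrow> complex mat) \<Rightarrow> real" where
  "second_eig_mag n L D = Sup ({0} \<union> {r. 0 \<le> r \<and> 2 \<le> count_eig_ge n L D r})"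

text \<open>Kronecker product; the first factor is the most significant one.\<close>
definition kron :: "complex mat \<Rightarrow> complex mat \<Rightarrow> complex mat" where
  "kron A B = mat (dim_row A * dim_row B) (dim_col A * dim_col B)
     (\<lambda>(i,j). A $$ (i div dim_row B, j div dim_col B) * B $$ (i mod dim_row B, j mod dim_col B))"

definition ket0 :: "complex vec" where "ket0 = vec 2 (\<lambda>i. if i = 0 then 1 else 0)"
definition ket1 :: "complex vec" where "ket1 = vec 2 (\<lambda>i. if i = 1 then 1 else 0)"
definition ket_minus :: "complex vec" where
  "ket_minus = vec 2 (\<lambda>i. if i = 0 then 1 / sqrt 2 else - 1 / sqrt 2)"

definition hadamard :: "complex mat" where
  "hadamard = mat 2 2 (\<lambda>(i,j). if i = 1 \<and> j = 1 then - 1 / sqrt 2 else 1 / sqrt 2)"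

text \<open>Operator V (x) G acting on the system and on qubit j (0-based) of m qubits
  (layout: system (x) q_0 (x) ... (x) q_{m-1}), identity on the other qubits.\<close>
definition on_sys_qubit :: "nat \<Rightarrow> nat \<Rightarrow> complex mat \<Rightarrow> complex mat \<Rightarrow> complex mat" where
  "on_sys_qubit m j V G = kron V (kron (1\<^sub>m (2 ^ j)) (kron G (1\<^sub>m (2 ^ (m - 1 - j)))))"

definition ctrl_refl :: "nat \<Rightarrow> nat \<Rightarrow> complex vec \<Rightarrow> complex mat" where
  "ctrl_refl m j \<phi> = on_sys_qubit m j (1\<^sub>m (dim_vec \<phi>)) (ketbra ket0)
                    + on_sys_qubit m j (refl_op \<phi>) (ketbra ket1)"

definition had_on :: "nat \<Rightarrow> nat \<Rightarrow> nat \<Rightarrow> complex mat" where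
  "had_on n m j = on_sys_qubit m j (1\<^sub>m n) hadamard"

definition W_op :: "nat \<Rightarrow> nat \<Rightarrow> complex vec \<Rightarrow> complex vec \<Rightarrow> complex mat" where
  "W_op m j \<phi>k \<phi>1 = ctrl_refl m j \<phi>k * had_on (dim_vec \<phi>1) m j * ctrl_refl m j \<phi>1"

definition conj_by :: "complex mat \<Rightarrow> complex mat \<Rightarrow> complex mat" where
  "conj_by A \<sigma> = A * \<sigma> * mat_adjoint A"

fun minus_pow :: "nat \<Rightarrow> complex mat" where
  "minus_pow 0 = 1\<^sub>m 1"
| "minus_pow (Suc m) = kron (minus_pow m) (ketbra ket_minus)"

definition ptrace_sys :: "nat \<Rightarrow> complex mat \<Rightarrow> complex mat" where
  "ptrace_sys n \<sigma> = (let N = dim_row \<sigma> div n in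
     mat N N (\<lambda>(x,y). \<Sum>s<n. \<sigma> $$ (s * N + x, s * N + y)))"

definition ptrace_anc :: "nat \<Rightarrow> complex mat \<Rightarrow> complex mat" where
  "ptrace_anc N \<sigma> = (let n = dim_row \<sigma> div N in
     mat n n (\<lambda>(s,t). \<Sum>x<N. \<sigma> $$ (s * N + x, t * N + x)))"

text \<open>Output on the system for a fixed choice ks = [k_1,...,k_T] of indices.
  Qubits: a_1..a_T are qubits 0..T-1, c is qubit T.\<close>
definition procedure_out ::
  "nat \<Rightarrow> (nat \<Rightarrow> complex vec) \<Rightarrow> (nat \<Rightarrow> complex vec) \<Rightarrow> nat list \<Rightarrow> complex mat \<Rightarrow> complex mat" where
  "procedure_out n \<phi>in \<phi>out ks \<rho> = (let
     T = length ks;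
     \<comment> \<open>(i) a_1..a_T in |->, apply W^in_{a_1}(k_1), ..., W^in_{a_T}(k_T)\<close>
     \<sigma>0 = kron \<rho> (minus_pow T);
     \<sigma>1 = foldl (\<lambda>\<sigma> i. conj_by (W_op T i (\<phi>in (ks ! i)) (\<phi>in 1)) \<sigma>) \<sigma>0 [0..<T];
     \<comment> \<open>(ii) c in |->, R^in_c(1), Hadamard on c, measure c (outcome ignored)\<close>
     \<sigma>2 = kron \<sigma>1 (ketbra ket_minus);
     \<sigma>3 = conj_by (had_on n (T+1) T) (conj_by (ctrl_refl (T+1) T (\<phi>in 1)) \<sigma>2);
     \<sigma>4 = conj_by (on_sys_qubit (T+1) T (1\<^sub>m n) (ketbra ket0)) \<sigma>3
          + conj_by (on_sys_qubit (T+1) T (1\<^sub>m n) (ketbra ket1)) \<sigma>3;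
     \<comment> \<open>(iii) replace the system state by |phi^out_1>\<close>
     \<sigma>5 = kron (ketbra (\<phi>out 1)) (ptrace_sys n \<sigma>4);
     \<comment> \<open>(iv) apply W^out_{a_T}(k_T)^dagger, ..., W^out_{a_1}(k_1)^dagger\<close>
     \<sigma>6 = foldl (\<lambda>\<sigma> i. conj_by (mat_adjoint (W_op (T+1) i (\<phi>out (ks ! i)) (\<phi>out 1))) \<sigma>)
            \<sigma>5 (rev [0..<T])
   in ptrace_anc (2 ^ (T+1)) \<sigma>6)"

definition channel_E ::
  "nat \<Rightarrow> nat \<Rightarrow> nat \<Rightarrow> (nat \<Rightarrow> complex vec) \<Rightarrow> (nat \<Rightarrow> complex vec) \<Rightarrow> complex mat \<Rightarrow> complex mat" where
  "channel_E n K T \<phi>in \<phi>out \<rho> = mat n n (\<lambda>(i,j).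
     (\<Sum>ks \<in> {ks. length ks = T \<and> set ks \<subseteq> {1..K}}. procedure_out n \<phi>in \<phi>out ks \<rho> $$ (i,j))
       / of_nat K ^ T)"

definition D_map :: "nat \<Rightarrow> (nat \<Rightarrow> complex vec) \<Rightarrow> complex mat \<Rightarrow> complex mat" where
  "D_map K \<phi>in X = mat (dim_row X) (dim_col X) (\<lambda>(i,j).
     (\<Sum>k=1..K. (refl_op (\<phi>in k) * X * refl_op (\<phi>in k)) $$ (i,j)) / of_nat K)"

end

theory Submission
  imports Defs "HOL-Analysis.L2_Norm" "Jordan_Normal_Form.DL_Rank"
begin

text \<open>
  Write \<open>P\<close> for the projector onto the first input state and \<open>Q\<close> for the projector onto the input
  space, of dimension \<open>d\<close>. Applied to a fresh qubit in the minus state, one step of the procedure sends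
  \<open>s\<close> to \<open>P s\<close> (qubit \<open>0\<close>) plus \<open>R\<^sub>k (1 - P) s\<close> (qubit \<open>1\<close>). Hence, before the system is replaced, the
  joint state is \<open>\<phi>\<^sub>1 \<otimes> \<chi> + h \<otimes> |1...1>\<close>, where \<open>h\<close> is the failed branch, and undoing the steps with the
  output reflections recovers \<open>U \<rho> U\<^sup>*\<close> up to an error controlled by \<open>t = |h|\<^sup>2\<close>: the trace distance is at
  most \<open>sqrt (t (4 - 3 t)) + t\<close>, hence at most \<open>sqrt (8 t)\<close>.

  The average of \<open>t\<close> is the trace of the \<open>T\<close>-th power of the superoperator \<open>X \<mapsto> P' D (P' X P') P'\<close> with
  \<open>P' = Q - P\<close>, applied to \<open>\<rho>\<close>. The map \<open>D\<close> is self-adjoint for the Hilbert-Schmidt inner product, fixes \<open>Q\<close>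
  and has norm at most \<open>\<lambda>\<close> (its second largest eigenvalue modulus) on traceless operators. As an operator \<open>X = P' X P'\<close>
  has rank at most \<open>d - 1\<close>, its component along \<open>Q\<close> carries at most the fraction \<open>(d - 1) / d\<close> of its squared norm,
  so the compressed map has norm at most \<open>1 - (1 - \<lambda>) / d\<close>.
\<close>

section \<open>Matrix algebra and the Frobenius norm\<close>

text \<open>A mixed input is factored as \<open>V * adj V\<close>: every gate then multiplies
  \<open>V\<close> from the left, and the column index of \<open>V\<close> serves as a purifying
  system that can be attached to either tensor factor. The difference of the outputs is Hermitian,
  so its trace norm is attained at one unitary, and the average over the choices passes through this
  linear functional.

  The error grows like sqrt t while only the mean of t is controlled. So sqrt (8 t) is replaced by
  its tangent at t = eps^2 / 8, namely 4 t / eps + eps / 2, which is affine in t: a mean of at most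
  eps^2 / 8 gives eps / 2 + eps / 2. Hence the 8 in the logarithm; the d beside it pays for the
  factor sqrt d lost in passing from the trace to the Hilbert-Schmidt norm.

  The second eigenvalue concerns operators supported on the input space only, whereas the spectral
  theorem is applied to maps on all matrices. Compression by projectors reconciles the two: an
  eigenoperator of a compressed map with nonzero eigenvalue lies in the range of that map, hence in
  the right space.\<close>

abbreviation adj :: "complex mat \<Rightarrow> complex mat" where
  "adj \<equiv> mat_adjoint"

lemma dim_adj [simp]: "dim_row (adj A) = dim_col A" "dim_col (adj A) = dim_row A"
  by (auto simp: mat_adjoint_def)

lemma index_adj [simp]: "i < dim_col A \<Longrightarrow> j < dim_row A \<Longrightarrow> adj A $$ (i,j) = cnj (A $$ (j,i))"
  by (auto simp: mat_adjoint_def mat_of_rows_def)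

lemma adj_carrier [simp]: "A \<in> carrier_mat n m \<Longrightarrow> adj A \<in> carrier_mat m n"
  by (auto intro!: carrier_matI)

lemma index_mult_sum:
  "i < dim_row A \<Longrightarrow> j < dim_col B \<Longrightarrow> dim_col A = dim_row B \<Longrightarrow>
   (A * B) $$ (i,j) = (\<Sum>k<dim_row B. A $$ (i,k) * B $$ (k,j))"
  by (auto simp: scalar_prod_def lessThan_atLeast0 intro!: sum.cong)

lemma adj_adj [simp]: "adj (adj A) = A"
  by (rule eq_matI) auto

lemma adj_mult: "dim_col A = dim_row B \<Longrightarrow> adj (A * B) = adj B * adj A"
  by (rule eq_matI) (auto simp: index_mult_sum mult.commute simp del: index_mult_mat(1) intro!: sum.cong)

lemma adj_add: "dim_row A = dim_row B \<Longrightarrow> dim_col A = dim_col B \<Longrightarrow> adj (A + B) = adj A + adj B"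
  by (rule eq_matI) auto

lemma adj_minus: "dim_row A = dim_row B \<Longrightarrow> dim_col A = dim_col B \<Longrightarrow> adj (A - B) = adj A - adj B"
  by (rule eq_matI) auto

lemma adj_smult: "adj (c \<cdot>\<^sub>m A) = cnj c \<cdot>\<^sub>m adj A"
  by (rule eq_matI) auto

lemma adj_one [simp]: "adj (1\<^sub>m n) = 1\<^sub>m n"
  by (rule eq_matI) auto

lemma adj_zero [simp]: "adj (0\<^sub>m n m) = 0\<^sub>m m n"
  by (rule eq_matI) auto

text \<open>Associativity and distributivity with dimension equations instead of carrier sets as
  premises, so that the simplifier can discharge them.\<close>

lemma mult_assoc_dim:
  fixes A B C :: "complex mat"
  shows "dim_col A = dim_row B \<Longrightarrow> dim_col B = dim_row C \<Longrightarrow> A * B * C = A * (B * C)"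
  by (rule assoc_mult_mat[of _ "dim_row A" "dim_row B" _ "dim_row C" _ "dim_col C"]) auto

lemma mult_add_dim:
  fixes A B C :: "complex mat"
  shows "dim_col A = dim_row B \<Longrightarrow> dim_row C = dim_row B \<Longrightarrow> dim_col C = dim_col B \<Longrightarrow>
    A * (B + C) = A * B + A * C"
  by (rule mult_add_distrib_mat[of _ "dim_row A" "dim_row B" _ "dim_col B"]) auto

lemma add_mult_dim:
  fixes A B C :: "complex mat"
  shows "dim_col A = dim_row C \<Longrightarrow> dim_row A = dim_row B \<Longrightarrow> dim_col A = dim_col B \<Longrightarrow>
    (A + B) * C = A * C + B * C"
  by (rule add_mult_distrib_mat[of _ "dim_row A" "dim_row C" _ _ "dim_col C"]) auto

lemma mult_minus_dim:
  fixes A B C :: "complex mat"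
  shows "dim_col A = dim_row B \<Longrightarrow> dim_row C = dim_row B \<Longrightarrow> dim_col C = dim_col B \<Longrightarrow>
    A * (B - C) = A * B - A * C"
  by (rule mult_minus_distrib_mat[of _ "dim_row A" "dim_row B" _ "dim_col B"]) auto

lemma minus_mult_dim:
  fixes A B C :: "complex mat"
  shows "dim_col A = dim_row C \<Longrightarrow> dim_row A = dim_row B \<Longrightarrow> dim_col A = dim_col B \<Longrightarrow>
    (A - B) * C = A * C - B * C"
  by (rule minus_mult_distrib_mat[of _ "dim_row A" "dim_row C" _ _ "dim_col C"]) auto

lemma smult_mult_dim:
  fixes A B :: "complex mat"
  shows "dim_col A = dim_row B \<Longrightarrow> (c \<cdot>\<^sub>m A) * B = c \<cdot>\<^sub>m (A * B)"
  by (rule mult_smult_assoc_mat[of _ "dim_row A" "dim_row B" _ "dim_col B"]) auto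

lemma mult_smult_dim:
  fixes A B :: "complex mat"
  shows "dim_col A = dim_row B \<Longrightarrow> A * (c \<cdot>\<^sub>m B) = c \<cdot>\<^sub>m (A * B)"
  by (rule mult_smult_distrib[of _ "dim_row A" "dim_row B" _ "dim_col B"]) auto

lemma mult_one_dim [simp]:
  fixes A :: "complex mat"
  shows "dim_col A = n \<Longrightarrow> A * 1\<^sub>m n = A"
  by (auto intro!: right_mult_one_mat)

lemma mult_zero_dim [simp]:
  fixes A :: "complex mat"
  shows "dim_col A = m \<Longrightarrow> A * 0\<^sub>m m n = 0\<^sub>m (dim_row A) n"
  by (auto intro!: right_mult_zero_mat)

lemmas mat_dim_simps = mult_assoc_dim mult_add_dim add_mult_dim mult_minus_dim minus_mult_dim
  smult_mult_dim mult_smult_dim adj_mult adj_add adj_minus adj_smult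

section \<open>The trace and the Hilbert-Schmidt inner product\<close>

lemma mtrace_mult:
  assumes "dim_col A = dim_row B" "dim_col B = dim_row A"
  shows "mtrace (A * B) = (\<Sum>i<dim_row A. \<Sum>k<dim_row B. A $$ (i,k) * B $$ (k,i))"
  using assms by (auto simp: mtrace_def index_mult_sum simp del: index_mult_mat(1) intro!: sum.cong)

lemma mtrace_comm:
  assumes "dim_col A = dim_row B" "dim_col B = dim_row A"
  shows "mtrace (A * B) = mtrace (B * A)"
  using assms by (simp add: mtrace_mult mult.commute) (rule sum.swap)

lemma mtrace_add: "dim_row A = dim_row B \<Longrightarrow> dim_col A = dim_row B \<Longrightarrow> dim_col B = dim_row B \<Longrightarrow>
    mtrace (A + B) = mtrace A + mtrace B"
  by (auto simp: mtrace_def sum.distrib)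

lemma mtrace_minus: "dim_row A = dim_row B \<Longrightarrow> dim_col A = dim_row B \<Longrightarrow> dim_col B = dim_row B \<Longrightarrow>
    mtrace (A - B) = mtrace A - mtrace B"
  by (auto simp: mtrace_def sum_subtractf)

lemma mtrace_smult: "dim_col A = dim_row A \<Longrightarrow> mtrace (c \<cdot>\<^sub>m A) = c * mtrace A"
  by (auto simp: mtrace_def sum_distrib_left)

lemma mtrace_adj: "dim_col A = dim_row A \<Longrightarrow> mtrace (adj A) = cnj (mtrace A)"
  by (auto simp: mtrace_def)

lemma mtrace_one [simp]: "mtrace (1\<^sub>m n) = of_nat n"
  by (auto simp: mtrace_def)

text \<open>The Hilbert-Schmidt norm, phrased with \<open>L2_set\<close> so that Cauchy-Schwarz is
  inherited. It serves operators, single kets and factors of states alike, hence rectangular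
  matrices.\<close>

definition frob :: "complex mat \<Rightarrow> real" where
  "frob A = L2_set (\<lambda>p. cmod (A $$ p)) ({..<dim_row A} \<times> {..<dim_col A})"

lemma frob_nonneg [simp]: "0 \<le> frob A"
  by (simp add: frob_def)

lemma mtrace_adj_mult:
  assumes "dim_row A = dim_row B" "dim_col A = dim_col B"
  shows "mtrace (adj A * B) = (\<Sum>p\<in>{..<dim_row A} \<times> {..<dim_col A}. cnj (A $$ p) * B $$ p)"
proof -
  have "mtrace (adj A * B) = (\<Sum>i<dim_col A. \<Sum>k<dim_row A. cnj (A $$ (k,i)) * B $$ (k,i))"
    using assms by (subst mtrace_mult) (auto intro!: sum.cong)
  also have "\<dots> = (\<Sum>k<dim_row A. \<Sum>i<dim_col A. cnj (A $$ (k,i)) * B $$ (k,i))"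
    by (rule sum.swap)
  finally show ?thesis
    by (simp add: sum.cartesian_product case_prod_beta)
qed

lemma mtrace_adj_self: "mtrace (adj A * A) = of_real ((frob A)\<^sup>2)"
  by (simp add: mtrace_adj_mult frob_def L2_set_def sum_nonneg complex_norm_square mult.commute del: of_real_power)

lemma frob_sq: "(frob A)\<^sup>2 = Re (mtrace (adj A * A))"
  by (simp add: mtrace_adj_self)

lemma frob_cauchy_schwarz:
  assumes "dim_row A = dim_row B" "dim_col A = dim_col B"
  shows "cmod (mtrace (adj A * B)) \<le> frob A * frob B"
proof -
  let ?I = "{..<dim_row A} \<times> {..<dim_col A}"
  have "cmod (mtrace (adj A * B)) \<le> (\<Sum>p\<in>?I. \<bar>cmod (A $$ p)\<bar> * \<bar>cmod (B $$ p)\<bar>)"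
    unfolding mtrace_adj_mult[OF assms] 
    by (rule order_trans[OF norm_sum]) (auto simp: norm_mult)
  also have "\<dots> \<le> frob A * frob B"
    unfolding frob_def assms by (rule L2_set_mult_ineq)
  finally show ?thesis .
qed

lemma frob_zero_iff: "frob A = 0 \<longleftrightarrow> A = 0\<^sub>m (dim_row A) (dim_col A)"
  by (auto simp: frob_def L2_set_eq_0_iff intro!: eq_matI) (metis index_zero_mat(1))

lemma frob_isometry:
  assumes "dim_col W = dim_row X" "adj W * W = 1\<^sub>m (dim_col W)"
  shows "frob (W * X) = frob X"
proof -
  have "adj (W * X) * (W * X) = adj X * (adj W * W) * X"
    using assms(1) by (simp add: mat_dim_simps)
  then have "(frob (W * X))\<^sup>2 = (frob X)\<^sup>2"
    using assms by (simp add: frob_sq)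
  then show ?thesis by simp
qed

lemma frob_adj [simp]: "frob (adj X) = frob X"
proof -
  have "(frob (adj X))\<^sup>2 = (frob X)\<^sup>2"
    unfolding frob_sq by (subst mtrace_comm) auto
  then show ?thesis by simp
qed

text \<open>For a projector the squared norm of \<open>Q * X\<close> is the inner product of
  \<open>X\<close> with \<open>Q * X\<close>. Cauchy-Schwarz then leaves a common factor
  \<open>frob (Q * X)\<close> to cancel, which is why the vanishing case is split off.\<close>

lemma frob_proj_le:
  assumes "dim_col Q = dim_row X" "dim_row Q = dim_row X" "adj Q = Q" "Q * Q = Q"
  shows "frob (Q * X) \<le> frob X"
proof (cases "frob (Q * X) = 0")
  case False
  have "adj (Q * X) * (Q * X) = adj X * (Q * Q) * X"
    using assms(1,2,3) by (simp add: mat_dim_simps)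
  then have "adj (Q * X) * (Q * X) = adj X * (Q * X)"
    using assms by (simp add: mat_dim_simps)
  then have "(frob (Q * X))\<^sup>2 \<le> cmod (mtrace (adj X * (Q * X)))"
    unfolding frob_sq by (simp add: complex_Re_le_cmod)
  also have "\<dots> \<le> frob X * frob (Q * X)"
    using assms by (intro frob_cauchy_schwarz) auto
  finally show ?thesis
    using False frob_nonneg[of "Q * X"] by (simp add: power2_eq_square)
qed auto

text \<open>Cauchy-Schwarz for each entry, then summation. Its purpose is the bound
  \<open>frob \<rho> \<le> 1\<close> for a state \<open>\<rho> = V * adj V\<close> with
  \<open>frob V = 1\<close>.\<close>

lemma frob_mult_le:
  assumes "dim_col A = dim_row B"
  shows "frob (A * B) \<le> frob A * frob B"
proof -
  have *: "(cmod ((A * B) $$ (i,j)))\<^sup>2 \<le> (\<Sum>k<dim_row B. (cmod (A $$ (i,k)))\<^sup>2) * (\<Sum>k<dim_row B. (cmod (B $$ (k,j)))\<^sup>2)"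
    if "i < dim_row A" "j < dim_col B" for i j
  proof -
    have "cmod ((A * B) $$ (i,j)) \<le> (\<Sum>k<dim_row B. \<bar>cmod (A $$ (i,k))\<bar> * \<bar>cmod (B $$ (k,j))\<bar>)"
      using that assms
      by (subst index_mult_sum) (auto simp: norm_mult intro!: order_trans[OF norm_sum])
    also have "\<dots> \<le> L2_set (\<lambda>k. cmod (A $$ (i,k))) {..<dim_row B} * L2_set (\<lambda>k. cmod (B $$ (k,j))) {..<dim_row B}"
      by (rule L2_set_mult_ineq)
    finally have "(cmod ((A * B) $$ (i,j)))\<^sup>2 \<le> (\<dots>)\<^sup>2"
      by (rule power_mono) auto
    then show ?thesis
      by (simp add: L2_set_def power_mult_distrib sum_nonneg)
  qed
  have sq: "(frob X)\<^sup>2 = (\<Sum>i<dim_row X. \<Sum>j<dim_col X. (cmod (X $$ (i,j)))\<^sup>2)" for X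
    by (simp add: frob_def L2_set_def sum_nonneg sum.cartesian_product case_prod_beta)
  have "(frob (A * B))\<^sup>2 \<le> (\<Sum>i<dim_row A. \<Sum>j<dim_col B. (\<Sum>k<dim_row B. (cmod (A $$ (i,k)))\<^sup>2) * (\<Sum>k<dim_row B. (cmod (B $$ (k,j)))\<^sup>2))"
    unfolding sq using * by (auto simp del: index_mult_mat(1) intro!: sum_mono)
  also have "\<dots> = (\<Sum>i<dim_row A. \<Sum>k<dim_row B. (cmod (A $$ (i,k)))\<^sup>2) * (\<Sum>j<dim_col B. \<Sum>k<dim_row B. (cmod (B $$ (k,j)))\<^sup>2)"
    by (simp add: sum_product)
  also have "(\<Sum>j<dim_col B. \<Sum>k<dim_row B. (cmod (B $$ (k,j)))\<^sup>2) = (frob B)\<^sup>2"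
    unfolding sq by (rule sum.swap)
  also have "(\<Sum>i<dim_row A. \<Sum>k<dim_row B. (cmod (A $$ (i,k)))\<^sup>2) = (frob A)\<^sup>2"
    unfolding sq assms ..
  finally show ?thesis
    by (metis frob_nonneg mult_nonneg_nonneg power2_le_imp_le power_mult_distrib)
qed

section \<open>The spectral theorem for Hermitian matrices\<close>

definition rdiag :: "nat \<Rightarrow> (nat \<Rightarrow> real) \<Rightarrow> complex mat" where
  "rdiag n f = mat n n (\<lambda>(i,j). if i = j then complex_of_real (f i) else 0)"

lemma dim_rdiag [simp]: "dim_row (rdiag n f) = n" "dim_col (rdiag n f) = n"
  by (simp_all add: rdiag_def)

lemma index_rdiag [simp]:
  "i < n \<Longrightarrow> j < n \<Longrightarrow> rdiag n f $$ (i,j) = (if i = j then complex_of_real (f i) else 0)"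
  by (simp add: rdiag_def)

lemma adj_rdiag [simp]: "adj (rdiag n f) = rdiag n f"
  by (rule eq_matI) auto

lemma rdiag_mult [simp]: "rdiag n f * rdiag n g = rdiag n (\<lambda>i. f i * g i)"
proof (rule eq_matI)
  fix i j assume ij: "i < dim_row (rdiag n (\<lambda>i. f i * g i))" "j < dim_col (rdiag n (\<lambda>i. f i * g i))"
  then have "(rdiag n f * rdiag n g) $$ (i,j) =
      (\<Sum>k<n. if i = k then complex_of_real (f i) * rdiag n g $$ (i,j) else 0)"
    by (subst index_mult_sum) (auto simp del: sum.delta sum.delta' intro!: sum.cong)
  also have "\<dots> = rdiag n (\<lambda>i. f i * g i) $$ (i,j)"
    using ij by simp
  finally show "(rdiag n f * rdiag n g) $$ (i,j) = rdiag n (\<lambda>i. f i * g i) $$ (i,j)" .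
qed auto

lemma cscalar_self: "v \<bullet>c v = complex_of_real (\<Sum>i<dim_vec v. (cmod (v $ i))\<^sup>2)"
  for v :: "complex vec"
  by (simp add: scalar_prod_def complex_norm_square lessThan_atLeast0 del: of_real_power)

text \<open>Gram-Schmidt delivers orthogonal but unnormalised vectors. The scaling factors are
  exposed as nonzero so that the original vectors can be recovered from the columns.\<close>

lemma orthonormalize:
  fixes us :: "complex vec list"
  assumes us: "set us \<subseteq> carrier_vec n" "corthogonal us"
  obtains c where "\<And>i. i < length us \<Longrightarrow> c i \<noteq> (0 :: complex)"
    "adj (mat_of_cols n (map (\<lambda>i. c i \<cdot>\<^sub>v us ! i) [0..<length us])) *
       mat_of_cols n (map (\<lambda>i. c i \<cdot>\<^sub>v us ! i) [0..<length us]) = 1\<^sub>m (length us)"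
proof
  define s where "s u = (\<Sum>i<dim_vec u. (cmod (u $ i))\<^sup>2)" for u :: "complex vec"
  define c where "c i = complex_of_real (1 / sqrt (s (us ! i)))" for i
  let ?P = "mat_of_cols n (map (\<lambda>i. c i \<cdot>\<^sub>v us ! i) [0..<length us])"
  have s: "us ! i \<bullet>c us ! i = complex_of_real (s (us ! i))" for i
    by (simp add: cscalar_self s_def)
  have s0: "0 < s (us ! i)" if "i < length us" for i
  proof -
    have "s (us ! i) \<noteq> 0"
      using corthogonalD[OF us(2) that that] s[of i] by auto
    moreover have "0 \<le> s (us ! i)" by (simp add: s_def sum_nonneg)
    ultimately show ?thesis by simp
  qed
  show "c i \<noteq> 0" if "i < length us" for i
    using s0[OF that] by (simp add: c_def)
  have dv: "dim_vec (us ! i) = n" if "i < length us" for i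
    using us(1) that by (metis carrier_vecD nth_mem subsetD)
  show "adj ?P * ?P = 1\<^sub>m (length us)"
  proof (rule eq_matI)
    fix i j assume ij: "i < dim_row (1\<^sub>m (length us))" "j < dim_col (1\<^sub>m (length us))"
    have "(adj ?P * ?P) $$ (i,j) = (\<Sum>k<n. cnj (c i * us ! i $ k) * (c j * us ! j $ k))"
      using ij dv by (subst index_mult_sum) (auto simp: mat_of_cols_def)
    also have "\<dots> = cnj (c i) * c j * (\<Sum>k<n. us ! j $ k * cnj (us ! i $ k))"
      by (simp add: sum_distrib_left mult_ac)
    also have "(\<Sum>k<n. us ! j $ k * cnj (us ! i $ k)) = us ! j \<bullet>c us ! i"
      using ij dv by (simp add: scalar_prod_def lessThan_atLeast0)
    also have "cnj (c i) * c j * (us ! j \<bullet>c us ! i) = 1\<^sub>m (length us) $$ (i,j)"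
    proof (cases "i = j")
      case True
      have "(1 / sqrt (s (us ! i))) * (1 / sqrt (s (us ! i))) * s (us ! i) = 1"
        using s0[of i] ij by simp
      then show ?thesis using ij True
        unfolding s c_def True by (simp flip: of_real_mult)
    next
      case False
      then show ?thesis using ij corthogonalD[OF us(2), of j i] by simp
    qed
    finally show "(adj ?P * ?P) $$ (i,j) = 1\<^sub>m (length us) $$ (i,j)" .
  qed auto
qed

text \<open>Supplies the change of basis for one deflation step. Gram-Schmidt leaves the head of the
  list unchanged, so the first column stays proportional to \<open>v\<close>.\<close>

lemma unitary_first_col:
  assumes v: "v \<in> carrier_vec n" "v \<noteq> 0\<^sub>v n"
  obtains W c where "W \<in> carrier_mat n n" "adj W * W = 1\<^sub>m n" "W * adj W = 1\<^sub>m n"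
    "col W 0 = c \<cdot>\<^sub>v v"
proof -
  interpret cof_vec_space n "TYPE(complex)" .
  let ?b = "basis_completion v"
  let ?us = "gram_schmidt n ?b"
  note bc = basis_completion[OF v]
  have len: "length ?b = n" by (rule basis_completion(6)[OF v])
  have n: "n > 0" using v by (metis carrier_vecD dim_vec eq_vecI gr0I index_zero_vec(2) not_less_zero)
  obtain vs where b: "?b = v # vs"
    by (auto simp: basis_completion_def Let_def)
  note gs = gram_schmidt_result[OF bc(2,4,5) refl]
  have hd: "hd ?us = v"
    unfolding b by (rule gram_schmidt_hd) (rule v)
  obtain c where c: "adj (mat_of_cols n (map (\<lambda>i. c i \<cdot>\<^sub>v ?us ! i) [0..<length ?us])) *
       mat_of_cols n (map (\<lambda>i. c i \<cdot>\<^sub>v ?us ! i) [0..<length ?us]) = 1\<^sub>m (length ?us)"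
    using orthonormalize[OF gs(3,2)] by blast
  let ?W = "mat_of_cols n (map (\<lambda>i. c i \<cdot>\<^sub>v ?us ! i) [0..<length ?us])"
  have W: "?W \<in> carrier_mat n n"
    using gs(4) len by (auto intro!: carrier_matI)
  have "?W * adj ?W = 1\<^sub>m n"
    using mat_mult_left_right_inverse[of "adj ?W" n ?W] W c gs(4) len by auto
  moreover have "col ?W 0 = c 0 \<cdot>\<^sub>v v"
  proof -
    have "?us \<noteq> []" using gs(4) len n by auto
    then have "?us ! 0 = v" using hd hd_conv_nth[of ?us] by simp
    then show ?thesis
      using n gs(3,4) len v(1) by (subst col_mat_of_cols) auto
  qed
  ultimately show ?thesis
    using that[of ?W "c 0"] W c gs(4) len by auto
qed

lemma block_diag_mult:
  fixes A B C D :: "complex mat"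
  assumes "A \<in> carrier_mat k k" "B \<in> carrier_mat m m" "C \<in> carrier_mat k k" "D \<in> carrier_mat m m"
  shows "four_block_mat A (0\<^sub>m k m) (0\<^sub>m m k) B * four_block_mat C (0\<^sub>m k m) (0\<^sub>m m k) D
    = four_block_mat (A * C) (0\<^sub>m k m) (0\<^sub>m m k) (B * D)"
  using assms
  by (subst mult_four_block_mat[of _ k k _ m _ m _ _ k _ m]) auto

text \<open>Deflation: in a unitary basis starting with an eigenvector, the first column of the
  matrix is a multiple of the first unit vector; being Hermitian, the matrix has the same kind of
  first row, and the remaining block is Hermitian and smaller.\<close>

theorem hermitian_spectral:
  assumes "A \<in> carrier_mat n n" "adj A = A"
  obtains P d where "P \<in> carrier_mat n n" "adj P * P = 1\<^sub>m n" "P * adj P = 1\<^sub>m n"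
    "A = P * rdiag n d * adj P"
proof -
  have "\<exists>P d. P \<in> carrier_mat n n \<and> adj P * P = 1\<^sub>m n \<and> P * adj P = 1\<^sub>m n \<and> A = P * rdiag n d * adj P"
    using assms
  proof (induction n arbitrary: A)
    case 0
    then have "A = 1\<^sub>m 0 * rdiag 0 (\<lambda>_. 0) * adj (1\<^sub>m 0)"
      by (intro eq_matI) auto
    then show ?case by (intro exI[of _ "1\<^sub>m 0"] exI[of _ "\<lambda>_. 0"]) auto
  next
    case (Suc m)
    let ?n = "Suc m"
    note A = Suc.prems
    have "degree (char_poly A) = ?n" by (rule degree_monic_char_poly[OF A(1), THEN conjunct1])
    then obtain e where "poly (char_poly A) e = 0"
      using fundamental_theorem_of_algebra[of "char_poly A"] constant_degree[of "char_poly A"] by auto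
    then obtain v where "eigenvector A v e"
      using eigenvalue_root_char_poly[OF A(1)] by (auto simp: eigenvalue_def)
    then have v: "v \<in> carrier_vec ?n" "v \<noteq> 0\<^sub>v ?n" "A *\<^sub>v v = e \<cdot>\<^sub>v v"
      using A by (auto simp: eigenvector_def)
    obtain W c where W: "W \<in> carrier_mat ?n ?n" "adj W * W = 1\<^sub>m ?n" "W * adj W = 1\<^sub>m ?n"
      and c: "col W 0 = c \<cdot>\<^sub>v v"
      by (rule unitary_first_col[OF v(1,2)])
    define B where "B = adj W * A * W"
    have dims [simp]: "dim_row W = ?n" "dim_col W = ?n" "dim_row A = ?n" "dim_col A = ?n"
      "dim_row B = ?n" "dim_col B = ?n"
      using A W by (auto simp: B_def)
    have adjB: "adj B = B"
      using A by (simp add: B_def mat_dim_simps)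
    have colB: "col B 0 = e \<cdot>\<^sub>v unit_vec ?n 0"
    proof -
      have "col B 0 = adj W *\<^sub>v (A *\<^sub>v col W 0)"
      proof -
        have "A * W \<in> carrier_mat ?n ?n" "adj W \<in> carrier_mat ?n ?n" using A W by auto
        then have "col (adj W * (A * W)) 0 = adj W *\<^sub>v col (A * W) 0"
          by (intro col_mult2) auto
        also have "col (A * W) 0 = A *\<^sub>v col W 0"
          using A W by (intro col_mult2) auto
        finally show ?thesis by (simp add: B_def mult_assoc_dim)
      qed
      also have "A *\<^sub>v col W 0 = e \<cdot>\<^sub>v col W 0"
        using v A unfolding c by (simp add: mult_mat_vec smult_smult_assoc mult.commute)
      also have "adj W *\<^sub>v (e \<cdot>\<^sub>v col W 0) = e \<cdot>\<^sub>v (adj W *\<^sub>v col W 0)"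
        by (rule mult_mat_vec[of _ ?n ?n]) (use W in \<open>auto intro!: carrier_vecI\<close>)
      also have "adj W *\<^sub>v col W 0 = col (adj W * W) 0"
        by (rule col_mult2[symmetric, of _ ?n ?n _ ?n]) (use W in auto)
      finally show ?thesis using W by simp
    qed
    have B0: "B $$ (i,0) = (if i = 0 then e else 0)" if "i < ?n" for i
      using arg_cong[OF colB, of "\<lambda>v. v $ i"] that by (auto simp: unit_vec_def)
    have B0': "B $$ (0,i) = (if i = 0 then e else 0)" if "i < ?n" for i
    proof -
      have "B $$ (0,i) = adj B $$ (0,i)" by (simp add: adjB)
      also have "\<dots> = cnj (B $$ (i,0))" using that by simp
      finally show ?thesis using that B0[of 0] B0[of i] by auto
    qed
    \<comment> \<open>As a diagonal entry of a Hermitian matrix the eigenvalue is real, so it can be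
      stored in \<open>rdiag\<close>.\<close>
    have "e = cnj e"
      using B0[of 0] arg_cong[OF adjB, of "\<lambda>M. M $$ (0,0)"] by simp
    then obtain r where e: "e = complex_of_real r"
      by (metis Reals_cases Reals_cnj_iff)
    define C where "C = mat m m (\<lambda>(i,j). B $$ (Suc i, Suc j))"
    have "cnj (B $$ (Suc j, Suc i)) = B $$ (Suc i, Suc j)" if "i < m" "j < m" for i j
      using index_adj[of "Suc i" B "Suc j"] that unfolding adjB by simp
    then have "adj C = C"
      by (intro eq_matI) (auto simp: C_def)
    then obtain P d where P: "P \<in> carrier_mat m m" "adj P * P = 1\<^sub>m m" "P * adj P = 1\<^sub>m m"
      and C: "C = P * rdiag m d * adj P"
      using Suc.IH[of C] by (auto simp: C_def)
    have [simp]: "dim_row P = m" "dim_col P = m" using P by auto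
    let ?e = "mat 1 1 (\<lambda>_. e)"
    let ?P = "four_block_mat (1\<^sub>m 1) (0\<^sub>m 1 m) (0\<^sub>m m 1) P"
    let ?d = "\<lambda>i. case i of 0 \<Rightarrow> r | Suc j \<Rightarrow> d j"
    have Bblock: "B = four_block_mat ?e (0\<^sub>m 1 m) (0\<^sub>m m 1) C"
    proof (rule eq_matI)
      fix i j assume "i < dim_row (four_block_mat ?e (0\<^sub>m 1 m) (0\<^sub>m m 1) C)"
        "j < dim_col (four_block_mat ?e (0\<^sub>m 1 m) (0\<^sub>m m 1) C)"
      then show "B $$ (i,j) = four_block_mat ?e (0\<^sub>m 1 m) (0\<^sub>m m 1) C $$ (i,j)"
        using B0[of i] B0'[of j] by (cases i; cases j) (auto simp: C_def)
    qed (auto simp: C_def)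
    have adjP: "adj ?P = four_block_mat (1\<^sub>m 1) (0\<^sub>m 1 m) (0\<^sub>m m 1) (adj P)"
      by (rule eq_matI) auto
    have D: "rdiag ?n ?d = four_block_mat ?e (0\<^sub>m 1 m) (0\<^sub>m m 1) (rdiag m d)"
    proof (rule eq_matI)
      fix i j assume "i < dim_row (four_block_mat ?e (0\<^sub>m 1 m) (0\<^sub>m m 1) (rdiag m d))"
        "j < dim_col (four_block_mat ?e (0\<^sub>m 1 m) (0\<^sub>m m 1) (rdiag m d))"
      then show "rdiag ?n ?d $$ (i,j) = four_block_mat ?e (0\<^sub>m 1 m) (0\<^sub>m m 1) (rdiag m d) $$ (i,j)"
        using e by (cases i; cases j) auto
    qed auto
    have one: "four_block_mat (1\<^sub>m 1) (0\<^sub>m 1 m) (0\<^sub>m m 1) (1\<^sub>m m) = 1\<^sub>m ?n"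
      by simp
    note bd = block_diag_mult[of _ 1 _ m]
    have rd: "rdiag m d \<in> carrier_mat m m" by (auto intro!: carrier_matI)
    have PP: "adj ?P * ?P = 1\<^sub>m ?n" "?P * adj ?P = 1\<^sub>m ?n"
      unfolding adjP using bd[of "1\<^sub>m 1" "adj P" "1\<^sub>m 1" P] bd[of "1\<^sub>m 1" P "1\<^sub>m 1" "adj P"] P one
      by simp_all
    have B: "B = ?P * rdiag ?n ?d * adj ?P"
      unfolding adjP Bblock C D using P rd
      
        bd[of "1\<^sub>m 1" P ?e "rdiag m d"] bd[of ?e "P * rdiag m d" "1\<^sub>m 1" "adj P"]
      by simp
    define R where "R = ?P"
    have dP [simp]: "dim_row R = ?n" "dim_col R = ?n" by (auto simp: R_def)
    note PP = PP[folded R_def] and B = B[folded R_def]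
    have "A = (W * adj W) * A * (W * adj W)"
      using W by simp
    also have "\<dots> = W * B * adj W"
      by (simp add: B_def mat_dim_simps)
    also have "\<dots> = (W * R) * rdiag ?n ?d * adj (W * R)"
      unfolding B by (simp add: mat_dim_simps)
    finally have A': "A = (W * R) * rdiag ?n ?d * adj (W * R)" .
    have "adj (W * R) * (W * R) = adj R * (adj W * W) * R"
      by (simp add: mat_dim_simps)
    also have "\<dots> = 1\<^sub>m ?n" unfolding W(2) using PP by simp
    finally have 1: "adj (W * R) * (W * R) = 1\<^sub>m ?n" .
    have "(W * R) * adj (W * R) = W * (R * adj R) * adj W"
      by (simp add: mat_dim_simps)
    also have "\<dots> = 1\<^sub>m ?n" unfolding PP using W by simp
    finally have 2: "(W * R) * adj (W * R) = 1\<^sub>m ?n" .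
    show ?case
      using A' 1 2 by (intro exI[of _ "W * R"] exI[of _ ?d]) (auto intro!: carrier_matI)
  qed
  then show ?thesis using that by blast
qed

text \<open>Turns the sum over distinct roots in \<open>trace_norm\<close> into a sum over listed
  eigenvalues: the order of a root counts how often it occurs in the list, and the two sums are
  exchanged.\<close>

lemma sum_order_roots:
  fixes c :: "nat \<Rightarrow> complex" and g :: "complex \<Rightarrow> real" and n :: nat
  defines "p \<equiv> (\<Prod>i<n. [:- c i, 1:])"
  shows "(\<Sum>\<mu> | poly p \<mu> = 0. real (order \<mu> p) * g \<mu>) = (\<Sum>i<n. g (c i))"
proof -
  have ord: "order \<mu> (\<Prod>i<m. [:- c i, 1:]) = (\<Sum>i<m. if \<mu> = c i then 1 else 0)" for \<mu> m
  proof (induction m)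
    case (Suc m)
    have "(\<Prod>i<m. [:- c i, 1:]) * [:- c m, 1:] \<noteq> 0"
      unfolding mult_eq_0_iff prod_zero_iff[OF finite_lessThan] by auto
    then have "order \<mu> ((\<Prod>i<m. [:- c i, 1:]) * [:- c m, 1:]) =
        order \<mu> (\<Prod>i<m. [:- c i, 1:]) + order \<mu> [:- c m, 1:]"
      by (rule order_mult)
    moreover have "order \<mu> [:- c m, 1:] = (if \<mu> = c m then 1 else 0)"
      using order_power_n_n[of \<mu> 1] by (auto intro!: order_0I)
    ultimately show ?case
      unfolding prod.lessThan_Suc sum.lessThan_Suc Suc by simp
  qed auto
  have roots: "{\<mu>. poly p \<mu> = 0} = c ` {..<n}"
    by (auto simp: p_def poly_prod)
  have "(\<Sum>\<mu> | poly p \<mu> = 0. real (order \<mu> p) * g \<mu>) = (\<Sum>\<mu>\<in>c ` {..<n}. \<Sum>i<n. if \<mu> = c i then g (c i) else 0)"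
    unfolding roots unfolding p_def ord
    by (auto simp: sum_distrib_right intro!: sum.cong)
  also have "\<dots> = (\<Sum>i<n. \<Sum>\<mu>\<in>c ` {..<n}. if \<mu> = c i then g (c i) else 0)"
    by (rule sum.swap)
  finally show ?thesis by simp
qed

lemma mtrace_unitary_conj:
  assumes "P \<in> carrier_mat n n" "adj P * P = 1\<^sub>m n" "B \<in> carrier_mat n n"
  shows "mtrace (P * B * adj P) = mtrace B"
proof -
  have "mtrace (P * B * adj P) = mtrace (adj P * (P * B))"
    by (rule mtrace_comm) (use assms in auto)
  also have "adj P * (P * B) = (adj P * P) * B"
    by (rule mult_assoc_dim[symmetric]) (use assms in auto)
  finally show ?thesis using assms by simp
qed

lemma conj_mult:
  assumes "P \<in> carrier_mat n n" "adj P * P = 1\<^sub>m n" "B \<in> carrier_mat n n" "C \<in> carrier_mat n n"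
  shows "(P * B * adj P) * (P * C * adj P) = P * (B * C) * adj P"
proof -
  have "(P * B * adj P) * (P * C * adj P) = P * B * (adj P * P) * (C * adj P)"
    using assms(1,3,4) by (simp add: mult_assoc_dim)
  then show ?thesis
    using assms by (simp add: mult_assoc_dim)
qed

lemma mtrace_rdiag: "mtrace (rdiag n d) = (\<Sum>i<n. complex_of_real (d i))"
  by (simp add: mtrace_def)

text \<open>\<open>Z\<close> is the sign of \<open>A\<close> in its eigenbasis, a unitary at which
  the duality between trace norm and operator norm is attained. Later estimates only have to bound
  \<open>mtrace (Z * A)\<close>, which is linear in \<open>A\<close>.\<close>

lemma trace_norm_hermitian:
  assumes A: "A \<in> carrier_mat n n" "adj A = A"
  obtains Z where "Z \<in> carrier_mat n n" "adj Z * Z = 1\<^sub>m n" "trace_norm A = Re (mtrace (Z * A))"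
proof -
  obtain P d where P: "P \<in> carrier_mat n n" "adj P * P = 1\<^sub>m n" "P * adj P = 1\<^sub>m n"
    and APD: "A = P * rdiag n d * adj P"
    using hermitian_spectral[OF A] .
  have rc: "rdiag n f \<in> carrier_mat n n" for f by (auto intro!: carrier_matI)
  note cm = conj_mult[OF P(1,2) rc rc]
  have AA: "adj A * A = P * rdiag n (\<lambda>i. d i * d i) * adj P"
    unfolding A(2) unfolding APD cm by simp
  have "similar_mat_wit (adj A * A) (rdiag n (\<lambda>i. d i * d i)) P (adj P)"
    unfolding AA using P rc by (auto simp: similar_mat_wit_def Let_def)
  then have "similar_mat (adj A * A) (rdiag n (\<lambda>i. d i * d i))"
    unfolding similar_mat_def by blast
  then have "char_poly (adj A * A) = char_poly (rdiag n (\<lambda>i. d i * d i))"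
    by (rule char_poly_similar)
  also have "\<dots> = (\<Prod>a\<leftarrow>diag_mat (rdiag n (\<lambda>i. d i * d i)). [:- a, 1:])"
    by (rule char_poly_upper_triangular[OF rc]) auto
  also have "diag_mat (rdiag n (\<lambda>i. d i * d i)) = map (\<lambda>i. complex_of_real (d i * d i)) [0..<n]"
    by (simp add: diag_mat_def)
  also have "(\<Prod>a\<leftarrow>map (\<lambda>i. complex_of_real (d i * d i)) [0..<n]. [:- a, 1:]) =
      (\<Prod>i<n. [:- complex_of_real (d i * d i), 1:])"
    unfolding map_map o_def lessThan_atLeast0
    by (subst prod.distinct_set_conv_list[symmetric]) auto
  finally have "trace_norm A = (\<Sum>i<n. sqrt (cmod (complex_of_real (d i * d i))))"
    unfolding trace_norm_def Let_def
    using sum_order_roots[where n = n and c = "\<lambda>i. complex_of_real (d i * d i)" and g = "\<lambda>\<mu>. sqrt (cmod \<mu>)"] by simp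
  then have tn: "trace_norm A = (\<Sum>i<n. \<bar>d i\<bar>)"
    by (simp add: norm_mult del: of_real_mult)
  \<comment> \<open>Zero eigenvalues get sign 1; a sign 0 would spoil unitarity.\<close>
  define s where "s i = (if d i < 0 then - 1 else 1 :: real)" for i
  define Z where "Z = P * rdiag n s * adj P"
  have Z: "Z \<in> carrier_mat n n" using P by (auto simp: Z_def)
  have "adj Z = Z"
    using P(1) by (simp add: Z_def mat_dim_simps)
  moreover have "rdiag n (\<lambda>i. s i * s i) = 1\<^sub>m n"
    by (rule eq_matI) (auto simp: s_def)
  ultimately have ZZ: "adj Z * Z = 1\<^sub>m n"
    using P by (simp add: Z_def cm)
  have "mtrace (Z * A) = (\<Sum>i<n. complex_of_real (s i * d i))"
    unfolding Z_def APD cm rdiag_mult mtrace_unitary_conj[OF P(1,2) rc] mtrace_rdiag ..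
  also have "\<dots> = complex_of_real (\<Sum>i<n. \<bar>d i\<bar>)"
    unfolding of_real_sum by (rule sum.cong) (auto simp: s_def)
  finally show ?thesis
    using that[OF Z ZZ] tn by simp
qed

text \<open>Takes \<open>V\<close> as the eigenbasis times the square roots of the eigenvalues. The
  columns of \<open>V\<close> form an ensemble of unnormalised pure states for \<open>A\<close>, so
  conjugating \<open>A\<close> by a gate amounts to multiplying \<open>V\<close> by it.\<close>

lemma psd_factor:
  assumes A: "A \<in> carrier_mat n n" "adj A = A"
    and psd: "\<And>v. v \<in> carrier_vec n \<Longrightarrow> 0 \<le> Re ((A *\<^sub>v v) \<bullet>c v)"
  obtains V where "V \<in> carrier_mat n n" "A = V * adj V"
proof -
  obtain P d where P: "P \<in> carrier_mat n n" "adj P * P = 1\<^sub>m n" "P * adj P = 1\<^sub>m n"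
    and APD: "A = P * rdiag n d * adj P"
    using hermitian_spectral[OF A] .
  have rc: "rdiag n f \<in> carrier_mat n n" for f by (auto intro!: carrier_matI)
  have d0: "0 \<le> d i" if i: "i < n" for i
  proof -
    have "adj P * (A * P) = (adj P * P) * rdiag n d * (adj P * P)"
      unfolding APD using P(1) by (simp add: mult_assoc_dim)
    \<comment> \<open>An eigenvalue is the quadratic form of \<open>A\<close> at the corresponding
      column of \<open>P\<close>, hence nonnegative.\<close>
    then have "complex_of_real (d i) = (adj P * (A * P)) $$ (i,i)"
      using P i by simp
    also have "\<dots> = (\<Sum>k<n. cnj (P $$ (k,i)) * (A *\<^sub>v col P i) $ k)"
      using P(1) A(1) i by (subst index_mult_sum) (auto intro!: sum.cong)
    also have "\<dots> = (A *\<^sub>v col P i) \<bullet>c col P i"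
      using P(1) A(1) i by (auto simp: scalar_prod_def lessThan_atLeast0 mult.commute intro!: sum.cong)
    finally have "d i = Re ((A *\<^sub>v col P i) \<bullet>c col P i)"
      by (metis Re_complex_of_real)
    also have "\<dots> \<ge> 0" using P(1) i by (intro psd) auto
    finally show ?thesis .
  qed
  have "rdiag n (\<lambda>i. sqrt (d i) * sqrt (d i)) = rdiag n d"
    by (rule eq_matI) (auto simp: d0)
  then have "rdiag n d = rdiag n (\<lambda>i. sqrt (d i)) * rdiag n (\<lambda>i. sqrt (d i))" by simp
  then have "A = (P * rdiag n (\<lambda>i. sqrt (d i))) * adj (P * rdiag n (\<lambda>i. sqrt (d i)))"
    unfolding APD using P(1) by (simp add: mat_dim_simps del: rdiag_mult)
  then show ?thesis
    using that[of "P * rdiag n (\<lambda>i. sqrt (d i))"] P(1) rc by auto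
qed

text \<open>Replaces the span by a projector whose trace is the dimension. With orthonormal columns
  in \<open>P\<close>, the matrix \<open>P * adj P\<close> is a projector, and cyclicity turns its
  trace into that of \<open>adj P * P\<close>, the identity of size \<open>card B\<close>.\<close>

lemma span_projector:
  assumes S: "finite S" "S \<subseteq> carrier_vec n"
  obtains Q where "Q \<in> carrier_mat n n" "adj Q = Q" "Q * Q = Q"
    "mtrace Q = of_nat (cdim_vec n (cspan_vec n S))"
    "\<And>v. v \<in> cspan_vec n S \<Longrightarrow> v \<in> carrier_vec n \<and> Q *\<^sub>v v = v"
    "\<And>v. v \<in> carrier_vec n \<Longrightarrow> Q *\<^sub>v v \<in> cspan_vec n S"
proof -
  interpret cof_vec_space n "TYPE(complex)" .
  have sp: "cspan_vec n S = span S" by (simp add: cspan_vec_def)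
  \<comment> \<open>Gram-Schmidt needs independent vectors, while those in \<open>S\<close> may be
    dependent; so a maximal independent subset is orthonormalised.\<close>
  obtain B where B: "finite B" "maximal B (\<lambda>T. T \<subseteq> S \<and> lin_indpt T)"
    using maximal_exists_superset[of S "\<lambda>T. T \<subseteq> S \<and> lin_indpt T" "{}"] S
    by (auto simp: lin_dep_def)
  then have BS: "B \<subseteq> S" and Bli: "lin_indpt B" by (auto simp: maximal_def)
  have Bc: "B \<subseteq> carrier_vec n" using BS S by auto
  have dim: "cdim_vec n (span S) = card B"
    unfolding cdim_vec_def using dim_span[of S B] S B by simp
  have "S \<subseteq> span B"
  proof (rule ccontr)
    assume "\<not> S \<subseteq> span B"
    then obtain s where s: "s \<in> S" "s \<notin> span B" by blast
    then have "s \<notin> B" using span_mem[OF Bc] by auto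
    moreover have "lin_indpt (B \<union> {s})"
      using lin_dep_iff_in_span[OF Bc Bli _ \<open>s \<notin> B\<close>] s S by auto
    ultimately show False
      using B(2) s BS unfolding maximal_def by (metis Un_insert_right insertI1 insert_subset subset_insertI sup_bot_right)
  qed
  then have "span S = span B"
    using span_is_subset[OF _ span_is_submodule[OF Bc]] span_is_monotone[OF BS] by auto
  obtain ws where ws: "set ws = B" "distinct ws" using finite_distinct_list[OF B(1)] by auto
  define us where "us = gram_schmidt n ws"
  have gs: "span B = span (set us)" "corthogonal us" "set us \<subseteq> carrier_vec n" "length us = card B"
    using gram_schmidt_result[of ws us] ws Bc Bli by (auto simp: us_def distinct_card)
  obtain c where c0: "\<And>i. i < length us \<Longrightarrow> c i \<noteq> (0 :: complex)"
    and c1: "adj (mat_of_cols n (map (\<lambda>i. c i \<cdot>\<^sub>v us ! i) [0..<length us])) *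
       mat_of_cols n (map (\<lambda>i. c i \<cdot>\<^sub>v us ! i) [0..<length us]) = 1\<^sub>m (length us)"
    using orthonormalize[OF gs(3,2)] by blast
  define l where "l = map (\<lambda>i. c i \<cdot>\<^sub>v us ! i) [0..<length us]"
  define P where "P = mat_of_cols n l"
  have PP: "adj P * P = 1\<^sub>m (card B)" using c1 gs(4) by (simp add: P_def l_def)
  have dP [simp]: "dim_row P = n" "dim_col P = card B" by (auto simp: P_def l_def gs)
  have Pc: "P \<in> carrier_mat n (card B)" by (auto intro!: carrier_matI)
  have usc: "us ! i \<in> carrier_vec n" if "i < length us" for i using gs(3) that by auto
  define Q where "Q = P * adj P"
  have Q: "Q \<in> carrier_mat n n" by (auto simp: Q_def intro!: carrier_matI)
  have aQ: "adj Q = Q" by (simp add: Q_def adj_mult)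
  have QP: "Q * P = P" by (simp add: Q_def mult_assoc_dim PP)
  have QQ: "Q * Q = Q" by (simp add: Q_def mult_assoc_dim[of P "adj P" "P * adj P"] PP
      mult_assoc_dim[symmetric, of "adj P" P "adj P"])
  have tQ: "mtrace Q = of_nat (card B)"
    unfolding Q_def by (subst mtrace_comm) (auto simp: PP)
  have Qus: "Q *\<^sub>v u = u" if us: "u \<in> set us" for u
  proof -
    obtain i where i: "i < length us" "u = us ! i" using us by (metis in_set_conv_nth)
    have lP: "col P i = l ! i"
      unfolding P_def by (rule col_mat_of_cols) (use i usc in \<open>simp_all add: l_def\<close>)
    have li: "l ! i = c i \<cdot>\<^sub>v u"
      using i by (simp add: l_def)
    have u: "u = (1 / c i) \<cdot>\<^sub>v col P i"
      unfolding lP li smult_smult_assoc using c0[OF i(1)] by simp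
    have cP: "col P i \<in> carrier_vec n" by (auto intro!: carrier_vecI)
    have "Q *\<^sub>v col P i = col P i"
      using col_mult2[OF Q Pc, of i] i gs(4) QP by simp
    then show ?thesis
      unfolding u mult_mat_vec[OF Q cP] by simp
  qed
  have Qfix: "v \<in> carrier_vec n \<and> Q *\<^sub>v v = v" if vS: "v \<in> span S" for v
  proof -
    obtain a where a: "v = lincomb a (set us)"
      using vS gs(1) \<open>span S = span B\<close> finite_span[OF _ gs(3)] by auto
    have vc: "v \<in> carrier_vec n" unfolding a using gs(3) by (rule lincomb_closed)
    have "(Q *\<^sub>v v) $ i = v $ i" if i: "i < n" for i
    proof -
      have "(Q *\<^sub>v v) $ i = (\<Sum>j<n. Q $$ (i,j) * (\<Sum>x\<in>set us. a x * x $ j))"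
        using i vc Q lincomb_index[OF _ gs(3), of _ a, folded a]
        by (auto simp: scalar_prod_def lessThan_atLeast0 intro!: sum.cong)
      also have "\<dots> = (\<Sum>x\<in>set us. a x * (\<Sum>j<n. Q $$ (i,j) * x $ j))"
        unfolding sum_distrib_left by (subst sum.swap) (simp add: mult_ac)
      also have "\<dots> = (\<Sum>x\<in>set us. a x * (Q *\<^sub>v x) $ i)"
        using i Q gs(3) by (auto simp: scalar_prod_def lessThan_atLeast0 intro!: sum.cong)
      also have "\<dots> = v $ i"
        using Qus lincomb_index[OF i gs(3), of a, folded a] by simp
      finally show ?thesis .
    qed
    then show ?thesis using vc Q by (auto intro!: eq_vecI)
  qed
  have Qran: "Q *\<^sub>v v \<in> span S" if v: "v \<in> carrier_vec n" for v
  proof -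
    have "Q *\<^sub>v v = P *\<^sub>v (adj P *\<^sub>v v)"
      unfolding Q_def by (rule assoc_mult_mat_vec[OF Pc]) (use v in \<open>auto intro!: carrier_matI\<close>)
    also have "\<dots> \<in> span (set l)"
    proof -
      have ll: "length l = card B" by (simp add: l_def gs)
      have lc: "l ! i \<in> carrier_vec n" if "i < length l" for i
        using that usc by (auto simp: l_def)
      then have lc': "set l \<subseteq> carrier_vec n" by (auto simp: in_set_conv_nth)
      have "P *\<^sub>v (adj P *\<^sub>v v) = lincomb (\<lambda>w. \<Sum>i = 0..<length l. if w = l ! i then (adj P *\<^sub>v v) $ i else 0) (set l)"
        unfolding P_def using lc ll by (intro mat_of_cols_mult_as_finsum carrier_vecI) (auto simp: P_def)
      then show ?thesis using finite_span[OF _ lc'] by auto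
    qed
    also have "\<dots> \<subseteq> span (set us)"
    proof (rule span_is_subset[OF _ span_is_submodule[OF gs(3)]])
      show "set l \<subseteq> span (set us)"
        using gs(3) span_mem[OF gs(3)] by (auto simp: l_def intro!: smult_in_span)
    qed
    finally show ?thesis using gs(1) \<open>span S = span B\<close> by simp
  qed
  show ?thesis
    using that[of Q] Q aQ QQ tQ Qfix Qran unfolding sp dim by auto
qed

lemma mat_mult_unit_col:
  fixes A :: "complex mat"
  assumes "A \<in> carrier_mat n m" "i < m"
  shows "A *\<^sub>v unit_vec m i = col A i"
  using assms by (intro eq_vecI) auto

lemma mult_mat_vec_proj:
  fixes Q X :: "complex mat"
  assumes Q: "Q \<in> carrier_mat n n" and X: "X \<in> carrier_mat n n"
  shows "Q * X = X \<longleftrightarrow> (\<forall>v\<in>carrier_vec n. Q *\<^sub>v (X *\<^sub>v v) = X *\<^sub>v v)"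
proof
  assume *: "\<forall>v\<in>carrier_vec n. Q *\<^sub>v (X *\<^sub>v v) = X *\<^sub>v v"
  have "(Q * X) *\<^sub>v v = X *\<^sub>v v" if "v \<in> carrier_vec n" for v
    using * that assms by (simp add: assoc_mult_mat_vec[OF Q X])
  then have "col (Q * X) i = col X i" if "i < n" for i
    using that assms mat_mult_unit_col[of "Q * X" n n i] mat_mult_unit_col[of X n n i] by fastforce
  then show "Q * X = X"
    using assms by (intro mat_col_eqI) auto
next
  assume "Q * X = X"
  then show "\<forall>v\<in>carrier_vec n. Q *\<^sub>v (X *\<^sub>v v) = X *\<^sub>v v"
    using assoc_mult_mat_vec[OF Q X] by auto
qed

text \<open>A vector lies in \<open>W\<close> exactly if \<open>Q\<close> fixes it. Hence the range
  condition on \<open>X\<close> is an equation with \<open>Q\<close> on the left, and the one on its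
  adjoint becomes, after taking adjoints, an equation with \<open>Q\<close> on the right.\<close>

lemma supported_on_iff:
  assumes Q: "Q \<in> carrier_mat n n" "adj Q = Q" "Q * Q = Q"
    and fx: "\<And>v. v \<in> W \<Longrightarrow> v \<in> carrier_vec n \<and> Q *\<^sub>v v = v"
    and ran: "\<And>v. v \<in> carrier_vec n \<Longrightarrow> Q *\<^sub>v v \<in> W"
  shows "supported_on n W X \<longleftrightarrow> X \<in> carrier_mat n n \<and> Q * X = X \<and> X * Q = X"
proof -
  have *: "(\<forall>v\<in>carrier_vec n. X *\<^sub>v v \<in> W) \<longleftrightarrow> Q * X = X" if X: "X \<in> carrier_mat n n" for X
    unfolding mult_mat_vec_proj[OF Q(1) X] using fx ran X by (metis mult_mat_vec_carrier)
  have "Q * adj X = adj X \<longleftrightarrow> X * Q = X" if "X \<in> carrier_mat n n"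
    using that Q by (metis adj_adj adj_mult carrier_matD dim_adj)
  then show ?thesis
    unfolding supported_on_def using *[of X] *[of "adj X"] by auto
qed

section \<open>Self-adjoint superoperators\<close>

lemma index_rdiag_mult:
  assumes "i < n" "j < dim_col X" "dim_row X = n"
  shows "(rdiag n d * X) $$ (i,j) = complex_of_real (d i) * X $$ (i,j)"
proof -
  have "(rdiag n d * X) $$ (i,j) = (\<Sum>k<n. if i = k then complex_of_real (d i) * X $$ (i,j) else 0)"
    using assms by (subst index_mult_sum) (auto simp del: sum.delta sum.delta' intro!: sum.cong)
  then show ?thesis using assms(1) by simp
qed

lemma frob_rdiag_mult_le:
  assumes "dim_row X = n" "\<And>i. i < n \<Longrightarrow> \<bar>d i\<bar> \<le> a" "0 \<le> a"
  shows "frob (rdiag n d * X) \<le> a * frob X"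
proof -
  have "frob (rdiag n d * X) \<le> L2_set (\<lambda>p. a * cmod (X $$ p)) ({..<n} \<times> {..<dim_col X})"
    unfolding frob_def using assms
    by (auto simp: norm_mult index_rdiag_mult simp del: index_mult_mat(1) intro!: L2_set_mono mult_right_mono)
  also have "\<dots> = a * frob X"
    unfolding frob_def using assms(1,3) by (simp add: L2_set_right_distrib)
  finally show ?thesis .
qed

text \<open>Row-by-row vectorisation. It preserves \<open>frob\<close> and turns a self-adjoint map
  on matrices into a Hermitian matrix of size \<open>n * n\<close>, to which the spectral theorem
  applies.\<close>

definition flat :: "nat \<Rightarrow> complex mat \<Rightarrow> complex mat" where
  "flat n X = mat (n * n) 1 (\<lambda>(k,_). X $$ (k div n, k mod n))"

definition unflat :: "nat \<Rightarrow> complex mat \<Rightarrow> complex mat" where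
  "unflat n y = mat n n (\<lambda>(i,j). y $$ (i * n + j, 0))"

lemma div_mod_less: "k < n * m \<Longrightarrow> k div m < n \<and> k mod m < (m :: nat)"
  by (metis less_mult_imp_div_less mod_less_divisor mult_0_right not_less_zero neq0_conv)

lemma index_less: "i < n \<Longrightarrow> j < m \<Longrightarrow> i * m + j < n * (m :: nat)"
  by (metis add_mult_distrib add_less_cancel_left less_eq_Suc_le mult_Suc mult_le_mono1 order.strict_trans2 add.commute mult.commute)

lemma flat_unflat:
  assumes "y \<in> carrier_mat (n * n) 1"
  shows "flat n (unflat n y) = y"
  using assms by (intro eq_matI) (auto simp: flat_def unflat_def div_mod_less)

lemma unflat_flat:
  assumes "X \<in> carrier_mat n n"
  shows "unflat n (flat n X) = X"
  using assms by (intro eq_matI) (auto simp: flat_def unflat_def index_less)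

lemma flat_smult: "X \<in> carrier_mat n n \<Longrightarrow> flat n (c \<cdot>\<^sub>m X) = c \<cdot>\<^sub>m flat n X"
  by (intro eq_matI) (auto simp: flat_def div_mod_less)

lemma dim_flat [simp]: "dim_row (flat n X) = n * n" "dim_col (flat n X) = 1"
  by (auto simp: flat_def)

lemma dim_unflat [simp]: "dim_row (unflat n y) = n" "dim_col (unflat n y) = n"
  by (auto simp: unflat_def)

lemma unflat_carrier [simp]: "unflat n y \<in> carrier_mat n n"
  by (auto simp: unflat_def)

lemma bij_div_mod:
  "bij_betw (\<lambda>k. (k div m, k mod m)) {..<n * m} ({..<n} \<times> {..<m :: nat})"
  by (rule bij_betw_byWitness[where f' = "\<lambda>(i,j). i * m + j"]) (auto simp: div_mod_less index_less)

lemma frob_flat: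
  assumes "X \<in> carrier_mat n n"
  shows "frob (flat n X) = frob X"
proof -
  have "(\<Sum>p\<in>{..<n * n} \<times> {..<1::nat}. (cmod (flat n X $$ p))\<^sup>2) = (\<Sum>k<n * n. (cmod (X $$ (k div n, k mod n)))\<^sup>2)"
    by (rule sum.reindex_bij_witness[of _ "\<lambda>k. (k,0)" fst]) (auto simp: flat_def)
  also have "\<dots> = (\<Sum>p\<in>{..<n} \<times> {..<n}. (cmod (X $$ p))\<^sup>2)"
    by (rule sum.reindex_bij_betw[OF bij_div_mod])
  finally show ?thesis
    using assms by (simp add: frob_def L2_set_def)
qed

locale selfadjoint_superop =
  fixes n :: nat and f :: "complex mat \<Rightarrow> complex mat"
  assumes closed: "X \<in> carrier_mat n n \<Longrightarrow> f X \<in> carrier_mat n n"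
    and add: "X \<in> carrier_mat n n \<Longrightarrow> Y \<in> carrier_mat n n \<Longrightarrow> f (X + Y) = f X + f Y"
    and smult: "X \<in> carrier_mat n n \<Longrightarrow> f (c \<cdot>\<^sub>m X) = c \<cdot>\<^sub>m f X"
    and selfadj: "X \<in> carrier_mat n n \<Longrightarrow> Y \<in> carrier_mat n n \<Longrightarrow>
      mtrace (adj Y * f X) = mtrace (adj (f Y) * X)"
begin

definition E :: "nat \<Rightarrow> complex mat" where
  "E k = mat n n (\<lambda>p. if p = (k div n, k mod n) then 1 else 0)"

lemma E_carrier [simp]: "E k \<in> carrier_mat n n"
  by (simp add: E_def)

lemma dim_E [simp]: "dim_row (E k) = n" "dim_col (E k) = n"
  by (simp_all add: E_def)

definition M :: "complex mat" where
  "M = mat (n * n) (n * n) (\<lambda>(k,l). f (E l) $$ (k div n, k mod n))"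

lemma dim_M [simp]: "dim_row M = n * n" "dim_col M = n * n"
  by (auto simp: M_def)

lemma mtrace_E:
  assumes "k < n * n" "Y \<in> carrier_mat n n"
  shows "mtrace (adj (E k) * Y) = Y $$ (k div n, k mod n)"
proof -
  have "mtrace (adj (E k) * Y) = (\<Sum>p\<in>{..<n}\<times>{..<n}. if p = (k div n, k mod n) then Y $$ p else 0)"
    using assms by (subst mtrace_adj_mult) (auto simp: E_def simp del: sum.delta sum.delta' intro!: sum.cong)
  then show ?thesis
    using div_mod_less[OF assms(1)] by simp
qed

lemma adj_M: "adj M = M"
proof (rule eq_matI)
  fix k l assume "k < dim_row M" "l < dim_col M"
  then have kl: "k < n * n" "l < n * n" by auto
  have "M $$ (k,l) = mtrace (adj (E k) * f (E l))"
    using kl by (simp add: mtrace_E closed M_def)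
  also have "\<dots> = mtrace (adj (f (E k)) * E l)"
    by (simp add: selfadj)
  also have "\<dots> = cnj (mtrace (adj (adj (f (E k)) * E l)))"
    using closed[OF E_carrier, of k] E_carrier[of l] by (subst mtrace_adj) auto
  also have "adj (adj (f (E k)) * E l) = adj (E l) * f (E k)"
    using closed[OF E_carrier, of k] E_carrier[of l] by (subst adj_mult) auto
  also have "mtrace \<dots> = f (E k) $$ (l div n, l mod n)"
    using kl by (simp add: mtrace_E closed)
  finally show "adj M $$ (k,l) = M $$ (k,l)"
    using kl by (simp add: M_def)
qed auto

lemma f_zero: "f (0\<^sub>m n n) = 0\<^sub>m n n"
proof -
  have "f (0\<^sub>m n n) = 0 \<cdot>\<^sub>m f (0\<^sub>m n n)"
    using smult[of "0\<^sub>m n n" 0] by simp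
  also have "\<dots> = 0\<^sub>m n n"
    using closed[of "0\<^sub>m n n"] by (intro eq_matI) auto
  finally show ?thesis .
qed

lemma M_mult_flat:
  assumes X: "X \<in> carrier_mat n n"
  shows "M * flat n X = flat n (f X)"
proof -
  \<comment> \<open>\<open>Y m\<close> keeps the first \<open>m\<close> entries of \<open>X\<close>
    in row order and is zero beyond, so \<open>X\<close> is reached by adding one multiple of a
    matrix unit at a time; the locale provides additivity for two summands only.\<close>
  define Y where "Y m = mat n n (\<lambda>(i,j). if i * n + j < m then X $$ (i,j) else 0)" for m
  have Yc [simp]: "Y m \<in> carrier_mat n n" for m by (simp add: Y_def)
  have fY: "f (Y m) $$ p = (\<Sum>l<m. f (E l) $$ p * X $$ (l div n, l mod n))"
    if "m \<le> n * n" "p \<in> {..<n} \<times> {..<n}" for m p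
    using that(1)
  proof (induction m)
    case 0
    have "Y 0 = 0\<^sub>m n n" by (rule eq_matI) (auto simp: Y_def)
    then show ?case using that(2) by (auto simp: f_zero)
  next
    case (Suc m)
    have "Y (Suc m) = Y m + X $$ (m div n, m mod n) \<cdot>\<^sub>m E m"
      using X Suc.prems div_mod_less[of m n n] 
      by (intro eq_matI) (auto simp: Y_def E_def less_Suc_eq)
    then have "f (Y (Suc m)) = f (Y m) + X $$ (m div n, m mod n) \<cdot>\<^sub>m f (E m)"
      by (simp add: add smult)
    then show ?case
      using Suc that(2) closed[OF E_carrier, of m] closed[OF Yc, of m] by auto
  qed
  have YX: "Y (n * n) = X"
    using X by (intro eq_matI) (auto simp: Y_def index_less)
  show ?thesis
  proof (rule eq_matI)
    fix k j assume "k < dim_row (flat n (f X))" "j < dim_col (flat n (f X))"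
    then have k: "k < n * n" "j = 0" by auto
    have "(M * flat n X) $$ (k,j) = (\<Sum>l<n * n. f (E l) $$ (k div n, k mod n) * X $$ (l div n, l mod n))"
      using k by (subst index_mult_sum) (auto simp: M_def flat_def intro!: sum.cong)
    also have "\<dots> = f (Y (n * n)) $$ (k div n, k mod n)"
      using fY[of "n * n" "(k div n, k mod n)"] div_mod_less[OF k(1)] by simp
    finally show "(M * flat n X) $$ (k,j) = flat n (f X) $$ (k,j)"
      using k by (simp add: YX flat_def)
  qed auto
qed

text \<open>The diagonal entries are eigenvalues of \<open>f\<close> itself: unflattening the
  \<open>i\<close>-th column of \<open>P\<close> gives an eigenoperator for
  \<open>d i\<close>.\<close>

lemma spectral:
  obtains P d where "P \<in> carrier_mat (n * n) (n * n)" "adj P * P = 1\<^sub>m (n * n)" "P * adj P = 1\<^sub>m (n * n)"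
    "\<And>X. X \<in> carrier_mat n n \<Longrightarrow> flat n (f X) = P * (rdiag (n * n) d * (adj P * flat n X))"
    "\<And>i. i < n * n \<Longrightarrow> \<exists>X\<in>carrier_mat n n. X \<noteq> 0\<^sub>m n n \<and> f X = complex_of_real (d i) \<cdot>\<^sub>m X"
proof -
  have Mc: "M \<in> carrier_mat (n * n) (n * n)" by (auto intro!: carrier_matI)
  obtain P d where P: "P \<in> carrier_mat (n * n) (n * n)" "adj P * P = 1\<^sub>m (n * n)" "P * adj P = 1\<^sub>m (n * n)"
    and M: "M = P * rdiag (n * n) d * adj P"
    using hermitian_spectral[OF Mc adj_M] .
  have fl: "flat n (f X) = P * (rdiag (n * n) d * (adj P * flat n X))" if "X \<in> carrier_mat n n" for X
    using P(1) unfolding M_mult_flat[OF that, symmetric] M by (simp add: mult_assoc_dim)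
  have "\<exists>X\<in>carrier_mat n n. X \<noteq> 0\<^sub>m n n \<and> f X = complex_of_real (d i) \<cdot>\<^sub>m X" if i: "i < n * n" for i
  proof -
    define u where "u = mat (n * n) 1 (\<lambda>(k,_). if k = i then 1 else 0 :: complex)"
    define y where "y = P * u"
    define X where "X = unflat n y"
    have u [simp]: "dim_row u = n * n" "dim_col u = 1" by (auto simp: u_def)
    have y: "y \<in> carrier_mat (n * n) 1" using P by (auto simp: y_def intro!: carrier_matI)
    have Py: "adj P * y = u"
      using P by (simp add: y_def mult_assoc_dim[symmetric])
    have "rdiag (n * n) d * u = complex_of_real (d i) \<cdot>\<^sub>m u"
      using i by (intro eq_matI) (auto simp: index_rdiag_mult u_def simp del: index_mult_mat(1))
    then have "flat n (f X) = complex_of_real (d i) \<cdot>\<^sub>m y"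
      using fl[of X] P flat_unflat[OF y] Py by (simp add: X_def y_def mult_smult_dim)
    also have "\<dots> = flat n (complex_of_real (d i) \<cdot>\<^sub>m X)"
      using flat_unflat[OF y] by (simp add: flat_smult X_def)
    finally have "f X = complex_of_real (d i) \<cdot>\<^sub>m X"
      using unflat_flat[OF closed, of X] unflat_flat[of "complex_of_real (d i) \<cdot>\<^sub>m X" n] by (simp add: X_def)
    moreover have "X \<noteq> 0\<^sub>m n n"
    proof
      assume "X = 0\<^sub>m n n"
      then have "y = flat n (0\<^sub>m n n)" using flat_unflat[OF y] by (simp add: X_def)
      also have "\<dots> = 0\<^sub>m (n * n) 1" by (rule eq_matI) (auto simp: flat_def div_mod_less)
      finally have "u = 0\<^sub>m (n * n) 1" using P Py by auto
      then have "u $$ (i,0) = 0" using i by simp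
      then show False using i by (simp add: u_def)
    qed
    ultimately show ?thesis by (auto simp: X_def)
  qed
  then show ?thesis using that[OF P fl] by blast
qed

text \<open>For a self-adjoint map the norm equals the spectral radius, so a norm bound need only be
  checked on eigenoperators: \<open>P\<close> and \<open>adj P\<close> are isometries, which leaves
  the diagonal factor.\<close>

lemma frob_bound:
  assumes ev: "\<And>\<mu> X. X \<in> carrier_mat n n \<Longrightarrow> X \<noteq> 0\<^sub>m n n \<Longrightarrow> f X = \<mu> \<cdot>\<^sub>m X \<Longrightarrow> cmod \<mu> \<le> a"
    and a: "0 \<le> a" and X: "X \<in> carrier_mat n n"
  shows "frob (f X) \<le> a * frob X"
proof -
  obtain P d where P: "P \<in> carrier_mat (n * n) (n * n)" "adj P * P = 1\<^sub>m (n * n)" "P * adj P = 1\<^sub>m (n * n)"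
    and fl: "\<And>X. X \<in> carrier_mat n n \<Longrightarrow> flat n (f X) = P * (rdiag (n * n) d * (adj P * flat n X))"
    and d: "\<And>i. i < n * n \<Longrightarrow> \<exists>X\<in>carrier_mat n n. X \<noteq> 0\<^sub>m n n \<and> f X = complex_of_real (d i) \<cdot>\<^sub>m X"
    using spectral by blast
  have da: "\<bar>d i\<bar> \<le> a" if "i < n * n" for i
    using d[OF that] ev by (metis norm_of_real)
  have "frob (f X) = frob (flat n (f X))" using frob_flat closed X by simp
  also have "\<dots> = frob (rdiag (n * n) d * (adj P * flat n X))"
    unfolding fl[OF X] by (rule frob_isometry) (use P in auto)
  also have "\<dots> \<le> a * frob (adj P * flat n X)"
    by (rule frob_rdiag_mult_le) (use P da a in auto)
  also have "frob (adj P * flat n X) = frob X"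
    using frob_isometry[of "adj P" "flat n X"] P frob_flat[OF X] by simp
  finally show ?thesis .
qed

text \<open>Guards the sum in \<open>count_eig_ge\<close>, which would be 0 over an infinite index
  set. In the eigenbasis the coordinates \<open>z\<close> of an eigenoperator satisfy
  \<open>d i * z = \<mu> * z\<close>, so \<open>\<mu>\<close> is one of the
  \<open>d i\<close>.\<close>

lemma finite_eigenvalues: "finite {\<mu>. \<exists>X\<in>carrier_mat n n. X \<noteq> 0\<^sub>m n n \<and> f X = \<mu> \<cdot>\<^sub>m X}"
proof -
  obtain P d where P: "P \<in> carrier_mat (n * n) (n * n)" "adj P * P = 1\<^sub>m (n * n)" "P * adj P = 1\<^sub>m (n * n)"
    and fl: "\<And>X. X \<in> carrier_mat n n \<Longrightarrow> flat n (f X) = P * (rdiag (n * n) d * (adj P * flat n X))"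
    and "\<And>i. i < n * n \<Longrightarrow> \<exists>X\<in>carrier_mat n n. X \<noteq> 0\<^sub>m n n \<and> f X = complex_of_real (d i) \<cdot>\<^sub>m X"
    using spectral by blast
  have "\<mu> \<in> (\<lambda>i. complex_of_real (d i)) ` {..<n * n}"
    if X: "X \<in> carrier_mat n n" "X \<noteq> 0\<^sub>m n n" "f X = \<mu> \<cdot>\<^sub>m X" for \<mu> X
  proof (rule ccontr)
    assume "\<not> ?thesis"
    then have ne: "complex_of_real (d i) \<noteq> \<mu>" if "i < n * n" for i using that by auto
    define z where "z = adj P * flat n X"
    have z [simp]: "dim_row z = n * n" "dim_col z = 1" using P by (auto simp: z_def)
    have "\<mu> \<cdot>\<^sub>m flat n X = P * (rdiag (n * n) d * z)"
      using fl[OF X(1)] X by (simp add: flat_smult z_def)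
    then have "adj P * (\<mu> \<cdot>\<^sub>m flat n X) = (adj P * P) * (rdiag (n * n) d * z)"
      using P(1) by (simp add: mult_assoc_dim)
    then have eq: "\<mu> \<cdot>\<^sub>m z = rdiag (n * n) d * z"
      using P by (simp add: mult_smult_dim z_def)
    have "z = 0\<^sub>m (n * n) 1"
    proof (rule eq_matI)
      fix i j assume "i < dim_row (0\<^sub>m (n * n) 1)" "j < dim_col (0\<^sub>m (n * n) 1)"
      then have i: "i < n * n" "j = 0" by auto
      have "(rdiag (n * n) d * z) $$ (i,0) = complex_of_real (d i) * z $$ (i,0)"
        using i by (intro index_rdiag_mult) auto
      moreover have "(\<mu> \<cdot>\<^sub>m z) $$ (i,0) = \<mu> * z $$ (i,0)" using i by simp
      ultimately have "\<mu> * z $$ (i,0) = complex_of_real (d i) * z $$ (i,0)" using eq by metis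
      then have "z $$ (i,0) = 0" using ne[OF i(1)] by (metis mult_cancel_right)
      then show "z $$ (i,j) = 0\<^sub>m (n * n) 1 $$ (i,j)" using i by simp
    qed auto
    then have "P * z = 0\<^sub>m (n * n) 1" using P by simp
    moreover have "P * z = flat n X" using P by (simp add: z_def mult_assoc_dim[symmetric])
    ultimately have "X = unflat n (0\<^sub>m (n * n) 1)" using unflat_flat[OF X(1)] by simp
    also have "\<dots> = 0\<^sub>m n n" by (rule eq_matI) (auto simp: unflat_def index_less)
    finally show False using X by simp
  qed
  then show ?thesis by (intro finite_subset[OF _ finite_imageI[OF finite_lessThan]]) blast
qed

end

section \<open>Lower bounds for the dimension of a subspace of matrices\<close>

lemma (in vectorspace) subspace_fin_dim:
  assumes fd: "fin_dim" and W: "submodule K W V"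
  shows "vectorspace.fin_dim K (vs W)"
proof -
  have "VectorSpace.subspace K W V" using W by (simp add: VectorSpace.subspace_def vectorspace_axioms)
  then have "vectorspace K (vs W)" by (rule subspace_is_vs)
  then interpret W: vectorspace K "vs W" .
  have sub: "W \<subseteq> carrier V" using W by (simp add: submodule_def)
  have small: "finite A \<and> card A \<le> dim" if "A \<subseteq> carrier (vs W) \<and> W.lin_indpt A" for A
    using that li_le_dim[OF fd, of A] sub span_li_not_depend(2)[OF _ W, of A] by auto
  have "{} \<subseteq> carrier (vs W) \<and> W.lin_indpt {}"
    by (auto simp: W.lin_dep_def)
  then obtain A where A: "finite A" "maximal A (\<lambda>A. A \<subseteq> carrier (vs W) \<and> W.lin_indpt A)"
    using maximal_exists[of "\<lambda>A. A \<subseteq> carrier (vs W) \<and> W.lin_indpt A", OF small] by blast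
  then have "W.gen_set A" by (intro W.max_li_is_gen)
  moreover have "A \<subseteq> carrier (vs W)" using A(2) by (simp add: maximal_def)
  ultimately show ?thesis using A(1) unfolding W.fin_dim_def by blast
qed

text \<open>\<open>cdim_mat\<close> is the dimension of a structure whose carrier is the subspace
  itself; independence is shown in the ambient space and transferred here.\<close>

lemma (in vectorspace) li_card_le_subspace_dim:
  assumes fd: "fin_dim" and W: "submodule K W V" and A: "A \<subseteq> W" "lin_indpt A"
  shows "card A \<le> vectorspace.dim K (vs W)"
proof -
  have "VectorSpace.subspace K W V" using W by (simp add: VectorSpace.subspace_def vectorspace_axioms)
  then have "vectorspace K (vs W)" by (rule subspace_is_vs)
  then interpret W: vectorspace K "vs W" .
  show ?thesis
    using W.li_le_dim(2)[OF subspace_fin_dim[OF fd W], of A] A span_li_not_depend(2)[OF A(1) W] by simp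
qed

lemma smult_eq_zero_mat:
  fixes X :: "complex mat"
  assumes X: "X \<in> carrier_mat n m" and eq: "c \<cdot>\<^sub>m X = 0\<^sub>m n m"
  shows "c = 0 \<or> X = 0\<^sub>m n m"
proof (rule disjCI)
  assume "X \<noteq> 0\<^sub>m n m"
  then obtain i j where ij: "i < n" "j < m" "X $$ (i,j) \<noteq> 0"
    using X by (metis carrier_matD eq_matI index_zero_mat)
  have "(c \<cdot>\<^sub>m X) $$ (i,j) = 0" using eq ij by simp
  then show "c = 0" using X ij by simp
qed

text \<open>Finite dimension is inherited through a surjective linear map from the vectors of length
  \<open>n * n\<close>.\<close>

lemma mat_fin_dim:
  "vectorspace.fin_dim (class_ring :: complex ring) (module_mat TYPE(complex) n n)"
proof -
  let ?V = "module_vec TYPE(complex) (n * n)"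
  let ?W = "module_mat TYPE(complex) n n"
  let ?T = "\<lambda>v. mat n n (\<lambda>(i,j). v $ (i * n + j))"
  interpret V: vec_space "TYPE(complex)" "n * n" .
  have "linear_map class_ring ?V ?W ?T"
  proof (unfold linear_map_def mod_hom_def mod_hom_axioms_def, intro conjI)
    show "vectorspace class_ring ?V" by (rule vec_vs)
    show "vectorspace class_ring ?W" by (rule matrix_vs)
    show "Module.module class_ring ?V" by (rule vec_module)
    show "Module.module class_ring ?W" using matrix_vs[of n n, where 'a = complex] by (simp add: vectorspace_def)
    show "?T \<in> LinearCombinations.module_hom class_ring ?V ?W"
      by (auto simp: LinearCombinations.module_hom_def module_vec_simps module_mat_simps index_less intro!: eq_matI)
  qed
  then interpret T: linear_map class_ring ?V ?W ?T .
  have "?T ` carrier ?V = carrier ?W"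
  proof safe
    fix X assume "X \<in> carrier ?W"
    then have X: "X \<in> carrier_mat n n" by (simp add: module_mat_simps)
    have "X = ?T (vec (n * n) (\<lambda>k. X $$ (k div n, k mod n)))"
      using X by (intro eq_matI) (auto simp: index_less)
    then show "X \<in> ?T ` carrier ?V"
      by (rule image_eqI) (simp add: module_vec_simps)
  qed (simp add: module_mat_simps)
  then show ?thesis
    using T.surj_fin_dim V.fin_dim by blast
qed

context
  fixes n :: nat and W :: "complex mat set"
  assumes W: "W \<subseteq> carrier_mat n n" "0\<^sub>m n n \<in> W"
    "\<And>X Y. X \<in> W \<Longrightarrow> Y \<in> W \<Longrightarrow> X + Y \<in> W" "\<And>c X. X \<in> W \<Longrightarrow> c \<cdot>\<^sub>m X \<in> W"
begin

interpretation matrix_vs n n "TYPE(complex)" .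

lemma submod: "submodule class_ring W V"
  using W matrix_vs[of n n, where 'a = complex] 
  by (auto simp: submodule_def module_mat_simps vectorspace_def)

lemma cdim_mat_ge_1:
  assumes X: "X \<in> W" "X \<noteq> 0\<^sub>m n n"
  shows "1 \<le> cdim_mat n W"
proof -
  have Xc: "X \<in> carrier_mat n n" using X W by auto
  have "lin_indpt {X}"
  proof (rule finite_lin_indpt2)
    fix a assume "lincomb a {X} = 0\<^sub>m n n"
    then have "a X \<cdot>\<^sub>m X = 0\<^sub>m n n"
      using Xc by (simp add: lincomb_def)
    then show "\<forall>v\<in>{X}. a v = 0"
      using smult_eq_zero_mat[OF Xc] X(2) by auto
  qed (use Xc in auto)
  then show ?thesis
    using li_card_le_subspace_dim[OF mat_fin_dim submod, of "{X}"] X by (simp add: cdim_mat_def)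
qed

text \<open>The trace separates the two operators: applied to a linear relation it removes the
  traceless \<open>X\<close> and so forces the coefficient of \<open>Y\<close> to vanish. Meant for
  an eigenspace that contains a traceless operator beside the projector \<open>Q\<close>.\<close>

lemma cdim_mat_ge_2:
  assumes XY: "X \<in> W" "X \<noteq> 0\<^sub>m n n" "Y \<in> W" "mtrace X = 0" "mtrace Y \<noteq> 0"
  shows "2 \<le> cdim_mat n W"
proof -
  have Xc: "X \<in> carrier_mat n n" "Y \<in> carrier_mat n n" using XY W by auto
  have "X \<noteq> Y" using XY by auto
  have "lin_indpt {X, Y}"
  proof (rule finite_lin_indpt2)
    fix a assume "lincomb a {X, Y} = 0\<^sub>m n n"
    then have eq: "a X \<cdot>\<^sub>m X + a Y \<cdot>\<^sub>m Y = 0\<^sub>m n n"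
      using Xc \<open>X \<noteq> Y\<close> by (simp add: lincomb_def finsum_insert Pi_def)
    have "a X * mtrace X + a Y * mtrace Y = mtrace (a X \<cdot>\<^sub>m X + a Y \<cdot>\<^sub>m Y)"
      using Xc by (simp add: mtrace_add mtrace_smult)
    then have "a Y = 0" using eq XY by (simp add: mtrace_def)
    then have "a X \<cdot>\<^sub>m X = 0\<^sub>m n n"
    proof -
      have "a Y \<cdot>\<^sub>m Y = 0\<^sub>m n n" using \<open>a Y = 0\<close> Xc by (intro eq_matI) auto
      then show ?thesis using eq Xc by simp
    qed
    then have "a X = 0"
      using smult_eq_zero_mat[OF Xc(1)] XY(2) by auto
    then show "\<forall>v\<in>{X, Y}. a v = 0" using \<open>a Y = 0\<close> by simp
  qed (use Xc in auto)
  then show ?thesis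
    using li_card_le_subspace_dim[OF mat_fin_dim submod, of "{X, Y}"] XY \<open>X \<noteq> Y\<close> by (simp add: cdim_mat_def)
qed

end

section \<open>The mixture of reflections\<close>

text \<open>Vectors become one-column matrices, so that kets, ensembles and operators share one
  multiplication and one Kronecker product.\<close>

definition colv :: "complex vec \<Rightarrow> complex mat" where
  "colv v = mat (dim_vec v) 1 (\<lambda>(i,_). v $ i)"

lemma dim_colv [simp]: "dim_row (colv v) = dim_vec v" "dim_col (colv v) = 1"
  by (simp_all add: colv_def)

lemma ketbra_colv: "ketbra v = colv v * adj (colv v)"
  by (rule eq_matI) (auto simp: ketbra_def colv_def scalar_prod_def)

lemma dim_ketbra [simp]: "dim_row (ketbra v) = dim_vec v" "dim_col (ketbra v) = dim_vec v"
  by (simp_all add: ketbra_def)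

lemma adj_ketbra [simp]: "adj (ketbra v) = ketbra v"
  by (simp add: ketbra_colv adj_mult)

lemma colv_unit: "is_unit_vec n v \<Longrightarrow> adj (colv v) * colv v = 1\<^sub>m 1"
  by (rule eq_matI)
    (auto simp: is_unit_vec_def colv_def scalar_prod_def lessThan_atLeast0 mult.commute)

lemma mult_colv: "dim_col A = dim_vec v \<Longrightarrow> A * colv v = colv (A *\<^sub>v v)"
  by (rule eq_matI) (auto simp: colv_def scalar_prod_def)

lemma ketbra_unit_idem:
  assumes "is_unit_vec n v"
  shows "ketbra v * ketbra v = ketbra v"
proof -
  have "ketbra v * ketbra v = colv v * (adj (colv v) * colv v) * adj (colv v)"
    by (simp add: ketbra_colv mult_assoc_dim)
  then show ?thesis
    using colv_unit[OF assms] by (simp add: ketbra_colv)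
qed

lemma dim_refl_op [simp]: "dim_row (refl_op v) = dim_vec v" "dim_col (refl_op v) = dim_vec v"
  by (simp_all add: refl_op_def)

lemma adj_refl_op [simp]: "adj (refl_op v) = refl_op v"
  by (simp add: refl_op_def adj_minus adj_smult)

lemma refl_op_idem:
  assumes "is_unit_vec n v"
  shows "refl_op v * refl_op v = 1\<^sub>m (dim_vec v)"
proof -
  have "refl_op v * refl_op v = 1\<^sub>m (dim_vec v) - 2 \<cdot>\<^sub>m ketbra v - 2 \<cdot>\<^sub>m (ketbra v - 2 \<cdot>\<^sub>m ketbra v)"
    by (simp add: refl_op_def mat_dim_simps ketbra_unit_idem[OF assms])
  also have "\<dots> = 1\<^sub>m (dim_vec v)"
    by (rule eq_matI) auto
  finally show ?thesis .
qed

text \<open>The input space is represented by its projector \<open>Q\<close>, and its dimension by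
  the trace of \<open>Q\<close>.\<close>

locale reflection_mixture =
  fixes n K d :: nat and \<phi> :: "nat \<Rightarrow> complex vec" and Q :: "complex mat"
  assumes K: "1 \<le> K"
    and unit: "\<And>k. k \<in> {1..K} \<Longrightarrow> is_unit_vec n (\<phi> k)"
    and Q: "Q \<in> carrier_mat n n" "adj Q = Q" "Q * Q = Q"
    and trQ: "mtrace Q = of_nat d"
    and Q\<phi>: "\<And>k. k \<in> {1..K} \<Longrightarrow> Q *\<^sub>v \<phi> k = \<phi> k"
begin

abbreviation "R k \<equiv> refl_op (\<phi> k)"
abbreviation "D \<equiv> D_map K \<phi>"
definition "L = {X \<in> carrier_mat n n. Q * X = X \<and> X * Q = X}"

lemma dimQ [simp]: "dim_row Q = n" "dim_col Q = n"
  using Q by auto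

lemma dim\<phi>: "k \<in> {1..K} \<Longrightarrow> dim_vec (\<phi> k) = n"
  using unit by (auto simp: is_unit_vec_def)

lemma R_idem: "k \<in> {1..K} \<Longrightarrow> R k * R k = 1\<^sub>m n"
  using refl_op_idem[OF unit] dim\<phi> by auto

lemma Q_ketbra: "k \<in> {1..K} \<Longrightarrow> Q * ketbra (\<phi> k) = ketbra (\<phi> k)"
  by (simp add: ketbra_colv mult_assoc_dim[symmetric] mult_colv dim\<phi> Q\<phi>)

lemma ketbra_Q: "k \<in> {1..K} \<Longrightarrow> ketbra (\<phi> k) * Q = ketbra (\<phi> k)"
  using arg_cong[OF Q_ketbra, of k adj] by (simp add: adj_mult dim\<phi> Q)

lemma Q_R: "k \<in> {1..K} \<Longrightarrow> Q * R k = R k * Q"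
  by (simp add: refl_op_def mat_dim_simps dim\<phi> Q_ketbra ketbra_Q)

lemma d_pos: "1 \<le> d"
proof (rule ccontr)
  assume "\<not> 1 \<le> d"
  then have "(frob Q)\<^sup>2 = 0" by (simp add: frob_sq Q trQ)
  then have Q0: "Q = 0\<^sub>m n n" by (simp add: frob_zero_iff)
  have "ketbra (\<phi> 1) = 0\<^sub>m n n"
    using Q_ketbra[of 1] K dim\<phi>[of 1] by (simp add: Q0)
  then have "colv (\<phi> 1) * adj (colv (\<phi> 1)) * colv (\<phi> 1) = 0\<^sub>m n 1"
    using K dim\<phi>[of 1] by (simp add: ketbra_colv)
  then have "colv (\<phi> 1) = 0\<^sub>m n 1"
    using K colv_unit[OF unit, of 1] by (simp add: mult_assoc_dim)
  then show False
  proof -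
    have "(1\<^sub>m 1 :: complex mat) = 0\<^sub>m 1 1"
      using K colv_unit[OF unit, of 1] \<open>colv (\<phi> 1) = 0\<^sub>m n 1\<close> by simp
    then have "(1\<^sub>m 1 :: complex mat) $$ (0,0) = 0\<^sub>m 1 1 $$ (0,0)" by (rule arg_cong)
    then show False by simp
  qed
qed

lemma dim_D [simp]: "dim_row (D X) = dim_row X" "dim_col (D X) = dim_col X"
  by (simp_all add: D_map_def)

lemma D_carrier [simp]: "X \<in> carrier_mat n n \<Longrightarrow> D X \<in> carrier_mat n n"
  by (auto intro!: carrier_matI)

lemma D_index:
  "i < dim_row X \<Longrightarrow> j < dim_col X \<Longrightarrow> D X $$ (i,j) = (\<Sum>k=1..K. (R k * X * R k) $$ (i,j)) / of_nat K"
  by (simp add: D_map_def)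

lemma D_eqI:
  assumes X: "X \<in> carrier_mat n n" and Y: "Y \<in> carrier_mat n n"
    and ent: "\<And>i j. i < n \<Longrightarrow> j < n \<Longrightarrow> Y $$ (i,j) = (\<Sum>k=1..K. (R k * X * R k) $$ (i,j)) / of_nat K"
  shows "Y = D X"
  using X Y ent by (intro eq_matI) (auto simp: D_index)

lemma D_add:
  assumes X: "X \<in> carrier_mat n n" "Y \<in> carrier_mat n n"
  shows "D (X + Y) = D X + D Y"
proof (rule D_eqI[symmetric])
  fix i j assume ij: "i < n" "j < n"
  have "(R k * (X + Y) * R k) $$ (i,j) = (R k * X * R k) $$ (i,j) + (R k * Y * R k) $$ (i,j)"
    if k: "k \<in> {1..K}" for k
  proof -
    have "R k * (X + Y) * R k = R k * X * R k + R k * Y * R k"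
      using k X dim\<phi>[OF k] by (simp add: mult_add_dim add_mult_dim)
    then show ?thesis using ij X dim\<phi>[OF k] by (simp del: index_mult_mat(1))
  qed
  then show "(D X + D Y) $$ (i,j) = (\<Sum>k=1..K. (R k * (X + Y) * R k) $$ (i,j)) / of_nat K"
    using ij X by (simp add: D_index sum.distrib add_divide_distrib del: index_mult_mat(1))
qed (use X in auto)

lemma D_smult:
  assumes X: "X \<in> carrier_mat n n"
  shows "D (c \<cdot>\<^sub>m X) = c \<cdot>\<^sub>m D X"
proof (rule D_eqI[symmetric])
  fix i j assume ij: "i < n" "j < n"
  have "(R k * (c \<cdot>\<^sub>m X) * R k) $$ (i,j) = c * (R k * X * R k) $$ (i,j)"
    if k: "k \<in> {1..K}" for k
  proof -
    have "R k * (c \<cdot>\<^sub>m X) * R k = c \<cdot>\<^sub>m (R k * X * R k)"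
      using k X dim\<phi>[OF k] by (simp add: smult_mult_dim mult_smult_dim)
    then show ?thesis using ij X dim\<phi>[OF k] by (simp del: index_mult_mat(1))
  qed
  then show "(c \<cdot>\<^sub>m D X) $$ (i,j) = (\<Sum>k=1..K. (R k * (c \<cdot>\<^sub>m X) * R k) $$ (i,j)) / of_nat K"
    using ij X by (simp add: D_index sum_distrib_left del: index_mult_mat(1))
qed (use X in auto)

lemma mult_D_index:
  assumes "A \<in> carrier_mat n n" "X \<in> carrier_mat n n" "i < n" "j < n"
  shows "(A * D X) $$ (i,j) = (\<Sum>k=1..K. (A * (R k * X * R k)) $$ (i,j)) / of_nat K"
proof -
  have "(A * D X) $$ (i,j) = (\<Sum>l<n. A $$ (i,l) * ((\<Sum>k=1..K. (R k * X * R k) $$ (l,j)) / of_nat K))"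
    using assms by (subst index_mult_sum) (auto simp: D_index simp del: index_mult_mat(1))
  also have "\<dots> = (\<Sum>k=1..K. \<Sum>l<n. A $$ (i,l) * (R k * X * R k) $$ (l,j)) / of_nat K"
    unfolding sum_divide_distrib sum_distrib_left by (subst sum.swap) simp
  also have "(\<Sum>k=1..K. \<Sum>l<n. A $$ (i,l) * (R k * X * R k) $$ (l,j)) = (\<Sum>k=1..K. (A * (R k * X * R k)) $$ (i,j))"
  proof (rule sum.cong)
    fix k assume "k \<in> {1..K}"
    then show "(\<Sum>l<n. A $$ (i,l) * (R k * X * R k) $$ (l,j)) = (A * (R k * X * R k)) $$ (i,j)"
      using assms dim\<phi>[of k] by (subst index_mult_sum) (auto simp del: index_mult_mat(1))
  qed simp
  finally show ?thesis .
qed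

lemma mtrace_mult_D:
  assumes "A \<in> carrier_mat n n" "X \<in> carrier_mat n n"
  shows "mtrace (A * D X) = (\<Sum>k=1..K. mtrace (A * (R k * X * R k))) / of_nat K"
proof -
  have "mtrace (A * D X) = (\<Sum>i<n. (\<Sum>k=1..K. (A * (R k * X * R k)) $$ (i,i)) / of_nat K)"
    using assms by (auto simp: mtrace_def mult_D_index simp del: index_mult_mat(1))
  also have "\<dots> = (\<Sum>k=1..K. \<Sum>i<n. (A * (R k * X * R k)) $$ (i,i)) / of_nat K"
    unfolding sum_divide_distrib by (rule sum.swap)
  finally show ?thesis using assms by (auto simp: mtrace_def simp del: index_mult_mat(1))
qed

lemma mtrace_D: "X \<in> carrier_mat n n \<Longrightarrow> mtrace (D X) = mtrace X"
proof -
  assume X: "X \<in> carrier_mat n n"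
  have "mtrace (1\<^sub>m n * (R k * X * R k)) = mtrace X" if k: "k \<in> {1..K}" for k
  proof -
    have "mtrace (1\<^sub>m n * (R k * X * R k)) = mtrace ((R k * X) * R k)"
      using X dim\<phi>[OF k] by simp
    also have "\<dots> = mtrace (R k * (R k * X))"
      using X dim\<phi>[OF k] by (intro mtrace_comm) auto
    also have "R k * (R k * X) = X"
      using X dim\<phi>[OF k] R_idem[OF k] by (simp add: mult_assoc_dim[symmetric])
    finally show ?thesis .
  qed
  then have "mtrace (1\<^sub>m n * D X) = mtrace X"
    using mtrace_mult_D[of "1\<^sub>m n" X] X K by simp
  then show ?thesis using X by simp
qed

text \<open>Each summand conjugates by a Hermitian matrix, and such a conjugation is its own adjoint
  for the trace inner product.\<close>

lemma D_selfadj: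
  assumes "X \<in> carrier_mat n n" "Y \<in> carrier_mat n n"
  shows "mtrace (adj Y * D X) = mtrace (adj (D Y) * X)"
proof -
  have "mtrace (adj Y * (R k * X * R k)) = cnj (mtrace (adj X * (R k * Y * R k)))"
    if k: "k \<in> {1..K}" for k
  proof -
    have "cnj (mtrace (adj X * (R k * Y * R k))) = mtrace (adj (adj X * (R k * Y * R k)))"
      using assms dim\<phi>[OF k] by (subst mtrace_adj) auto
    also have "adj (adj X * (R k * Y * R k)) = R k * (adj Y * R k * X)"
      using assms dim\<phi>[OF k] by (simp add: adj_mult mult_assoc_dim)
    also have "mtrace \<dots> = mtrace (adj Y * R k * X * R k)"
      using assms dim\<phi>[OF k] by (subst mtrace_comm) auto
    also have "adj Y * R k * X * R k = adj Y * (R k * X * R k)"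
      using assms dim\<phi>[OF k] by (simp add: mult_assoc_dim)
    finally show ?thesis ..
  qed
  then have "mtrace (adj Y * D X) = cnj (mtrace (adj X * D Y))"
    using assms by (simp add: mtrace_mult_D)
  also have "\<dots> = mtrace (adj (adj X * D Y))"
    using assms by (subst mtrace_adj) auto
  also have "adj (adj X * D Y) = adj (D Y) * X"
    using assms by (subst adj_mult) auto
  finally show ?thesis .
qed

text \<open>Every reflection commutes with \<open>Q\<close> because \<open>Q\<close> fixes its
  vector. So \<open>D\<close> maps the operators supported on the input space to themselves.\<close>

lemma Q_mult_D:
  assumes X: "X \<in> carrier_mat n n"
  shows "Q * D X = D (Q * X)"
proof (rule D_eqI)
  fix i j assume ij: "i < n" "j < n"
  have "Q * (R k * X * R k) = R k * (Q * X) * R k" if k: "k \<in> {1..K}" for k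
  proof -
    have "Q * (R k * X * R k) = (Q * R k) * X * R k"
      using X dim\<phi>[OF k] by (simp add: mult_assoc_dim)
    then show ?thesis using X dim\<phi>[OF k] by (simp add: Q_R[OF k] mult_assoc_dim)
  qed
  then show "(Q * D X) $$ (i,j) = (\<Sum>k=1..K. (R k * (Q * X) * R k) $$ (i,j)) / of_nat K"
    unfolding mult_D_index[OF Q(1) X ij] by (simp del: index_mult_mat(1))
qed (use X Q in auto)

lemma adj_D:
  assumes X: "X \<in> carrier_mat n n"
  shows "adj (D X) = D (adj X)"
proof (rule D_eqI)
  fix i j assume ij: "i < n" "j < n"
  have "cnj ((R k * X * R k) $$ (j,i)) = (R k * adj X * R k) $$ (i,j)" if k: "k \<in> {1..K}" for k
  proof -
    have "cnj ((R k * X * R k) $$ (j,i)) = adj (R k * X * R k) $$ (i,j)"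
      using ij X dim\<phi>[OF k] by (subst index_adj) auto
    also have "adj (R k * X * R k) = R k * adj X * R k"
      using X dim\<phi>[OF k] by (simp add: adj_mult mult_assoc_dim)
    finally show ?thesis .
  qed
  then show "adj (D X) $$ (i,j) = (\<Sum>k=1..K. (R k * adj X * R k) $$ (i,j)) / of_nat K"
    using ij X by (simp add: D_index del: index_mult_mat(1))
qed (use X in auto)

lemma D_mult_Q:
  assumes X: "X \<in> carrier_mat n n"
  shows "D X * Q = D (X * Q)"
proof -
  have "D X * Q = adj (Q * D (adj X))"
    using X by (simp add: adj_mult adj_D Q)
  also have "\<dots> = adj (D (adj (X * Q)))"
    using X by (subst Q_mult_D) (auto simp: adj_mult Q)
  also have "\<dots> = D (X * Q)"
    using X by (subst adj_D) auto
  finally show ?thesis .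
qed

lemma D_Q: "D Q = Q"
proof (rule D_eqI[symmetric])
  fix i j assume ij: "i < n" "j < n"
  have "R k * Q * R k = Q" if k: "k \<in> {1..K}" for k
    unfolding Q_R[OF k, symmetric] using dim\<phi>[OF k] by (simp add: mult_assoc_dim R_idem[OF k])
  then show "Q $$ (i,j) = (\<Sum>k=1..K. (R k * Q * R k) $$ (i,j)) / of_nat K"
    using K by simp
qed (use Q in auto)

text \<open>Conjugation by a unitary preserves \<open>frob\<close>, so Cauchy-Schwarz bounds each
  term of the average. Consequently the eigenvalues of \<open>D\<close> lie in the unit
  disc.\<close>

lemma D_quadratic_bound:
  assumes X: "X \<in> carrier_mat n n"
  shows "cmod (mtrace (adj X * D X)) \<le> (frob X)\<^sup>2"
proof -
  have "cmod (mtrace (adj X * (R k * X * R k))) \<le> (frob X)\<^sup>2" if k: "k \<in> {1..K}" for k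
  proof -
    have "frob (R k * (X * R k)) = frob (X * R k)"
      using X dim\<phi>[OF k] R_idem[OF k] by (intro frob_isometry) auto
    also have "\<dots> = frob (adj (X * R k))" by simp
    also have "adj (X * R k) = R k * adj X"
      using X dim\<phi>[OF k] by (simp add: adj_mult)
    also have "frob \<dots> = frob X"
      using X dim\<phi>[OF k] R_idem[OF k] by (subst frob_isometry) auto
    finally have "frob (R k * X * R k) = frob X"
      using X dim\<phi>[OF k] by (simp add: mult_assoc_dim)
    then show ?thesis
      using frob_cauchy_schwarz[of X "R k * X * R k"] X dim\<phi>[OF k] by (simp add: power2_eq_square)
  qed
  then have "cmod (\<Sum>k=1..K. mtrace (adj X * (R k * X * R k))) \<le> real K * (frob X)\<^sup>2"
    by (intro order_trans[OF norm_sum] order_trans[OF sum_bounded_above]) auto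
  then show ?thesis
    using X K by (simp add: mtrace_mult_D norm_divide field_simps)
qed

lemma D_eigenvalue_le_1:
  assumes X: "X \<in> carrier_mat n n" "X \<noteq> 0\<^sub>m n n" "D X = \<mu> \<cdot>\<^sub>m X"
  shows "cmod \<mu> \<le> 1"
proof -
  have "0 < frob X" using X frob_zero_iff[of X] frob_nonneg[of X] by (auto simp: less_le)
  moreover have "mtrace (adj X * D X) = \<mu> * of_real ((frob X)\<^sup>2)"
    unfolding X(3) using X(1) by (simp add: mult_smult_dim mtrace_smult mtrace_adj_self)
  then have "cmod \<mu> * (frob X)\<^sup>2 \<le> (frob X)\<^sup>2"
    using D_quadratic_bound[OF X(1)] by (simp add: norm_mult norm_power)
  ultimately show ?thesis by (simp add: mult_le_cancel_right1 zero_less_power)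
qed

lemma D_superop: "selfadjoint_superop n D"
  by unfold_locales (auto simp: D_add D_smult D_selfadj)

abbreviation "lam \<equiv> second_eig_mag n L D"

lemma L_carrier: "X \<in> L \<Longrightarrow> X \<in> carrier_mat n n"
  by (simp add: L_def)

lemma finite_op_eigenvalues: "finite {\<mu>. op_eigenvalue n L D \<mu> \<and> r \<le> cmod \<mu>}"
  by (rule finite_subset[OF _ selfadjoint_superop.finite_eigenvalues[OF D_superop]])
    (auto simp: op_eigenvalue_def L_carrier)

text \<open>Bounds the set whose supremum defines \<open>lam\<close>; a supremum of reals gives no
  upper bounds for members of an unbounded set.\<close>

lemma count_le_1:
  assumes "2 \<le> count_eig_ge n L D r"
  shows "r \<le> 1"
proof (rule ccontr)
  assume "\<not> r \<le> 1"
  then have *: "{\<mu>. op_eigenvalue n L D \<mu> \<and> r \<le> cmod \<mu>} = {}"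
    using D_eigenvalue_le_1 L_carrier by (fastforce simp: op_eigenvalue_def)
  then show False using assms unfolding count_eig_ge_def * by simp
qed

lemma bdd_lam: "bdd_above ({0} \<union> {r. 0 \<le> r \<and> 2 \<le> count_eig_ge n L D r})"
  using count_le_1 by (auto intro!: bdd_aboveI[of _ 1])

lemma lam_nonneg: "0 \<le> lam"
  unfolding second_eig_mag_def by (rule cSup_upper[OF _ bdd_lam]) auto

lemma lam_le_1: "lam \<le> 1"
  unfolding second_eig_mag_def using count_le_1 by (intro cSup_least) auto

text \<open>\<open>Q\<close> already accounts for one eigenvalue, namely 1, whose modulus is at
  least \<open>cmod \<mu>\<close>. A traceless eigenoperator is independent of it, so at threshold
  \<open>cmod \<mu>\<close> at least two eigenvalues are counted, and \<open>cmod \<mu>\<close>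
  belongs to the set whose supremum is \<open>lam\<close>.\<close>

lemma traceless_eigenvalue:
  assumes X: "X \<in> L" "X \<noteq> 0\<^sub>m n n" "D X = \<mu> \<cdot>\<^sub>m X" "mtrace X = 0"
  shows "cmod \<mu> \<le> lam"
proof -
  have QL: "Q \<in> L" using Q by (simp add: L_def)
  have Q0: "Q \<noteq> 0\<^sub>m n n" using trQ d_pos by (auto simp: mtrace_def)
  note c1 = D_eigenvalue_le_1[OF L_carrier[OF X(1)] X(2,3)]
  let ?W = "\<lambda>\<nu>. op_eigenspace L D \<nu>"
  let ?S = "{\<nu>. op_eigenvalue n L D \<nu> \<and> cmod \<mu> \<le> cmod \<nu>}"
  have W: "?W \<nu> \<subseteq> carrier_mat n n" "0\<^sub>m n n \<in> ?W \<nu>"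
    "\<And>A B. A \<in> ?W \<nu> \<Longrightarrow> B \<in> ?W \<nu> \<Longrightarrow> A + B \<in> ?W \<nu>"
    "\<And>c A. A \<in> ?W \<nu> \<Longrightarrow> c \<cdot>\<^sub>m A \<in> ?W \<nu>" for \<nu>
  proof -
    show "?W \<nu> \<subseteq> carrier_mat n n" by (auto simp: op_eigenspace_def L_def)
    have "D (0\<^sub>m n n) = 0\<^sub>m n n" by (rule selfadjoint_superop.f_zero[OF D_superop])
    then show "0\<^sub>m n n \<in> ?W \<nu>" by (simp add: op_eigenspace_def L_def)
    show "A + B \<in> ?W \<nu>" if AB: "A \<in> ?W \<nu>" "B \<in> ?W \<nu>" for A B
      using AB by (auto simp: op_eigenspace_def L_def D_add mult_add_dim add_mult_dim add_smult_distrib_left_mat[of _ n n])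
    show "c \<cdot>\<^sub>m A \<in> ?W \<nu>" if A: "A \<in> ?W \<nu>" for c A
    proof -
      have A': "A \<in> carrier_mat n n" "Q * A = A" "A * Q = A" "D A = \<nu> \<cdot>\<^sub>m A"
        using A by (auto simp: op_eigenspace_def L_def)
      have "c \<cdot>\<^sub>m (\<nu> \<cdot>\<^sub>m A) = \<nu> \<cdot>\<^sub>m (c \<cdot>\<^sub>m A)" by (rule eq_matI) auto
      then show ?thesis
        using A' by (simp add: op_eigenspace_def L_def D_smult mult_smult_dim smult_mult_dim)
    qed
  qed
  have DQ1: "D Q = 1 \<cdot>\<^sub>m Q" unfolding D_Q by (rule eq_matI) auto
  have X\<mu>: "X \<in> ?W \<mu>"
    unfolding op_eigenspace_def using X(1,3) by blast
  have Q1: "Q \<in> ?W 1"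
    unfolding op_eigenspace_def using QL DQ1 by blast
  have \<mu>S: "\<mu> \<in> ?S"
    unfolding op_eigenvalue_def using X(1-3) by blast
  have "op_eigenvalue n L D 1"
    unfolding op_eigenvalue_def using QL Q0 DQ1 by blast
  then have oneS: "1 \<in> ?S"
    using c1 by simp
  have "2 \<le> (\<Sum>\<nu>\<in>?S. cdim_mat n (?W \<nu>))"
  \<comment> \<open>If \<open>\<mu>\<close> is 1, both operators sit in one eigenspace, whose
    dimension must then be at least 2; otherwise two distinct eigenvalues contribute at least 1
    each.\<close>
  proof (cases "\<mu> = 1")
    case True
    have "2 \<le> cdim_mat n (?W 1)"
      by (rule cdim_mat_ge_2[OF W X\<mu>[unfolded True] X(2) Q1 X(4)]) (use trQ d_pos in auto)
    also have "\<dots> \<le> (\<Sum>\<nu>\<in>?S. cdim_mat n (?W \<nu>))"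
      by (rule member_le_sum[OF oneS]) (auto simp: finite_op_eigenvalues)
    finally show ?thesis .
  next
    case False
    have "1 \<le> cdim_mat n (?W \<mu>)" "1 \<le> cdim_mat n (?W 1)"
      using cdim_mat_ge_1[OF W X\<mu> X(2)] cdim_mat_ge_1[OF W Q1 Q0] by auto
    then have "2 \<le> (\<Sum>\<nu>\<in>{\<mu>,1}. cdim_mat n (?W \<nu>))" using False by simp
    also have "\<dots> \<le> (\<Sum>\<nu>\<in>?S. cdim_mat n (?W \<nu>))"
      using \<mu>S oneS by (intro sum_mono2 finite_op_eigenvalues) auto
    finally show ?thesis .
  qed
  then show ?thesis
    unfolding second_eig_mag_def
    by (intro cSup_upper[OF _ bdd_lam]) (auto simp: count_eig_ge_def)
qed

end

lemma mult_absorb: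
  fixes B C X :: "complex mat"
  assumes "B * C = C" "dim_col B = dim_row C" "dim_col C = dim_row X"
  shows "B * (C * X) = C * X"
  using assms by (simp add: mult_assoc_dim[symmetric])

context reflection_mixture
begin

text \<open>The part of \<open>D\<close> that \<open>lam\<close> controls: compress to the input
  space and remove the component along the fixed point \<open>Q\<close>. The coefficient has
  denominator \<open>d\<close> because that is the squared norm of \<open>Q\<close>. The compression
  makes \<open>F\<close> a map on all matrices, as \<open>frob_bound\<close> requires.\<close>

definition F :: "complex mat \<Rightarrow> complex mat" where
  "F X = D (Q * X * Q) - (mtrace (Q * X) / of_nat d) \<cdot>\<^sub>m Q"

lemma QXQ_carrier [simp]: "X \<in> carrier_mat n n \<Longrightarrow> Q * X * Q \<in> carrier_mat n n"
  by (auto intro!: carrier_matI)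

lemma Q_D_conj:
  assumes "X \<in> carrier_mat n n"
  shows "D (Q * X * Q) = Q * D X * Q"
proof -
  have "Q * X \<in> carrier_mat n n" using assms by (auto intro!: carrier_matI)
  then show ?thesis using assms by (simp add: Q_mult_D D_mult_Q)
qed

lemma mtrace_QXQ:
  assumes "X \<in> carrier_mat n n"
  shows "mtrace (Q * X * Q) = mtrace (Q * X)"
proof -
  have "mtrace (Q * X * Q) = mtrace (Q * (Q * X))"
    using assms by (intro mtrace_comm) auto
  also have "Q * (Q * X) = Q * X"
    using assms Q by (simp add: mult_assoc_dim[symmetric])
  finally show ?thesis .
qed

lemma mtrace_conj_proj:
  assumes "X \<in> carrier_mat n n" "Y \<in> carrier_mat n n" "B \<in> carrier_mat n n" "adj B = B"
  shows "mtrace (adj Y * (B * X * B)) = mtrace (adj (B * Y * B) * X)"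
proof -
  have "mtrace (adj Y * (B * X * B)) = mtrace ((adj Y * B * X) * B)"
    using assms by (simp add: mult_assoc_dim)
  also have "\<dots> = mtrace (B * (adj Y * B * X))"
    using assms by (intro mtrace_comm) auto
  also have "B * (adj Y * B * X) = adj (B * Y * B) * X"
    using assms by (simp add: mult_assoc_dim adj_mult)
  finally show ?thesis .
qed

lemma F_superop: "selfadjoint_superop n F"
proof
  fix X Y :: "complex mat" and c assume X: "X \<in> carrier_mat n n"
  show "F X \<in> carrier_mat n n" using X Q by (auto simp: F_def intro!: carrier_matI)
  have "F (c \<cdot>\<^sub>m X) = D (c \<cdot>\<^sub>m (Q * X * Q)) - (c * mtrace (Q * X) / of_nat d) \<cdot>\<^sub>m Q"
    using X by (simp add: F_def mult_smult_dim smult_mult_dim mtrace_smult)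
  also have "\<dots> = c \<cdot>\<^sub>m F X"
    using X by (subst D_smult) (auto simp: F_def algebra_simps intro!: eq_matI)
  finally show "F (c \<cdot>\<^sub>m X) = c \<cdot>\<^sub>m F X" .
  assume Y: "Y \<in> carrier_mat n n"
  have "F (X + Y) = D (Q * X * Q + Q * Y * Q) - ((mtrace (Q * X) + mtrace (Q * Y)) / of_nat d) \<cdot>\<^sub>m Q"
    using X Y by (simp add: F_def mult_add_dim add_mult_dim mtrace_add)
  also have "\<dots> = F X + F Y"
    using X Y by (subst D_add) (auto simp: F_def algebra_simps add_divide_distrib intro!: eq_matI)
  finally show "F (X + Y) = F X + F Y" .
  have "mtrace (adj Y * F X) = mtrace (adj Y * D (Q * X * Q)) - mtrace (Q * X) / of_nat d * mtrace (adj Y * Q)"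
    using X Y by (simp add: F_def mult_minus_dim mult_smult_dim mtrace_minus mtrace_smult)
  moreover have "mtrace (adj Y * D (Q * X * Q)) = mtrace (adj (D (Q * Y * Q)) * X)"
    using X Y mtrace_conj_proj[OF X D_carrier[OF Y] Q(1,2)] D_selfadj[of "Q * X * Q" Y]
    by (simp add: Q_D_conj)
  moreover have "mtrace (adj (F Y) * X) = mtrace (adj (D (Q * Y * Q)) * X) - cnj (mtrace (Q * Y)) / of_nat d * mtrace (Q * X)"
    using X Y by (simp add: F_def adj_minus adj_smult minus_mult_dim smult_mult_dim mtrace_minus mtrace_smult Q)
  moreover have "mtrace (adj Y * Q) = cnj (mtrace (Q * Y))"
    using Y by (subst mtrace_adj[symmetric]) (auto simp: adj_mult Q)
  ultimately show "mtrace (adj Y * F X) = mtrace (adj (F Y) * X)"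
    by simp
qed

lemma F_in_L:
  assumes X: "X \<in> carrier_mat n n"
  shows "Q * F X = F X" "F X * Q = F X"
  unfolding F_def Q_D_conj[OF X]
  using X by (simp_all add: mult_minus_dim minus_mult_dim mult_smult_dim smult_mult_dim
      mult_assoc_dim mult_absorb[OF Q(3)] Q(3))

lemma mtrace_F:
  assumes X: "X \<in> carrier_mat n n"
  shows "mtrace (F X) = 0"
  using X d_pos by (simp add: F_def mtrace_minus mtrace_smult mtrace_D mtrace_QXQ trQ)

lemma F_eq:
  assumes "X \<in> L"
  shows "F X = D X - (mtrace X / of_nat d) \<cdot>\<^sub>m Q"
  using assms by (simp add: F_def L_def)

text \<open>An eigenoperator with nonzero eigenvalue lies in the range of \<open>F\<close>, hence is
  traceless and supported on the input space; there \<open>F\<close> coincides with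
  \<open>D\<close>.\<close>

lemma F_bound:
  assumes "X \<in> carrier_mat n n"
  shows "frob (F X) \<le> lam * frob X"
proof (rule selfadjoint_superop.frob_bound[OF F_superop _ lam_nonneg assms])
  fix \<mu> X assume X: "X \<in> carrier_mat n n" "X \<noteq> 0\<^sub>m n n" "F X = \<mu> \<cdot>\<^sub>m X"
  show "cmod \<mu> \<le> lam"
  proof (cases "\<mu> = 0")
    case False
    have XF: "X = (1 / \<mu>) \<cdot>\<^sub>m F X"
      unfolding X(3) using False by (intro eq_matI) auto
    have Fc: "F X \<in> carrier_mat n n" by (rule selfadjoint_superop.closed[OF F_superop X(1)])
    have "Q * X = (1 / \<mu>) \<cdot>\<^sub>m (Q * F X)" "X * Q = (1 / \<mu>) \<cdot>\<^sub>m (F X * Q)"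
      using Fc arg_cong[OF XF, of "\<lambda>X. Q * X"] arg_cong[OF XF, of "\<lambda>X. X * Q"]
      by (simp_all add: mult_smult_dim smult_mult_dim)
    then have XL: "X \<in> L"
      unfolding F_in_L[OF X(1)] XF[symmetric] L_def using X(1) by auto
    have "mtrace X = (1 / \<mu>) * mtrace (F X)"
      using Fc arg_cong[OF XF, of mtrace] by (simp add: mtrace_smult)
    then have tr: "mtrace X = 0" by (simp add: mtrace_F[OF X(1)])
    have "D X = F X"
      unfolding F_eq[OF XL] tr using X(1) by (intro eq_matI) auto
    then show ?thesis
      using traceless_eigenvalue[OF XL X(2) _ tr] X(3) by simp
  qed (simp add: lam_nonneg)
qed

section \<open>Contraction of the failed branch under repeated rounds\<close>

definition P' :: "complex mat" where
  "P' = Q - ketbra (\<phi> 1)"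

lemma dim\<phi>1 [simp]: "dim_vec (\<phi> 1) = n" "dim_vec (\<phi> (Suc 0)) = n"
  using dim\<phi>[of 1] K by auto

lemma P'_carrier [simp]: "P' \<in> carrier_mat n n"
  by (auto simp: P'_def intro!: carrier_matI)

lemma dim_P' [simp]: "dim_row P' = n" "dim_col P' = n"
  using carrier_matD[OF P'_carrier] by auto

lemma adj_P' [simp]: "adj P' = P'"
  by (simp add: P'_def adj_minus Q)

lemma ketbra1:
  "Q * ketbra (\<phi> 1) = ketbra (\<phi> 1)" "ketbra (\<phi> 1) * Q = ketbra (\<phi> 1)"
  "ketbra (\<phi> 1) * ketbra (\<phi> 1) = ketbra (\<phi> 1)"
  using Q_ketbra[of 1] ketbra_Q[of 1] ketbra_unit_idem[OF unit, of 1] K by auto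

lemma P'_idem [simp]: "P' * P' = P'"
proof -
  have "P' * P' = Q - ketbra (\<phi> 1) - (ketbra (\<phi> 1) - ketbra (\<phi> 1))"
    using ketbra1 by (simp add: P'_def mult_minus_dim minus_mult_dim Q)
  then show ?thesis
    unfolding P'_def by (simp, intro eq_matI) auto
qed

lemma Q_P': "Q * P' = P'" "P' * Q = P'"
  using ketbra1 by (simp_all add: P'_def mult_minus_dim minus_mult_dim Q)

lemma frob_Q: "frob Q = sqrt (real d)"
  by (rule real_sqrt_unique[symmetric]) (auto simp: frob_sq Q trQ)

lemma frob_P': "(frob P')\<^sup>2 = real d - 1"
proof -
  have "mtrace (ketbra (\<phi> 1)) = mtrace (adj (colv (\<phi> 1)) * colv (\<phi> 1))"
    unfolding ketbra_colv by (rule mtrace_comm) auto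
  also have "\<dots> = 1" using colv_unit[OF unit, of 1] K by simp
  finally show ?thesis
    by (simp add: frob_sq) (simp add: P'_def mtrace_minus trQ)
qed

text \<open>The projection is put on both sides of \<open>D\<close>, which makes the map
  self-adjoint and \<open>frob_bound\<close> applicable.\<close>

definition A :: "complex mat \<Rightarrow> complex mat" where
  "A X = P' * D (P' * X * P') * P'"

text \<open>Equals \<open>lam + (1 - lam) * (d - 1) / d\<close>: the part of the squared norm along
  \<open>Q\<close> is not contracted at all, the rest is contracted by \<open>lam\<close>.\<close>

definition contr :: real where
  "contr = 1 - (1 - lam) / real d"

lemma contr_nonneg: "0 \<le> contr"
  using lam_nonneg d_pos by (simp add: contr_def field_simps)

lemma A_superop: "selfadjoint_superop n A"
proof
  fix X Y :: "complex mat" and c assume X: "X \<in> carrier_mat n n"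
  have PXP: "P' * X * P' \<in> carrier_mat n n" using X by (auto intro!: carrier_matI)
  show "A X \<in> carrier_mat n n" using X by (auto simp: A_def intro!: carrier_matI)
  show "A (c \<cdot>\<^sub>m X) = c \<cdot>\<^sub>m A X"
    using X PXP by (simp add: A_def mult_smult_dim smult_mult_dim D_smult)
  assume Y: "Y \<in> carrier_mat n n"
  have PYP: "P' * Y * P' \<in> carrier_mat n n" using Y by (auto intro!: carrier_matI)
  show "A (X + Y) = A X + A Y"
    using X Y PXP PYP by (simp add: A_def mult_add_dim add_mult_dim D_add)
  show "mtrace (adj Y * A X) = mtrace (adj (A Y) * X)"
    unfolding A_def using X Y PXP PYP
    by (simp add: mtrace_conj_proj D_selfadj)
qed

lemma A_bound:
  assumes "X \<in> carrier_mat n n"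
  shows "frob (A X) \<le> contr * frob X"
proof (rule selfadjoint_superop.frob_bound[OF A_superop _ contr_nonneg assms])
  fix \<mu> X assume X: "X \<in> carrier_mat n n" "X \<noteq> 0\<^sub>m n n" "A X = \<mu> \<cdot>\<^sub>m X"
  show "cmod \<mu> \<le> contr"
  proof (cases "\<mu> = 0")
    case False
    let ?n = "(frob X)\<^sup>2" and ?t = "mtrace X"
    have Ac: "A X \<in> carrier_mat n n" by (rule selfadjoint_superop.closed[OF A_superop X(1)])
    \<comment> \<open>Dividing by the eigenvalue exhibits \<open>X\<close> as a multiple of a value
      of \<open>A\<close>, so \<open>P'\<close> fixes it from both sides.\<close>
    have XA: "X = (1 / \<mu>) \<cdot>\<^sub>m A X"
      unfolding X(3) using False by (intro eq_matI) auto
    have AX: "P' * A X = A X" "A X * P' = A X"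
      using X(1) by (simp_all add: A_def mult_assoc_dim mult_absorb)
    have "P' * X = P' * ((1 / \<mu>) \<cdot>\<^sub>m A X)" "X * P' = ((1 / \<mu>) \<cdot>\<^sub>m A X) * P'"
      by (rule arg_cong[OF XA])+
    moreover have "P' * ((1 / \<mu>) \<cdot>\<^sub>m A X) = X"
    proof -
      have "P' * ((1 / \<mu>) \<cdot>\<^sub>m A X) = (1 / \<mu>) \<cdot>\<^sub>m (P' * A X)"
        using Ac by (intro mult_smult_dim) auto
      then show ?thesis unfolding AX using XA by simp
    qed
    moreover have "((1 / \<mu>) \<cdot>\<^sub>m A X) * P' = X"
    proof -
      have "((1 / \<mu>) \<cdot>\<^sub>m A X) * P' = (1 / \<mu>) \<cdot>\<^sub>m (A X * P')"
        using Ac by (intro smult_mult_dim) auto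
      then show ?thesis unfolding AX using XA by simp
    qed
    ultimately have PX: "P' * X = X" "X * P' = X" by metis+
    have "Q * (P' * X) = P' * X"
      using X(1) by (intro mult_absorb Q_P') auto
    moreover have "(X * P') * Q = X * P'"
      using X(1) by (simp add: mult_assoc_dim Q_P')
    ultimately have QX: "Q * X = X" "X * Q = X" unfolding PX by auto
    then have XL: "X \<in> L" using X(1) by (simp add: L_def)
    \<comment> \<open>The component of \<open>X\<close> orthogonal to \<open>Q\<close>, that is, its
      traceless part within the input space.\<close>
    define Y where "Y = X - (?t / of_nat d) \<cdot>\<^sub>m Q"
    have Y: "Y \<in> carrier_mat n n" using X(1) by (auto simp: Y_def intro!: carrier_matI)
    have XQ: "mtrace (adj X * Q) = cnj ?t"
    proof -
      have "adj X * Q = adj X" using arg_cong[OF QX(1), of adj] X(1) by (simp add: adj_mult Q)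
      then show ?thesis using X(1) by (simp add: mtrace_adj)
    qed
    have QXt: "mtrace (Q * X) = ?t" using QX by simp
    have nY: "(frob Y)\<^sup>2 = ?n - (cmod ?t)\<^sup>2 / real d"
    proof -
      have "complex_of_real ((frob Y)\<^sup>2) = of_real ?n - ?t * cnj ?t / of_nat d"
        unfolding mtrace_adj_self[symmetric] Y_def using X(1) d_pos
        by (simp add: adj_minus adj_smult mult_minus_dim minus_mult_dim mult_smult_dim smult_mult_dim
            mtrace_minus mtrace_smult Q XQ QXt trQ)
      also have "?t * cnj ?t = of_real ((cmod ?t)\<^sup>2)" by (rule complex_norm_square[symmetric])
      finally have "complex_of_real ((frob Y)\<^sup>2) = complex_of_real (?n - (cmod ?t)\<^sup>2 / real d)" by simp
      then show ?thesis unfolding of_real_eq_iff .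
    qed
    have FQ: "F Q = 0\<^sub>m n n"
      using d_pos Q by (simp add: F_def D_Q trQ) (intro eq_matI, auto)
    have FY: "F Y = F X"
    proof -
      have "F X = F (Y + (?t / of_nat d) \<cdot>\<^sub>m Q)"
        by (rule arg_cong[of _ _ F]) (use X(1) in \<open>auto simp: Y_def intro!: eq_matI\<close>)
      also have "\<dots> = F Y + (?t / of_nat d) \<cdot>\<^sub>m F Q"
        using selfadjoint_superop.add[OF F_superop Y, of "(?t / of_nat d) \<cdot>\<^sub>m Q"]
          selfadjoint_superop.smult[OF F_superop Q(1)] Q(1) by simp
      finally show ?thesis
        using selfadjoint_superop.closed[OF F_superop Y] FQ by simp
    qed
    have "mtrace (adj X * D X) = mtrace (adj X * F X) + ?t / of_nat d * cnj ?t"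
      using X(1) by (simp add: F_eq[OF XL] mult_minus_dim mult_smult_dim mtrace_minus mtrace_smult XQ)
    \<comment> \<open>\<open>F\<close> annihilates \<open>Q\<close>, so \<open>F X = F Y\<close>;
      self-adjointness allows the same replacement in the other argument.\<close>
    also have "mtrace (adj X * F X) = mtrace (adj Y * F Y)"
    proof -
      have "mtrace (adj X * F X) = mtrace (adj X * F Y)" by (simp add: FY)
      also have "\<dots> = mtrace (adj (F X) * Y)" by (rule selfadjoint_superop.selfadj[OF F_superop Y X(1)])
      also have "\<dots> = mtrace (adj (F Y) * Y)" by (simp add: FY)
      also have "\<dots> = mtrace (adj Y * F Y)" by (rule selfadjoint_superop.selfadj[OF F_superop Y Y, symmetric])
      finally show ?thesis .
    qed
    also have "?t / of_nat d * cnj ?t = of_real ((cmod ?t)\<^sup>2 / real d)"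
      using complex_norm_square[of ?t] by simp
    finally have "cmod (mtrace (adj X * D X)) \<le> cmod (mtrace (adj Y * F Y)) + (cmod ?t)\<^sup>2 / real d"
      using norm_triangle_ineq[of "mtrace (adj Y * F Y)" "of_real ((cmod ?t)\<^sup>2 / real d)"]
      by (simp del: of_real_divide of_real_power)
    also have "cmod (mtrace (adj Y * F Y)) \<le> frob Y * frob (F Y)"
      using Y selfadjoint_superop.closed[OF F_superop Y] by (intro frob_cauchy_schwarz) auto
    also have "\<dots> \<le> frob Y * (lam * frob Y)"
      by (rule mult_left_mono[OF F_bound[OF Y]]) simp
    also have "\<dots> = lam * (?n - (cmod ?t)\<^sup>2 / real d)"
      using nY by (simp add: power2_eq_square)
    finally have "cmod (mtrace (adj X * D X)) \<le> lam * ?n + (1 - lam) * ((cmod ?t)\<^sup>2 / real d)"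
      by (simp add: algebra_simps diff_divide_distrib)
    also have "\<dots> \<le> lam * ?n + (1 - lam) * ((real d - 1) * ?n / real d)"
    proof -
      \<comment> \<open>Testing the trace against \<open>P'\<close>, of squared norm
        \<open>d - 1\<close>, instead of \<open>Q\<close>, of squared norm \<open>d\<close>, is the
        whole gain: with \<open>d\<close> here the resulting bound would be 1.\<close>
      have "?t = mtrace (adj P' * X)" by (simp add: PX)
      then have "cmod ?t \<le> frob P' * frob X"
        using frob_cauchy_schwarz[of P' X] X(1) by simp
      then have "(cmod ?t)\<^sup>2 \<le> (frob P' * frob X)\<^sup>2" by (rule power_mono) simp
      then have "(cmod ?t)\<^sup>2 \<le> (real d - 1) * ?n" by (simp add: power_mult_distrib frob_P')
      then show ?thesis
        using lam_le_1 d_pos by (intro add_left_mono mult_left_mono divide_right_mono) auto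
    qed
    also have "\<dots> = contr * ?n"
      using d_pos by (simp add: contr_def field_simps)
    finally have "cmod (mtrace (adj X * D X)) \<le> contr * ?n" .
    moreover have "mtrace (adj X * A X) = mtrace (adj X * D X)"
      using mtrace_conj_proj[OF D_carrier[OF X(1)] X(1) P'_carrier adj_P'] D_selfadj[OF X(1) X(1)] PX X(1)
      by (simp add: A_def)
    moreover have "mtrace (adj X * A X) = \<mu> * of_real ?n"
      unfolding X(3) using X(1) by (simp add: mult_smult_dim mtrace_smult mtrace_adj_self)
    then have "cmod (mtrace (adj X * A X)) = cmod \<mu> * ?n"
      by (simp add: norm_mult norm_power)
    ultimately have "cmod \<mu> * ?n \<le> contr * ?n"
      by simp
    moreover have "0 < frob X" using X frob_zero_iff[of X] frob_nonneg[of X] by (auto simp: less_le)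
    ultimately show ?thesis by simp
  qed (simp add: contr_nonneg)
qed

text \<open>The projection that the circuit carries out: it removes \<open>\<phi> 1\<close> from the
  whole space. On operators in \<open>L\<close> it acts like \<open>P'\<close>.\<close>

definition Qf :: "complex mat" where
  "Qf = 1\<^sub>m n - ketbra (\<phi> 1)"

text \<open>One round on the unnormalised failed state, averaged over the choice of the reflection.
  Its projection stands on one side of \<open>D\<close> only, so it need not be self-adjoint;
  \<open>A\<close> is the symmetric form.\<close>

definition G :: "complex mat \<Rightarrow> complex mat" where
  "G X = D (Qf * X * Qf)"

lemma Qf_carrier [simp]: "Qf \<in> carrier_mat n n"
  by (auto simp: Qf_def intro!: carrier_matI)

lemma dim_Qf [simp]: "dim_row Qf = n" "dim_col Qf = n"
  using carrier_matD[OF Qf_carrier] by auto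

lemma Qf_L:
  assumes "X \<in> L"
  shows "Qf * X * Qf = P' * X * P'"
proof -
  have *: "Qf * Q = P'" "Q * Qf = P'"
    using ketbra1 by (simp_all add: Qf_def P'_def mult_minus_dim minus_mult_dim)
  have "Qf * X * Qf = Qf * (Q * X * Q) * Qf"
    using assms by (simp add: L_def)
  also have "\<dots> = (Qf * Q) * X * (Q * Qf)"
    using L_carrier[OF assms] by (simp add: mult_assoc_dim)
  finally show ?thesis by (simp add: *)
qed

lemma PXP_L: "X \<in> carrier_mat n n \<Longrightarrow> P' * X * P' \<in> L"
  by (auto simp: L_def mult_assoc_dim Q_P' mult_absorb intro!: carrier_matI)

lemma D_L: "X \<in> L \<Longrightarrow> D X \<in> L"
  by (simp add: L_def Q_mult_D D_mult_Q)

lemma G_L: "X \<in> L \<Longrightarrow> G X \<in> L"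
  unfolding G_def by (simp add: Qf_L PXP_L D_L L_carrier)

lemma G_pow_L: "X \<in> L \<Longrightarrow> (G ^^ T) X \<in> L"
  by (induction T) (auto simp: G_L)

text \<open>Regrouping: since the projection is idempotent it can be doubled between rounds, and the
  additional projection at the end completes the last symmetric round.\<close>

lemma G_pow:
  assumes X: "X \<in> L"
  shows "P' * (G ^^ T) X * P' = (A ^^ T) (P' * X * P')"
proof (induction T)
  case (Suc T)
  let ?Y = "(G ^^ T) X"
  have Y: "?Y \<in> L" by (rule G_pow_L[OF X])
  have Yc: "?Y \<in> carrier_mat n n" by (rule L_carrier[OF Y])
  have PP: "P' * (P' * ?Y * P') * P' = P' * ?Y * P'"
    using Yc by (simp add: mult_assoc_dim mult_absorb)
  have "(A ^^ Suc T) (P' * X * P') = A (P' * ?Y * P')" by (simp add: Suc)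
  also have "\<dots> = P' * D (P' * ?Y * P') * P'" unfolding A_def PP ..
  also have "\<dots> = P' * (G ^^ Suc T) X * P'" by (simp add: G_def Qf_L[OF Y])
  finally show ?case ..
qed simp

lemma frob_A_pow: "X \<in> carrier_mat n n \<Longrightarrow> (A ^^ T) X \<in> carrier_mat n n \<and> frob ((A ^^ T) X) \<le> contr ^ T * frob X"
proof (induction T)
  case (Suc T)
  then have Y: "(A ^^ T) X \<in> carrier_mat n n" "frob ((A ^^ T) X) \<le> contr ^ T * frob X" by auto
  have "frob (A ((A ^^ T) X)) \<le> contr * (contr ^ T * frob X)"
    using order_trans[OF A_bound[OF Y(1)] mult_left_mono[OF Y(2) contr_nonneg]] .
  then show ?case
    using selfadjoint_superop.closed[OF A_superop Y(1)] by (simp add: mult_ac)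
qed simp

text \<open>The operator left after the rounds is supported on the input space, so its trace is its
  inner product with \<open>Q\<close>; Cauchy-Schwarz then costs the factor \<open>frob Q\<close>,
  which is \<open>sqrt d\<close>.\<close>

lemma failure_bound:
  assumes X: "X \<in> L" and f: "frob X \<le> 1"
  shows "Re (mtrace (Qf * (G ^^ T) X * Qf)) \<le> sqrt (real d) * contr ^ T"
proof -
  have Xc: "X \<in> carrier_mat n n" by (rule L_carrier[OF X])
  have PXP: "P' * X * P' \<in> carrier_mat n n" using Xc by (auto intro!: carrier_matI)
  have "frob (P' * X * P') \<le> frob X"
  proof -
    have "frob (P' * (X * P')) \<le> frob (X * P')"
      using Xc by (intro frob_proj_le) auto
    also have "\<dots> = frob (adj (X * P'))" by simp
    also have "adj (X * P') = P' * adj X" using Xc by (simp add: adj_mult)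
    also have "frob \<dots> \<le> frob (adj X)"
      using Xc by (intro frob_proj_le) auto
    finally show ?thesis using Xc by (simp add: mult_assoc_dim)
  qed
  then have fP: "frob (P' * X * P') \<le> 1" using f by simp
  let ?B = "(A ^^ T) (P' * X * P')"
  have B: "?B \<in> carrier_mat n n" "frob ?B \<le> contr ^ T * frob (P' * X * P')"
    using frob_A_pow[OF PXP] by auto
  have "Qf * (G ^^ T) X * Qf = ?B"
    using Qf_L[OF G_pow_L[OF X]] G_pow[OF X] by simp
  moreover have "Q * ?B = ?B"
    using PXP_L[OF L_carrier[OF G_pow_L[OF X, of T]]] G_pow[OF X, of T] by (simp add: L_def)
  ultimately have "Re (mtrace (Qf * (G ^^ T) X * Qf)) \<le> cmod (mtrace (adj Q * ?B))"
    using complex_Re_le_cmod[of "mtrace ?B"] by (simp add: Q)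
  also have "\<dots> \<le> frob Q * frob ?B"
    using B by (intro frob_cauchy_schwarz) auto
  also have "\<dots> \<le> sqrt (real d) * (contr ^ T * 1)"
    unfolding frob_Q using B(2) mult_left_mono[OF fP, of "contr ^ T"] contr_nonneg
    by (intro mult_left_mono) auto
  finally show ?thesis by simp
qed

end

section \<open>Kronecker products and partial traces\<close>

lemma dim_kron [simp]: "dim_row (kron A B) = dim_row A * dim_row B" "dim_col (kron A B) = dim_col A * dim_col B"
  by (simp_all add: kron_def)

lemma index_kron [simp]:
  "i < dim_row A * dim_row B \<Longrightarrow> j < dim_col A * dim_col B \<Longrightarrow>
   kron A B $$ (i,j) = A $$ (i div dim_row B, j div dim_col B) * B $$ (i mod dim_row B, j mod dim_col B)"
  by (simp add: kron_def)

text \<open>The summation index codes a pair as quotient and remainder; decoding it factorises the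
  sum.\<close>

lemma kron_mult:
  assumes "dim_col A = dim_row C" "dim_col B = dim_row D"
  shows "kron A B * kron C D = kron (A * C) (B * D)"
proof (rule eq_matI)
  fix i j assume "i < dim_row (kron (A * C) (B * D))" "j < dim_col (kron (A * C) (B * D))"
  then have ij: "i < dim_row A * dim_row B" "j < dim_col C * dim_col D" by auto
  note dm = div_mod_less[OF ij(1)] div_mod_less[OF ij(2)]
  let ?i1 = "i div dim_row B" and ?i2 = "i mod dim_row B" and ?j1 = "j div dim_col D" and ?j2 = "j mod dim_col D"
  have "(kron A B * kron C D) $$ (i,j) = (\<Sum>k<dim_row C * dim_row D.
      A $$ (?i1, k div dim_row D) * B $$ (?i2, k mod dim_row D) * (C $$ (k div dim_row D, ?j1) * D $$ (k mod dim_row D, ?j2)))"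
    using ij assms by (subst index_mult_sum) (auto intro!: sum.cong)
  also have "\<dots> = (\<Sum>k<dim_row C * dim_row D. (\<lambda>(k1,k2). (A $$ (?i1, k1) * C $$ (k1, ?j1)) * (B $$ (?i2, k2) * D $$ (k2, ?j2)))
      (k div dim_row D, k mod dim_row D))"
    by (simp add: mult_ac)
  also have "\<dots> = (\<Sum>(k1,k2)\<in>{..<dim_row C} \<times> {..<dim_row D}. (A $$ (?i1, k1) * C $$ (k1, ?j1)) * (B $$ (?i2, k2) * D $$ (k2, ?j2)))"
    by (rule sum.reindex_bij_betw[OF bij_div_mod])
  also have "\<dots> = (\<Sum>k1<dim_row C. A $$ (?i1, k1) * C $$ (k1, ?j1)) * (\<Sum>k2<dim_row D. B $$ (?i2, k2) * D $$ (k2, ?j2))"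
    by (simp add: sum_product sum.cartesian_product)
  also have "\<dots> = kron (A * C) (B * D) $$ (i,j)"
    using ij dm assms by (simp add: index_mult_sum del: index_mult_mat(1))
  finally show "(kron A B * kron C D) $$ (i,j) = kron (A * C) (B * D) $$ (i,j)" .
qed auto

lemma mod_mult_div: "i mod (b * c) div c = i div c mod (b :: nat)"
  by (cases "c = 0") (simp_all add: mod_mult2_eq mult.commute[of b c])

lemma mod_mult_mod: "i mod (b * c) mod c = i mod (c :: nat)"
  by (simp add: mod_mod_cancel)

lemma kron_assoc: "kron (kron A B) C = kron A (kron B C)"
proof (rule eq_matI)
  fix i j assume "i < dim_row (kron A (kron B C))" "j < dim_col (kron A (kron B C))"
  then have ij: "i < dim_row A * dim_row B * dim_row C" "j < dim_col A * dim_col B * dim_col C"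
    by (auto simp: mult.assoc)
  then have ij': "i < dim_row A * (dim_row B * dim_row C)" "j < dim_col A * (dim_col B * dim_col C)"
    by (auto simp: mult.assoc)
  note dm = div_mod_less[OF ij(1)] div_mod_less[OF ij(2)] div_mod_less[OF ij'(1)] div_mod_less[OF ij'(2)]
  have dv: "k div (p * r) = k div r div p" for k p r :: nat
    by (metis div_mult2_eq mult.commute)
  show "kron (kron A B) C $$ (i,j) = kron A (kron B C) $$ (i,j)"
    using ij ij' dm by (simp add: mod_mult_div mod_mult_mod dv del: mult.assoc)
qed (simp_all add: mult.assoc)

lemma kron_add_left:
  "dim_row A = dim_row B \<Longrightarrow> dim_col A = dim_col B \<Longrightarrow> kron (A + B) C = kron A C + kron B C"
  by (rule eq_matI) (auto simp: div_mod_less ring_distribs)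

lemma kron_add_right:
  "dim_row A = dim_row B \<Longrightarrow> dim_col A = dim_col B \<Longrightarrow> kron C (A + B) = kron C A + kron C B"
  by (rule eq_matI) (auto simp: div_mod_less ring_distribs)

lemma kron_minus_left:
  "dim_row A = dim_row B \<Longrightarrow> dim_col A = dim_col B \<Longrightarrow> kron (A - B) C = kron A C - kron B C"
  by (rule eq_matI) (auto simp: div_mod_less ring_distribs)

lemma kron_smult_left: "kron (c \<cdot>\<^sub>m A) B = c \<cdot>\<^sub>m kron A B"
  by (rule eq_matI) (auto simp: div_mod_less)

lemma kron_smult_right: "kron A (c \<cdot>\<^sub>m B) = c \<cdot>\<^sub>m kron A B"
  by (rule eq_matI) (auto simp: div_mod_less)

lemma kron_zero_left [simp]: "kron (0\<^sub>m n m) B = 0\<^sub>m (n * dim_row B) (m * dim_col B)"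
  by (rule eq_matI) (auto simp: div_mod_less)

lemma kron_zero_right [simp]: "kron A (0\<^sub>m n m) = 0\<^sub>m (dim_row A * n) (dim_col A * m)"
  by (rule eq_matI) (auto simp: div_mod_less)

lemma kron_one [simp]: "kron (1\<^sub>m n) (1\<^sub>m m) = 1\<^sub>m (n * m)"
proof (rule eq_matI)
  fix i j assume ij: "i < dim_row (1\<^sub>m (n * m))" "j < dim_col (1\<^sub>m (n * m))"
  then have dm: "i div m < n" "i mod m < m" "j div m < n" "j mod m < m" by (auto simp: div_mod_less)
  have "i = j \<longleftrightarrow> i div m = j div m \<and> i mod m = j mod m"
    by (metis div_mult_mod_eq)
  then show "kron (1\<^sub>m n) (1\<^sub>m m) $$ (i,j) = 1\<^sub>m (n * m) $$ (i,j)"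
    using ij dm by auto
qed auto

lemma kron_one_1 [simp]: "kron A (1\<^sub>m 1) = A" "kron (1\<^sub>m 1) A = A"
  by (rule eq_matI; auto simp: div_mod_less)+

lemma kron_one_Suc0 [simp]: "kron A (1\<^sub>m (Suc 0)) = A" "kron (1\<^sub>m (Suc 0)) A = A"
  using kron_one_1 by simp_all

lemma adj_kron: "adj (kron A B) = kron (adj A) (adj B)"
  by (rule eq_matI) (auto simp: div_mod_less)

lemma mtrace_kron:
  assumes "dim_col A = dim_row A" "dim_col B = dim_row B"
  shows "mtrace (kron A B) = mtrace A * mtrace B"
proof -
  have "mtrace (kron A B) = (\<Sum>k<dim_row A * dim_row B. (\<lambda>(k1,k2). A $$ (k1,k1) * B $$ (k2,k2)) (k div dim_row B, k mod dim_row B))"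
    using assms by (simp add: mtrace_def)
  also have "\<dots> = (\<Sum>(k1,k2)\<in>{..<dim_row A} \<times> {..<dim_row B}. A $$ (k1,k1) * B $$ (k2,k2))"
    by (rule sum.reindex_bij_betw[OF bij_div_mod])
  finally show ?thesis
    by (simp add: mtrace_def sum_product sum.cartesian_product)
qed

lemma frob_kron: "frob (kron A B) = frob A * frob B"
proof -
  have "complex_of_real ((frob (kron A B))\<^sup>2) = complex_of_real ((frob A * frob B)\<^sup>2)"
    by (simp add: mtrace_adj_self[symmetric] adj_kron kron_mult mtrace_kron power_mult_distrib del: of_real_power)
  then have "(frob (kron A B))\<^sup>2 = (frob A * frob B)\<^sup>2"
    unfolding of_real_eq_iff .
  then show ?thesis by simp
qed

lemma ptrace_sys_kron:
  assumes "A \<in> carrier_mat n n" "B \<in> carrier_mat N N" "n > 0"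
  shows "ptrace_sys n (kron A B) = mtrace A \<cdot>\<^sub>m B"
proof (rule eq_matI)
  fix i j assume "i < dim_row (mtrace A \<cdot>\<^sub>m B)" "j < dim_col (mtrace A \<cdot>\<^sub>m B)"
  then have ij: "i < N" "j < N" using assms by auto
  have "(s * N + i) div N = s" "(s * N + i) mod N = i" "(s * N + j) div N = s" "(s * N + j) mod N = j" for s
    using ij by (auto simp: div_mult_self3)
  then show "ptrace_sys n (kron A B) $$ (i,j) = (mtrace A \<cdot>\<^sub>m B) $$ (i,j)"
    using assms ij by (auto simp: ptrace_sys_def Let_def index_less mtrace_def sum_distrib_right)
qed (use assms in \<open>auto simp: ptrace_sys_def Let_def\<close>)

lemma ptrace_sys_add:
  assumes "dim_row A = n * N" "dim_col A = n * N" "dim_row B = n * N" "dim_col B = n * N" "n > 0"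
  shows "ptrace_sys n (A + B) = ptrace_sys n A + ptrace_sys n B"
  using assms by (intro eq_matI) (auto simp: ptrace_sys_def Let_def index_less sum.distrib)

lemma dim_ptrace_anc [simp]:
  "dim_row (ptrace_anc N \<sigma>) = dim_row \<sigma> div N" "dim_col (ptrace_anc N \<sigma>) = dim_row \<sigma> div N"
  by (simp_all add: ptrace_anc_def Let_def)

lemma adj_ptrace_anc:
  assumes "dim_row A = n * N" "dim_col A = n * N" "N > 0"
  shows "adj (ptrace_anc N A) = ptrace_anc N (adj A)"
  using assms by (intro eq_matI) (auto simp: ptrace_anc_def Let_def index_less)

lemma ptrace_anc_kron:
  assumes "A \<in> carrier_mat n n" "B \<in> carrier_mat N N" "N > 0"
  shows "ptrace_anc N (kron A B) = mtrace B \<cdot>\<^sub>m A"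
proof (rule eq_matI)
  fix i j assume "i < dim_row (mtrace B \<cdot>\<^sub>m A)" "j < dim_col (mtrace B \<cdot>\<^sub>m A)"
  then have ij: "i < n" "j < n" using assms by auto
  then show "ptrace_anc N (kron A B) $$ (i,j) = (mtrace B \<cdot>\<^sub>m A) $$ (i,j)"
    using assms by (auto simp: ptrace_anc_def Let_def index_less mtrace_def sum_distrib_right mult.commute[of "A $$ _"])
qed (use assms in auto)

text \<open>Tracing out the ancillas is adjoint to tensoring with the identity. A test operator on
  the system can therefore be evaluated on the joint space, where the states are available in
  factored form.\<close>

lemma mtrace_ptrace_anc:
  assumes Z: "Z \<in> carrier_mat n n" and \<sigma>: "\<sigma> \<in> carrier_mat (n * N) (n * N)" and N: "N > 0"
  shows "mtrace (Z * ptrace_anc N \<sigma>) = mtrace (kron Z (1\<^sub>m N) * \<sigma>)"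
proof -
  define f where "f i x j y = Z $$ (i,j) * (if x = y then \<sigma> $$ (j * N + y, i * N + x) else 0)" for i x j y
  have "mtrace (kron Z (1\<^sub>m N) * \<sigma>) = (\<Sum>a<n * N. \<Sum>b<n * N. kron Z (1\<^sub>m N) $$ (a,b) * \<sigma> $$ (b,a))"
    using Z \<sigma> by (subst mtrace_mult) auto
  also have "\<dots> = (\<Sum>a<n * N. \<Sum>b<n * N. f (a div N) (a mod N) (b div N) (b mod N))"
  proof (intro sum.cong refl)
    fix a b assume "a \<in> {..<n * N}" "b \<in> {..<n * N}"
    then have "kron Z (1\<^sub>m N) $$ (a,b) = Z $$ (a div N, b div N) * (if a mod N = b mod N then 1 else 0)"
      using Z by (auto simp: div_mod_less)
    then show "kron Z (1\<^sub>m N) $$ (a,b) * \<sigma> $$ (b,a) = f (a div N) (a mod N) (b div N) (b mod N)"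
      unfolding f_def div_mult_mod_eq by (cases "a mod N = b mod N") simp_all
  qed
  also have "\<dots> = (\<Sum>a<n * N. \<Sum>(j,y)\<in>{..<n}\<times>{..<N}. f (a div N) (a mod N) j y)"
    using sum.reindex_bij_betw[OF bij_div_mod[of N n], of "\<lambda>(j,y). f i x j y" for i x] by simp
  also have "\<dots> = (\<Sum>(i,x)\<in>{..<n}\<times>{..<N}. \<Sum>(j,y)\<in>{..<n}\<times>{..<N}. f i x j y)"
    using sum.reindex_bij_betw[OF bij_div_mod[of N n], of "\<lambda>(i,x). \<Sum>(j,y)\<in>{..<n}\<times>{..<N}. f i x j y"] by simp
  also have "\<dots> = (\<Sum>i<n. \<Sum>x<N. \<Sum>j<n. \<Sum>y<N. if x = y then Z $$ (i,j) * \<sigma> $$ (j * N + x, i * N + x) else 0)"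
    unfolding sum.cartesian_product[symmetric] f_def by (intro sum.cong refl) auto
  also have "\<dots> = (\<Sum>i<n. \<Sum>x<N. \<Sum>j<n. Z $$ (i,j) * \<sigma> $$ (j * N + x, i * N + x))"
    by (intro sum.cong refl) simp
  also have "\<dots> = (\<Sum>i<n. \<Sum>j<n. \<Sum>x<N. Z $$ (i,j) * \<sigma> $$ (j * N + x, i * N + x))"
    by (rule sum.cong[OF refl], rule sum.swap)
  also have "\<dots> = mtrace (Z * ptrace_anc N \<sigma>)"
    using Z \<sigma> N by (subst mtrace_mult) (auto simp: ptrace_anc_def Let_def sum_distrib_left)
  finally show ?thesis ..
qed

section \<open>Gates and circuit\<close>

abbreviation "k0 \<equiv> colv ket0"
abbreviation "k1 \<equiv> colv ket1"
abbreviation "km \<equiv> colv ket_minus"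

lemma dim_ket [simp]: "dim_vec ket0 = 2" "dim_vec ket1 = 2" "dim_vec ket_minus = 2"
  by (simp_all add: ket0_def ket1_def ket_minus_def)

lemma dim_hadamard [simp]: "dim_row hadamard = 2" "dim_col hadamard = 2"
  by (simp_all add: hadamard_def)

lemma sqrt2_sq: "complex_of_real (sqrt 2) * complex_of_real (sqrt 2) = 2"
  by (simp flip: of_real_mult)

lemma unit_kets: "is_unit_vec 2 ket0" "is_unit_vec 2 ket1" "is_unit_vec 2 ket_minus"
  using sqrt2_sq
  by (auto simp: is_unit_vec_def ket0_def ket1_def ket_minus_def scalar_prod_def numeral_2_eq_2 field_simps)

lemma inner_kets: "adj k0 * k1 = 0\<^sub>m 1 1" "adj k1 * k0 = 0\<^sub>m 1 1"
  by (rule eq_matI; auto simp: colv_def ket0_def ket1_def scalar_prod_def numeral_2_eq_2)+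

lemma ketbra_k [simp]:
  "ketbra ket0 * k0 = k0" "ketbra ket1 * k1 = k1"
  "ketbra ket0 * k1 = 0\<^sub>m 2 1" "ketbra ket1 * k0 = 0\<^sub>m 2 1"
  using colv_unit[OF unit_kets(1)] colv_unit[OF unit_kets(2)] inner_kets
  by (simp_all add: ketbra_colv mult_assoc_dim)

lemma ketbra_mult_ketbra [simp]:
  "ketbra ket0 * ketbra ket0 = ketbra ket0" "ketbra ket1 * ketbra ket1 = ketbra ket1"
  "ketbra ket0 * ketbra ket1 = 0\<^sub>m 2 2" "ketbra ket1 * ketbra ket0 = 0\<^sub>m 2 2"
  using ketbra_unit_idem[OF unit_kets(1)] ketbra_unit_idem[OF unit_kets(2)]
  by (simp_all add: ketbra_colv[of ket1] ketbra_colv[of ket0] mult_assoc_dim mult_assoc_dim[symmetric, of "adj k0" k1]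
    mult_assoc_dim[symmetric, of "adj k1" k0] inner_kets)

lemma ketbra_sum: "ketbra ket0 + ketbra ket1 = 1\<^sub>m 2"
  by (rule eq_matI) (auto simp: ketbra_def ket0_def ket1_def numeral_2_eq_2 less_Suc_eq)

text \<open>The factor 1/2 is an amplitude of the minus state times an entry of the Hadamard gate,
  both 1 / sqrt 2 up to sign.\<close>

lemma had_minus:
  "hadamard * (ketbra ket0 * km) = (1/2) \<cdot>\<^sub>m (k0 + k1)"
  "hadamard * (ketbra ket1 * km) = (1/2) \<cdot>\<^sub>m (k1 - k0)"
  using sqrt2_sq
  by (intro eq_matI; auto simp: hadamard_def ketbra_def colv_def ket0_def ket1_def ket_minus_def
      scalar_prod_def numeral_2_eq_2 less_Suc_eq field_simps)+

lemma hadamard_invol: "hadamard * hadamard = 1\<^sub>m 2" "adj hadamard = hadamard"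
  using sqrt2_sq
  by (intro eq_matI; auto simp: hadamard_def scalar_prod_def numeral_2_eq_2 less_Suc_eq field_simps)+

lemma add_zero_dim [simp]:
  fixes A :: "complex mat"
  shows "dim_row A = n \<Longrightarrow> dim_col A = m \<Longrightarrow> A + 0\<^sub>m n m = A"
    "dim_row A = n \<Longrightarrow> dim_col A = m \<Longrightarrow> 0\<^sub>m n m + A = A"
  by (auto intro!: eq_matI)

text \<open>System \<open>s\<close>, marked qubit \<open>q\<close>, the qubits before it in
  \<open>x\<close> and those after it in \<open>y\<close>: the shape on which
  \<open>on_sys_qubit\<close> acts factor by factor. Any factor may have several columns.\<close>

definition stv :: "complex mat \<Rightarrow> complex mat \<Rightarrow> complex mat \<Rightarrow> complex mat \<Rightarrow> complex mat" where
  "stv s x q y = kron s (kron x (kron q y))"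

lemma dim_stv [simp]:
  "dim_row (stv s x q y) = dim_row s * (dim_row x * (dim_row q * dim_row y))"
  "dim_col (stv s x q y) = dim_col s * (dim_col x * (dim_col q * dim_col y))"
  by (simp_all add: stv_def)

lemma pow_split: "j < m \<Longrightarrow> 2 ^ j * (2 * 2 ^ (m - Suc j)) = (2 :: nat) ^ m"
  by (metis Suc_diff_Suc add_diff_inverse_nat diff_Suc_1 less_Suc_eq_le less_imp_le_nat not_less power_Suc power_add)

lemma dim_osq [simp]:
  assumes "j < m" "dim_row G = 2" "dim_col G = 2"
  shows "dim_row (on_sys_qubit m j V G) = dim_row V * 2 ^ m" "dim_col (on_sys_qubit m j V G) = dim_col V * 2 ^ m"
  using assms pow_split[of j m] by (simp_all add: on_sys_qubit_def)

lemma osq_apply: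
  assumes "dim_row s = dim_col V" "dim_row q = dim_col G" "dim_row x = 2 ^ j" "dim_row y = 2 ^ (m - 1 - j)"
  shows "on_sys_qubit m j V G * stv s x q y = stv (V * s) x (G * q) y"
  using assms by (simp add: on_sys_qubit_def stv_def kron_mult)

lemma osq_mult:
  assumes "dim_row V' = dim_col V" "dim_row G' = dim_col G"
  shows "on_sys_qubit m j V G * on_sys_qubit m j V' G' = on_sys_qubit m j (V * V') (G * G')"
  using assms by (simp add: on_sys_qubit_def kron_mult)

lemma adj_osq: "adj (on_sys_qubit m j V G) = on_sys_qubit m j (adj V) (adj G)"
  by (simp add: on_sys_qubit_def adj_kron)

lemma osq_add:
  assumes "dim_row G = dim_row G'" "dim_col G = dim_col G'"
  shows "on_sys_qubit m j V (G + G') = on_sys_qubit m j V G + on_sys_qubit m j V G'"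
  using assms by (simp add: on_sys_qubit_def kron_add_left kron_add_right)

lemma osq_one: "j < m \<Longrightarrow> on_sys_qubit m j (1\<^sub>m n) (1\<^sub>m 2) = 1\<^sub>m (n * 2 ^ m)"
  by (simp add: on_sys_qubit_def pow_split)

lemma osq_zero: "j < m \<Longrightarrow> on_sys_qubit m j V (0\<^sub>m 2 2) = 0\<^sub>m (dim_row V * 2 ^ m) (dim_col V * 2 ^ m)"
  by (simp add: on_sys_qubit_def pow_split)

lemma osq_Suc:
  assumes "j < m"
  shows "on_sys_qubit (m + 1) j V G = kron (on_sys_qubit m j V G) (1\<^sub>m 2)"
proof -
  have "(2::nat) ^ (m - j) = 2 ^ (m - Suc j) * 2"
    using assms by (metis Suc_diff_Suc mult.commute power_Suc)
  then show ?thesis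
    by (simp add: on_sys_qubit_def kron_assoc)
qed

lemma dim_ctrl [simp]:
  assumes "j < m"
  shows "dim_row (ctrl_refl m j \<phi>) = dim_vec \<phi> * 2 ^ m" "dim_col (ctrl_refl m j \<phi>) = dim_vec \<phi> * 2 ^ m"
  using assms by (simp_all add: ctrl_refl_def)

lemma dim_had_on [simp]:
  assumes "j < m"
  shows "dim_row (had_on n m j) = n * 2 ^ m" "dim_col (had_on n m j) = n * 2 ^ m"
  using assms by (simp_all add: had_on_def)

lemma had_on_invol:
  assumes "j < m"
  shows "adj (had_on n m j) = had_on n m j" "had_on n m j * had_on n m j = 1\<^sub>m (n * 2 ^ m)"
  using assms by (simp_all add: had_on_def adj_osq osq_mult hadamard_invol osq_one)

lemma ctrl_invol:
  assumes j: "j < m" and u: "is_unit_vec n \<phi>"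
  shows "adj (ctrl_refl m j \<phi>) = ctrl_refl m j \<phi>" "ctrl_refl m j \<phi> * ctrl_refl m j \<phi> = 1\<^sub>m (n * 2 ^ m)"
proof -
  have n: "dim_vec \<phi> = n" using u by (auto simp: is_unit_vec_def)
  show "adj (ctrl_refl m j \<phi>) = ctrl_refl m j \<phi>"
    using j by (simp add: ctrl_refl_def adj_add adj_osq)
  have "ctrl_refl m j \<phi> * ctrl_refl m j \<phi> =
      on_sys_qubit m j (1\<^sub>m n) (ketbra ket0) + on_sys_qubit m j (1\<^sub>m n) (ketbra ket1)"
    using j n refl_op_idem[OF u] by (simp add: ctrl_refl_def mult_add_dim add_mult_dim osq_mult osq_zero)
  also have "\<dots> = 1\<^sub>m (n * 2 ^ m)"
    using j by (subst osq_add[symmetric]) (auto simp: ketbra_sum osq_one)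
  finally show "ctrl_refl m j \<phi> * ctrl_refl m j \<phi> = 1\<^sub>m (n * 2 ^ m)" .
qed

lemma stv_zero_s [simp]: "stv (0\<^sub>m a b) x q y = 0\<^sub>m (a * (dim_row x * (dim_row q * dim_row y))) (b * (dim_col x * (dim_col q * dim_col y)))"
  by (simp add: stv_def)

lemma stv_zero_q [simp]: "stv s x (0\<^sub>m a b) y = 0\<^sub>m (dim_row s * (dim_row x * (a * dim_row y))) (dim_col s * (dim_col x * (b * dim_col y)))"
  by (simp add: stv_def)

lemma ctrl_apply:
  assumes j: "j < m" and "dim_row s = dim_vec \<phi>" "dim_row q = 2" "dim_row x = 2 ^ j" "dim_row y = 2 ^ (m - 1 - j)"
  shows "ctrl_refl m j \<phi> * stv s x q y = stv s x (ketbra ket0 * q) y + stv (refl_op \<phi> * s) x (ketbra ket1 * q) y"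
  unfolding ctrl_refl_def using assms by (simp add: add_mult_dim osq_apply pow_split)

lemma ctrl_k0:
  assumes j: "j < m" and "dim_row s = dim_vec \<phi>" "dim_row x = 2 ^ j" "dim_row y = 2 ^ (m - 1 - j)"
  shows "ctrl_refl m j \<phi> * stv s x k0 y = stv s x k0 y"
  using assms by (subst ctrl_apply) (auto intro!: eq_matI)

lemma ctrl_k1:
  assumes j: "j < m" and "dim_row s = dim_vec \<phi>" "dim_row x = 2 ^ j" "dim_row y = 2 ^ (m - 1 - j)"
  shows "ctrl_refl m j \<phi> * stv s x k1 y = stv (refl_op \<phi> * s) x k1 y"
  using assms by (subst ctrl_apply) (auto intro!: eq_matI)

text \<open>A Hadamard test. With a control in the minus state the outputs are half of
  \<open>s - R s\<close> on 0 and half of \<open>s + R s\<close> on 1, and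
  \<open>R = 1 - 2 P\<close> turns these into \<open>P s\<close> and \<open>s - P s\<close>.\<close>

lemma had_ctrl:
  assumes j: "j < m" and d: "dim_row s = dim_vec \<phi>" "dim_vec \<phi> = n" "dim_row x = 2 ^ j" "dim_row y = 2 ^ (m - 1 - j)"
  shows "had_on n m j * (ctrl_refl m j \<phi> * stv s x km y) =
    stv (ketbra \<phi> * s) x k0 y + stv ((1\<^sub>m n - ketbra \<phi>) * s) x k1 y"
proof -
  have "had_on n m j * (ctrl_refl m j \<phi> * stv s x km y) =
      stv s x ((1/2) \<cdot>\<^sub>m (k0 + k1)) y + stv (refl_op \<phi> * s) x ((1/2) \<cdot>\<^sub>m (k1 - k0)) y"
    using assms by (simp add: ctrl_apply mult_add_dim had_on_def osq_apply had_minus pow_split)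
  also have "refl_op \<phi> * s = s - 2 \<cdot>\<^sub>m (ketbra \<phi> * s)"
    using d by (simp add: refl_op_def minus_mult_dim smult_mult_dim)
  also have "stv s x ((1/2) \<cdot>\<^sub>m (k0 + k1)) y + stv (s - 2 \<cdot>\<^sub>m (ketbra \<phi> * s)) x ((1/2) \<cdot>\<^sub>m (k1 - k0)) y
    = stv (ketbra \<phi> * s) x k0 y + stv (s - ketbra \<phi> * s) x k1 y"
  proof (rule eq_matI)
    let ?r = "dim_row x * (2 * dim_row y)" and ?c = "dim_col x * (1 * dim_col y)"
    fix i l assume "i < dim_row (stv (ketbra \<phi> * s) x k0 y + stv (s - ketbra \<phi> * s) x k1 y)"
      "l < dim_col (stv (ketbra \<phi> * s) x k0 y + stv (s - ketbra \<phi> * s) x k1 y)"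
    then have il: "i < n * ?r" "l < dim_col s * ?c" using d by auto
    note dm = div_mod_less[OF il(1)] div_mod_less[OF il(2)]
    have dm2: "i mod ?r mod (2 * dim_row y) < 2 * dim_row y" "l mod ?c mod (1 * dim_col y) < 1 * dim_col y"
      "i mod ?r div (2 * dim_row y) < dim_row x" "l mod ?c div (1 * dim_col y) < dim_col x"
      using div_mod_less[of "i mod ?r" "dim_row x" "2 * dim_row y"] div_mod_less[of "l mod ?c" "dim_col x" "1 * dim_col y"] dm by auto
    have dm3: "i mod ?r mod (2 * dim_row y) div dim_row y < 2" "l mod ?c mod (1 * dim_col y) div dim_col y < 1"
      using div_mod_less[OF dm2(1)] div_mod_less[OF dm2(2)] by auto
    show "(stv s x ((1/2) \<cdot>\<^sub>m (k0 + k1)) y + stv (s - 2 \<cdot>\<^sub>m (ketbra \<phi> * s)) x ((1/2) \<cdot>\<^sub>m (k1 - k0)) y) $$ (i,l) =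
      (stv (ketbra \<phi> * s) x k0 y + stv (s - ketbra \<phi> * s) x k1 y) $$ (i,l)"
      using il dm dm2 dm3 d by (simp add: stv_def field_simps del: index_mult_mat(1))
  qed (use d in auto)
  also have "s - ketbra \<phi> * s = (1\<^sub>m n - ketbra \<phi>) * s"
    using d by (simp add: minus_mult_dim)
  finally show ?thesis .
qed

lemma dim_W_op [simp]:
  assumes "j < m" "dim_vec \<phi>k = n" "dim_vec \<phi>1 = n"
  shows "dim_row (W_op m j \<phi>k \<phi>1) = n * 2 ^ m" "dim_col (W_op m j \<phi>k \<phi>1) = n * 2 ^ m"
  using assms by (simp_all add: W_op_def)

lemma W_op_apply:
  assumes j: "j < m" and d: "dim_row s = n" "dim_vec \<phi>1 = n" "dim_vec \<phi>k = n" "dim_row x = 2 ^ j" "dim_row y = 2 ^ (m - 1 - j)"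
  shows "W_op m j \<phi>k \<phi>1 * stv s x km y =
    stv (ketbra \<phi>1 * s) x k0 y + stv (refl_op \<phi>k * ((1\<^sub>m n - ketbra \<phi>1) * s)) x k1 y"
proof -
  have "W_op m j \<phi>k \<phi>1 * stv s x km y =
      ctrl_refl m j \<phi>k * (had_on n m j * (ctrl_refl m j \<phi>1 * stv s x km y))"
    unfolding W_op_def using assms by (simp add: mult_assoc_dim pow_split)
  also have "\<dots> = ctrl_refl m j \<phi>k * stv (ketbra \<phi>1 * s) x k0 y +
      ctrl_refl m j \<phi>k * stv ((1\<^sub>m n - ketbra \<phi>1) * s) x k1 y"
    using assms by (subst had_ctrl) (auto simp: mult_add_dim pow_split)
  also have "\<dots> = stv (ketbra \<phi>1 * s) x k0 y + stv (refl_op \<phi>k * ((1\<^sub>m n - ketbra \<phi>1) * s)) x k1 y"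
    using assms by (simp add: ctrl_k0 ctrl_k1)
  finally show ?thesis .
qed

lemma W_op_unitary:
  assumes j: "j < m" and u: "is_unit_vec n \<phi>k" "is_unit_vec n \<phi>1"
  shows "adj (W_op m j \<phi>k \<phi>1) * W_op m j \<phi>k \<phi>1 = 1\<^sub>m (n * 2 ^ m)"
    "W_op m j \<phi>k \<phi>1 * adj (W_op m j \<phi>k \<phi>1) = 1\<^sub>m (n * 2 ^ m)"
proof -
  have d: "dim_vec \<phi>k = n" "dim_vec \<phi>1 = n" using u by (auto simp: is_unit_vec_def)
  note ck = ctrl_invol[OF j u(1)] and c1 = ctrl_invol[OF j u(2)] and h = had_on_invol[OF j, of n]
  have a: "adj (W_op m j \<phi>k \<phi>1) = ctrl_refl m j \<phi>1 * (had_on n m j * ctrl_refl m j \<phi>k)"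
    unfolding W_op_def using j d by (simp add: adj_mult ck c1 h)
  show "adj (W_op m j \<phi>k \<phi>1) * W_op m j \<phi>k \<phi>1 = 1\<^sub>m (n * 2 ^ m)"
    unfolding a unfolding W_op_def using j d
    by (simp add: mult_assoc_dim mult_assoc_dim[symmetric, of "ctrl_refl m j \<phi>k" "ctrl_refl m j \<phi>k"] ck
      mult_assoc_dim[symmetric, of "had_on n m j" "had_on n m j"] h c1)
  show "W_op m j \<phi>k \<phi>1 * adj (W_op m j \<phi>k \<phi>1) = 1\<^sub>m (n * 2 ^ m)"
    unfolding a unfolding W_op_def using j d
    by (simp add: mult_assoc_dim mult_assoc_dim[symmetric, of "ctrl_refl m j \<phi>1" "ctrl_refl m j \<phi>1"] ck
      mult_assoc_dim[symmetric, of "had_on n m j" "had_on n m j"] h c1)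
qed

lemma refl_op_image:
  assumes U: "U \<in> carrier_mat n n" "U * adj U = 1\<^sub>m n" and \<phi>: "dim_vec \<phi> = n"
  shows "refl_op (U *\<^sub>v \<phi>) = U * refl_op \<phi> * adj U"
proof -
  have "ketbra (U *\<^sub>v \<phi>) = U * ketbra \<phi> * adj U"
    using U(1) \<phi> by (simp add: ketbra_colv mult_colv[symmetric] adj_mult mult_assoc_dim)
  then show ?thesis
    using U \<phi> by (simp add: refl_op_def mult_minus_dim minus_mult_dim mult_smult_dim smult_mult_dim)
qed

text \<open>The output reflections are the input ones conjugated by \<open>U\<close>, the Hadamard
  gate does not touch the system, and adjacent factors of \<open>U\<close> and its adjoint cancel.
  This is how \<open>U\<close> gets into a circuit that never applies it.\<close>

lemma W_op_image:
  assumes j: "j < m" and U: "U \<in> carrier_mat n n" "U * adj U = 1\<^sub>m n" "adj U * U = 1\<^sub>m n"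
    and d: "dim_vec \<phi>k = n" "dim_vec \<phi>1 = n"
  shows "W_op m j (U *\<^sub>v \<phi>k) (U *\<^sub>v \<phi>1) = kron U (1\<^sub>m (2 ^ m)) * W_op m j \<phi>k \<phi>1 * kron (adj U) (1\<^sub>m (2 ^ m))"
proof -
  let ?U = "kron U (1\<^sub>m (2 ^ m))" and ?U' = "kron (adj U) (1\<^sub>m (2 ^ m))"
  have os: "on_sys_qubit m j (U * X * adj U) G = ?U * on_sys_qubit m j X G * ?U'"
    if "dim_row X = n" "dim_col X = n" "dim_row G = 2" "dim_col G = 2" for X G
    using that U(1) j pow_split[OF j] by (simp add: on_sys_qubit_def kron_mult)
  have dU: "dim_row U = n" "dim_col U = n" using U by auto
  have c: "ctrl_refl m j (U *\<^sub>v \<phi>) = ?U * ctrl_refl m j \<phi> * ?U'" if \<phi>: "dim_vec \<phi> = n" for \<phi>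
  proof -
    have "ctrl_refl m j (U *\<^sub>v \<phi>) = on_sys_qubit m j (U * 1\<^sub>m n * adj U) (ketbra ket0) +
        on_sys_qubit m j (U * refl_op \<phi> * adj U) (ketbra ket1)"
      using U \<phi> dU by (simp add: ctrl_refl_def refl_op_image)
    also have "\<dots> = ?U * ctrl_refl m j \<phi> * ?U'"
    proof -
      have "on_sys_qubit m j (U * 1\<^sub>m n * adj U) (ketbra ket0) = ?U * on_sys_qubit m j (1\<^sub>m n) (ketbra ket0) * ?U'"
        "on_sys_qubit m j (U * refl_op \<phi> * adj U) (ketbra ket1) = ?U * on_sys_qubit m j (refl_op \<phi>) (ketbra ket1) * ?U'"
        using \<phi> by (intro os; simp)+
      then show ?thesis
        unfolding ctrl_refl_def using \<phi> j dU by (simp only: mult_add_dim add_mult_dim dim_osq dim_kron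
            index_mult_mat index_add_mat index_one_mat dim_ketbra dim_ket dim_refl_op dim_adj)
    qed
    finally show ?thesis .
  qed
  have h: "had_on n m j = ?U * had_on n m j * ?U'"
    using os[of "1\<^sub>m n" hadamard] U dU by (simp add: had_on_def)
  have UU: "?U' * ?U = 1\<^sub>m (n * 2 ^ m)" using U by (simp add: kron_mult)
  have UUX: "?U' * (?U * X) = X" if "dim_row X = n * 2 ^ m" for X
    using that dU UU by (simp add: mult_assoc_dim[symmetric])
  have "W_op m j (U *\<^sub>v \<phi>k) (U *\<^sub>v \<phi>1) = (?U * ctrl_refl m j \<phi>k * ?U') * (?U * had_on n m j * ?U') * (?U * ctrl_refl m j \<phi>1 * ?U')"
    unfolding W_op_def using dU d h c by simp
  also have "\<dots> = ?U * W_op m j \<phi>k \<phi>1 * ?U'"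
    unfolding W_op_def using dU d j by (simp add: mult_assoc_dim UUX)
  finally show ?thesis .
qed

section \<open>Sequences of gates acting on factored states\<close>

definition app :: "('a \<Rightarrow> complex mat) \<Rightarrow> 'a list \<Rightarrow> complex mat \<Rightarrow> complex mat" where
  "app f is X = foldl (\<lambda>X i. f i * X) X is"

lemma app_Nil [simp]: "app f [] X = X"
  by (simp add: app_def)

lemma app_Cons [simp]: "app f (i # is) X = app f is (f i * X)"
  by (simp add: app_def)

lemma app_append [simp]: "app f (is @ js) X = app f js (app f is X)"
  by (simp add: app_def)

definition squares :: "nat \<Rightarrow> ('a \<Rightarrow> complex mat) \<Rightarrow> 'a list \<Rightarrow> bool" where
  "squares N f is \<longleftrightarrow> (\<forall>i\<in>set is. dim_row (f i) = N \<and> dim_col (f i) = N)"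

lemma squares_Cons [simp]: "squares N f (i # is) \<longleftrightarrow> dim_row (f i) = N \<and> dim_col (f i) = N \<and> squares N f is"
  by (auto simp: squares_def)

lemma dim_app:
  "squares N f is \<Longrightarrow> dim_row X = N \<Longrightarrow> dim_row (app f is X) = N"
  "squares N f is \<Longrightarrow> dim_row X = N \<Longrightarrow> dim_col (app f is X) = dim_col X"
  by (induction "is" arbitrary: X) auto

lemma app_minus:
  "squares N f is \<Longrightarrow> dim_row X = N \<Longrightarrow> dim_row Y = N \<Longrightarrow> dim_col X = dim_col Y \<Longrightarrow>
   app f is (X - Y) = app f is X - app f is Y"
  by (induction "is" arbitrary: X Y) (auto simp: mult_minus_dim)

lemma app_smult:
  "squares N f is \<Longrightarrow> dim_row X = N \<Longrightarrow> app f is (c \<cdot>\<^sub>m X) = c \<cdot>\<^sub>m app f is X"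
  by (induction "is" arbitrary: X) (auto simp: mult_smult_dim)

lemma frob_app:
  "squares N f is \<Longrightarrow> (\<And>i. i \<in> set is \<Longrightarrow> adj (f i) * f i = 1\<^sub>m N) \<Longrightarrow> dim_row X = N \<Longrightarrow> frob (app f is X) = frob X"
  by (induction "is" arbitrary: X) (auto simp: frob_isometry)

lemma app_undo:
  assumes "squares N f is" "\<And>i. i \<in> set is \<Longrightarrow> adj (f i) * f i = 1\<^sub>m N" "dim_row X = N"
  shows "app (\<lambda>i. adj (f i)) (rev is) (app f is X) = X"
  using assms
proof (induction "is" arbitrary: X)
  case (Cons i "is")
  have "app (\<lambda>i. adj (f i)) (rev (i # is)) (app f (i # is) X) =
      adj (f i) * app (\<lambda>i. adj (f i)) (rev is) (app f is (f i * X))" by simp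
  also have "app (\<lambda>i. adj (f i)) (rev is) (app f is (f i * X)) = f i * X"
    using Cons by auto
  also have "adj (f i) * (f i * X) = X"
    using Cons.prems by (simp add: mult_assoc_dim[symmetric])
  finally show ?case .
qed simp

lemma conj_by_gram:
  assumes "dim_col B = dim_row X"
  shows "conj_by B (X * adj X) = (B * X) * adj (B * X)"
  using assms by (simp add: conj_by_def adj_mult mult_assoc_dim)

lemma foldl_conj:
  assumes "squares N f is" "dim_row X = N"
  shows "foldl (\<lambda>\<sigma> i. conj_by (f i) \<sigma>) (X * adj X) is = app f is X * adj (app f is X)"
  using assms by (induction "is" arbitrary: X) (auto simp: conj_by_gram)

text \<open>Two summands are what the measurement of \<open>c\<close> leaves, one for each
  outcome.\<close>

lemma foldl_conj_add:
  assumes "squares N f is" "dim_row X = N" "dim_row Y = N"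
  shows "foldl (\<lambda>\<sigma> i. conj_by (f i) \<sigma>) (X * adj X + Y * adj Y) is =
    app f is X * adj (app f is X) + app f is Y * adj (app f is Y)"
  using assms
proof (induction "is" arbitrary: X Y)
  case (Cons i "is")
  have "conj_by (f i) (X * adj X + Y * adj Y) = conj_by (f i) (X * adj X) + conj_by (f i) (Y * adj Y)"
    using Cons.prems by (simp add: conj_by_def mult_add_dim add_mult_dim)
  then show ?case
    using Cons by (simp add: conj_by_gram)
qed simp

primrec qstate :: "complex mat \<Rightarrow> nat \<Rightarrow> complex mat" where
  "qstate q 0 = 1\<^sub>m 1"
| "qstate q (Suc m) = kron (qstate q m) q"

lemma dim_qstate [simp]:
  "dim_row q = 2 \<Longrightarrow> dim_row (qstate q m) = 2 ^ m"
  "dim_col q = 1 \<Longrightarrow> dim_col (qstate q m) = 1"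
  by (induction m) auto

lemma qstate_Suc_left: "qstate q (Suc m) = kron q (qstate q m)"
  by (induction m) (auto simp: kron_assoc)

lemma qstate_unit: "adj q * q = 1\<^sub>m 1 \<Longrightarrow> adj (qstate q m) * qstate q m = 1\<^sub>m 1"
  by (induction m) (auto simp: adj_kron kron_mult)

lemma minus_pow_qstate: "minus_pow m = qstate km m * adj (qstate km m)"
  by (induction m) (auto simp: adj_kron kron_mult ketbra_colv)

text \<open>The row \<open>r\<close> carries the column index of the ensemble and may be attached to
  either tensor factor. This moves the index to the ancillas once the system is in a single
  vector.\<close>

lemma kron_rank1:
  assumes "dim_col u = 1" "dim_row r = 1" "dim_col z = 1"
  shows "kron (u * r) z = kron u (z * r)"
proof -
  have "kron (u * r) (z * 1\<^sub>m 1) = kron u z * kron r (1\<^sub>m 1)"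
    using assms by (subst kron_mult) auto
  moreover have "kron (u * 1\<^sub>m 1) (z * r) = kron u z * kron (1\<^sub>m 1) r"
    using assms by (subst kron_mult) auto
  ultimately show ?thesis using assms by simp
qed

lemma kron_mult_left:
  assumes "dim_col y = 1" "dim_col a = dim_row r"
  shows "kron a y * r = kron (a * r) y"
proof -
  have "kron a y * kron r (1\<^sub>m 1) = kron (a * r) (y * 1\<^sub>m 1)"
    using assms by (subst kron_mult) auto
  then show ?thesis using assms by simp
qed

section \<open>The joint state after the input rounds\<close>

context reflection_mixture
begin

abbreviation "\<phi>c \<equiv> colv (\<phi> 1)"

text \<open>System part, unnormalised, of the branch in which every round has recorded 1.\<close>

definition failed :: "nat list \<Rightarrow> complex mat \<Rightarrow> complex mat" where
  "failed ks X = foldl (\<lambda>X k. R k * (Qf * X)) X ks"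

definition W_in :: "nat list \<Rightarrow> nat \<Rightarrow> complex mat" where
  "W_in ks i = W_op (length ks) i (\<phi> (ks ! i)) (\<phi> 1)"

lemma ketbra_\<phi>c: "ketbra (\<phi> 1) * \<phi>c = \<phi>c"
  using colv_unit[OF unit, of 1] K by (simp add: ketbra_colv mult_assoc_dim)

lemma Qf_\<phi>c: "Qf * \<phi>c = 0\<^sub>m n 1"
  by (simp add: Qf_def minus_mult_dim ketbra_\<phi>c del: One_nat_def) (auto intro!: eq_matI)

lemma adj_Qf [simp]: "adj Qf = Qf"
  by (simp add: Qf_def adj_minus)

lemma Qf_idem: "Qf * Qf = Qf"
  using ketbra1 by (simp add: Qf_def minus_mult_dim mult_minus_dim) (auto intro!: eq_matI)

lemma dim_failed:
  assumes "set ks \<subseteq> {1..K}" "dim_row X = n"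
  shows "dim_row (failed ks X) = n" "dim_col (failed ks X) = dim_col X"
  using assms unfolding failed_def by (induction ks arbitrary: X) (auto simp: dim\<phi>)

lemma failed_snoc: "failed (ks @ [k]) X = R k * (Qf * failed ks X)"
  by (simp add: failed_def)

lemma split_Qf:
  assumes "dim_row g = n"
  shows "g = \<phi>c * (adj \<phi>c * g) + Qf * g"
proof -
  have "\<phi>c * (adj \<phi>c * g) = ketbra (\<phi> 1) * g"
    using assms by (simp add: ketbra_colv mult_assoc_dim)
  then show ?thesis
    using assms by (simp add: Qf_def minus_mult_dim) (auto intro!: eq_matI)
qed

lemma squares_W_in:
  assumes "set ks \<subseteq> {1..K}" "i \<le> length ks"
  shows "squares (n * 2 ^ length ks) (W_in ks) [0..<i]"
  unfolding squares_def W_in_def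
proof (intro ballI)
  fix j assume "j \<in> set [0..<i]"
  then have j: "j < length ks" using assms(2) by auto
  then have "dim_vec (\<phi> (ks ! j)) = n" using assms(1) dim\<phi> nth_mem by blast
  then show "dim_row (W_op (length ks) j (\<phi> (ks ! j)) (\<phi> 1)) = n * 2 ^ length ks \<and>
      dim_col (W_op (length ks) j (\<phi> (ks ! j)) (\<phi> 1)) = n * 2 ^ length ks"
    using dim_W_op[OF j, of "\<phi> (ks ! j)" n "\<phi> 1"] dim\<phi>1 by simp
qed

text \<open>Invariant of the rounds. A system in \<open>\<phi> 1\<close> passes a round unchanged
  and records 0, so the good part keeps its form; the failed branch records 1 and hands its
  component along \<open>\<phi> 1\<close> over to the good part. Mere existence of
  \<open>\<chi>\<close> is enough, since its norm will follow from unitarity.\<close>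

lemma evolution:
  assumes ks: "set ks \<subseteq> {1..K}" and V: "V \<in> carrier_mat n c" and i: "i \<le> length ks"
  shows "\<exists>\<chi>\<in>carrier_mat (2 ^ i) c. app (W_in ks) [0..<i] (kron V (qstate km (length ks))) =
    kron \<phi>c (kron \<chi> (qstate km (length ks - i))) +
    kron (failed (take i ks) V) (kron (qstate k1 i) (qstate km (length ks - i)))"
  using i
proof (induction i)
  case 0
  show ?case
    using V by (intro bexI[of _ "0\<^sub>m 1 c"]) (auto simp: failed_def)
next
  case (Suc i)
  let ?T = "length ks"
  let ?y = "qstate km (?T - Suc i)" and ?o = "qstate k1 i" and ?g = "failed (take i ks) V"
  let ?k = "ks ! i"
  have iT: "i < ?T" using Suc.prems by simp
  have k: "?k \<in> {1..K}" using ks iT nth_mem by blast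
  have dk: "dim_vec (\<phi> ?k) = n" by (rule dim\<phi>[OF k])
  have dg: "dim_row ?g = n" "dim_col ?g = c"
    using dim_failed[of "take i ks" V] ks V set_take_subset[of i ks] by auto
  have mT: "qstate km (?T - i) = kron km ?y"
    using iT qstate_Suc_left[of km "?T - Suc i"] by (simp add: Suc_diff_Suc del: qstate.simps)
  obtain \<chi> where \<chi>: "\<chi> \<in> carrier_mat (2 ^ i) c"
    and IH: "app (W_in ks) [0..<i] (kron V (qstate km ?T)) = stv \<phi>c \<chi> km ?y + stv ?g ?o km ?y"
    using Suc unfolding mT stv_def by auto
  have d\<chi> [simp]: "dim_row \<chi> = 2 ^ i" "dim_col \<chi> = c" using \<chi> by auto
  \<comment> \<open>The row of overlaps of the failed states with \<open>\<phi> 1\<close>. Their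
    component along \<open>\<phi> 1\<close> is the column \<open>\<phi>c\<close> times this row, the
    form that \<open>kron_rank1\<close> can move to the ancillas.\<close>
  let ?r = "adj \<phi>c * ?g"
  have dr: "dim_row ?r = 1" "dim_col ?r = c" using dg by simp_all
  have W1: "W_in ks i * stv \<phi>c \<chi> km ?y = stv \<phi>c \<chi> k0 ?y"
  proof -
    have "W_in ks i * stv \<phi>c \<chi> km ?y = stv (ketbra (\<phi> 1) * \<phi>c) \<chi> k0 ?y + stv (R ?k * (Qf * \<phi>c)) \<chi> k1 ?y"
      unfolding W_in_def Qf_def by (rule W_op_apply) (use iT dk in auto)
    then show ?thesis
      unfolding ketbra_\<phi>c Qf_\<phi>c using dk by simp
  qed
  have W2: "W_in ks i * stv ?g ?o km ?y = stv (\<phi>c * ?r) ?o k0 ?y + stv (R ?k * (Qf * ?g)) ?o k1 ?y"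
  proof -
    have "W_in ks i * stv ?g ?o km ?y = stv (ketbra (\<phi> 1) * ?g) ?o k0 ?y + stv (R ?k * (Qf * ?g)) ?o k1 ?y"
      unfolding W_in_def Qf_def by (rule W_op_apply) (use iT dk dg in auto)
    then show ?thesis
      using dg by (simp add: ketbra_colv mult_assoc_dim)
  qed
  have W3: "stv (\<phi>c * ?r) ?o k0 ?y = kron \<phi>c (kron (kron ?o k0 * ?r) ?y)"
    unfolding stv_def using dr dg
    by (subst kron_rank1) (auto simp: kron_mult_left kron_assoc[symmetric])
  have f: "failed (take (Suc i) ks) V = R ?k * (Qf * ?g)"
    using iT by (simp add: take_Suc_conv_app_nth failed_snoc)
  have dW: "dim_col (W_in ks i) = n * 2 ^ ?T"
    using squares_W_in[OF ks, of "Suc i"] Suc.prems by (auto simp: squares_def)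
  have "app (W_in ks) [0..<Suc i] (kron V (qstate km ?T)) = W_in ks i * (stv \<phi>c \<chi> km ?y + stv ?g ?o km ?y)"
    using IH by simp
  also have "\<dots> = W_in ks i * stv \<phi>c \<chi> km ?y + W_in ks i * stv ?g ?o km ?y"
    using dW dg pow_split[OF iT] by (intro mult_add_dim) auto
  also have "\<dots> = stv \<phi>c \<chi> k0 ?y + (kron \<phi>c (kron (kron ?o k0 * ?r) ?y) + stv (R ?k * (Qf * ?g)) ?o k1 ?y)"
    unfolding W1 W2 W3 ..
  also have "\<dots> = (kron \<phi>c (kron (kron \<chi> k0) ?y) + kron \<phi>c (kron (kron ?o k0 * ?r) ?y)) + stv (R ?k * (Qf * ?g)) ?o k1 ?y"
    unfolding stv_def kron_assoc using dg dk
    by (intro assoc_add_mat[symmetric, of _ "n * (2 ^ i * (2 * 2 ^ (?T - Suc i)))" c] carrier_matI) auto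
  also have "kron \<phi>c (kron (kron \<chi> k0) ?y) + kron \<phi>c (kron (kron ?o k0 * ?r) ?y) =
      kron \<phi>c (kron (kron \<chi> k0 + kron ?o k0 * ?r) ?y)"
    using dg by (subst kron_add_left, simp, simp, subst kron_add_right) auto
  also have "stv (R ?k * (Qf * ?g)) ?o k1 ?y = kron (failed (take (Suc i) ks) V) (kron (qstate k1 (Suc i)) ?y)"
    by (simp add: f stv_def kron_assoc)
  finally show ?case
    using dg by (intro bexI[of _ "kron \<chi> k0 + kron ?o k0 * ?r"]) (auto intro!: carrier_matI)
qed

text \<open>The last reflection can leave a component of the failed branch along
  \<open>\<phi> 1\<close>. Splitting it off anticipates the test with qubit \<open>c\<close>, which
  separates exactly these two terms.\<close>

lemma final_state:
  assumes ks: "set ks \<subseteq> {1..K}" and V: "V \<in> carrier_mat n c"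
  obtains \<chi> where "\<chi> \<in> carrier_mat (2 ^ length ks) c"
    "app (W_in ks) [0..<length ks] (kron V (qstate km (length ks))) =
      kron \<phi>c \<chi> + kron (Qf * failed ks V) (qstate k1 (length ks))"
proof -
  let ?T = "length ks"
  let ?o = "qstate k1 ?T" and ?g = "failed ks V"
  have dg: "dim_row ?g = n" "dim_col ?g = c" using dim_failed[OF ks] V by auto
  obtain \<chi> where \<chi>: "\<chi> \<in> carrier_mat (2 ^ ?T) c"
    and ev: "app (W_in ks) [0..<?T] (kron V (qstate km ?T)) = kron \<phi>c \<chi> + kron ?g ?o"
    using evolution[OF ks V, of ?T] by auto
  let ?r = "adj \<phi>c * ?g"
  have "kron ?g ?o = kron (\<phi>c * ?r + Qf * ?g) ?o"
    using split_Qf[OF dg(1)] by simp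
  also have "\<dots> = kron (\<phi>c * ?r) ?o + kron (Qf * ?g) ?o"
    using dg by (intro kron_add_left) auto
  also have "kron (\<phi>c * ?r) ?o = kron \<phi>c (?o * ?r)"
    by (rule kron_rank1) auto
  finally have "kron \<phi>c \<chi> + kron ?g ?o = kron \<phi>c \<chi> + (kron \<phi>c (?o * ?r) + kron (Qf * ?g) ?o)"
    by simp
  also have "\<dots> = (kron \<phi>c \<chi> + kron \<phi>c (?o * ?r)) + kron (Qf * ?g) ?o"
    using dg \<chi> by (intro assoc_add_mat[symmetric, of _ "n * 2 ^ ?T" c] carrier_matI) auto
  also have "kron \<phi>c \<chi> + kron \<phi>c (?o * ?r) = kron \<phi>c (\<chi> + ?o * ?r)"
    using dg \<chi> by (intro kron_add_right[symmetric]) auto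
  finally have eq: "kron \<phi>c \<chi> + kron ?g ?o = kron \<phi>c (\<chi> + ?o * ?r) + kron (Qf * ?g) ?o" .
  have "\<chi> + ?o * ?r \<in> carrier_mat (2 ^ ?T) c"
    using dg by (intro carrier_matI) auto
  then show ?thesis
    using that[OF _ ev[unfolded eq]] by blast
qed

end

lemma is_unit_vec_iff: "is_unit_vec n v \<longleftrightarrow> dim_vec v = n \<and> adj (colv v) * colv v = 1\<^sub>m 1"
proof
  assume *: "dim_vec v = n \<and> adj (colv v) * colv v = 1\<^sub>m 1"
  have "v \<bullet>c v = (adj (colv v) * colv v) $$ (0,0)"
    by (simp add: colv_def scalar_prod_def lessThan_atLeast0 mult.commute)
  then show "is_unit_vec n v"
    using * by (auto simp: is_unit_vec_def)
qed (use colv_unit in \<open>auto simp: is_unit_vec_def\<close>)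

lemma frob_smult: "frob (c \<cdot>\<^sub>m A) = cmod c * frob A"
proof -
  have "frob (c \<cdot>\<^sub>m A) = L2_set (\<lambda>p. cmod c * cmod (A $$ p)) ({..<dim_row A} \<times> {..<dim_col A})"
    unfolding frob_def by (auto simp: norm_mult intro!: L2_set_cong)
  then show ?thesis by (simp add: frob_def L2_set_right_distrib)
qed

lemma frob_unit: "adj q * q = 1\<^sub>m 1 \<Longrightarrow> frob q = 1"
  by (rule power2_eq_imp_eq) (auto simp: frob_sq)

lemma frob_add_orth:
  assumes "dim_row A = dim_row B" "dim_col A = dim_col B" "mtrace (adj A * B) = 0"
  shows "(frob (A + B))\<^sup>2 = (frob A)\<^sup>2 + (frob B)\<^sup>2"
proof -
  have "mtrace (adj B * A) = cnj (mtrace (adj A * B))"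
    using assms by (subst mtrace_adj[symmetric]) (auto simp: adj_mult)
  then show ?thesis
    using assms by (simp add: frob_sq adj_add mult_add_dim add_mult_dim mtrace_add)
qed

lemma unit_kets_colv: "adj k0 * k0 = 1\<^sub>m 1" "adj k1 * k1 = 1\<^sub>m 1" "adj km * km = 1\<^sub>m 1"
  using unit_kets colv_unit by blast+

lemma W_op_Suc:
  assumes j: "j < m" and d: "dim_vec \<phi>k = n" "dim_vec \<phi>1 = n"
  shows "W_op (m + 1) j \<phi>k \<phi>1 = kron (W_op m j \<phi>k \<phi>1) (1\<^sub>m 2)"
proof -
  have c: "ctrl_refl (m + 1) j \<phi> = kron (ctrl_refl m j \<phi>) (1\<^sub>m 2)" if "dim_vec \<phi> = n" for \<phi>
    unfolding ctrl_refl_def osq_Suc[OF j] using j by (subst kron_add_left) auto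
  have h: "had_on n (m + 1) j = kron (had_on n m j) (1\<^sub>m 2)"
    unfolding had_on_def osq_Suc[OF j] ..
  show ?thesis
    unfolding W_op_def c[OF d(1)] c[OF d(2)] d(2) h using j d by (simp add: kron_mult)
qed

text \<open>Cyclicity turns the trace into the inner product of \<open>y\<close> with
  \<open>Z * x\<close>, and \<open>Z\<close> preserves the norm.\<close>

lemma cauchy_schwarz_unitary:
  assumes "Z \<in> carrier_mat N N" "adj Z * Z = 1\<^sub>m N" "dim_row x = N" "dim_row y = N" "dim_col x = dim_col y"
  shows "cmod (mtrace (Z * (x * adj y))) \<le> frob x * frob y"
proof -
  have "mtrace (Z * (x * adj y)) = mtrace ((Z * x) * adj y)"
    using assms by (simp add: mult_assoc_dim)
  also have "\<dots> = mtrace (adj y * (Z * x))"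
    using assms by (intro mtrace_comm) auto
  finally have "cmod (mtrace (Z * (x * adj y))) \<le> frob y * frob (Z * x)"
    using assms frob_cauchy_schwarz[of y "Z * x"] by simp
  also have "frob (Z * x) = frob x"
    using assms by (intro frob_isometry) auto
  finally show ?thesis by (simp add: mult.commute)
qed

text \<open>With \<open>w = 2 a - e\<close> one has \<open>a a\<^sup>* - (a - e) (a - e)\<^sup>* = (e w\<^sup>* + w e\<^sup>*) / 2\<close>.\<close>
lemma rank_one_difference:
  assumes "Z \<in> carrier_mat N N" "adj Z * Z = 1\<^sub>m N" "dim_row a = N" "dim_row e = N" "dim_col a = dim_col e"
  shows "cmod (mtrace (Z * (a * adj a)) - mtrace (Z * ((a - e) * adj (a - e)))) \<le> frob e * frob (2 \<cdot>\<^sub>m a - e)"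
proof -
  let ?w = "2 \<cdot>\<^sub>m a - e"
  have d: "dim_row Z = N" "dim_col Z = N" using assms by auto
  have "2 * (mtrace (Z * (a * adj a)) - mtrace (Z * ((a - e) * adj (a - e)))) =
      mtrace (Z * (e * adj ?w)) + mtrace (Z * (?w * adj e))"
    using assms(3-5) d
    by (simp add: adj_minus adj_smult mult_minus_dim minus_mult_dim mult_smult_dim smult_mult_dim
        mtrace_minus mtrace_smult)
  then have "2 * cmod (mtrace (Z * (a * adj a)) - mtrace (Z * ((a - e) * adj (a - e)))) =
      cmod (mtrace (Z * (e * adj ?w)) + mtrace (Z * (?w * adj e)))"
    by (metis norm_mult norm_numeral)
  also have "\<dots> \<le> frob e * frob ?w + frob ?w * frob e"
    using assms by (intro order_trans[OF norm_triangle_ineq] add_mono cauchy_schwarz_unitary[OF assms(1,2)]) auto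
  finally show ?thesis by (simp add: mult.commute)
qed

section \<open>Error of the procedure for a fixed sequence of choices\<close>

locale emulator = reflection_mixture +
  fixes U V :: "complex mat" and \<psi> :: "nat \<Rightarrow> complex vec"
  assumes U: "U \<in> carrier_mat n n" "U * adj U = 1\<^sub>m n" "adj U * U = 1\<^sub>m n"
    and V: "V \<in> carrier_mat n n" "frob V = 1"
    and \<psi>: "\<And>k. \<psi> k = U *\<^sub>v \<phi> k"
begin

lemma dimUV [simp]: "dim_row U = n" "dim_col U = n" "dim_row V = n" "dim_col V = n"
  using U V by auto

lemma n_pos: "0 < n"
proof (rule ccontr)
  assume "\<not> 0 < n"
  then have "V = 0\<^sub>m (dim_row V) (dim_col V)" by (intro eq_matI) auto
  then have "frob V = 0" by (simp only: frob_zero_iff)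
  then show False using V by simp
qed

lemma unit_\<psi>: "k \<in> {1..K} \<Longrightarrow> is_unit_vec n (\<psi> k)"
proof -
  assume k: "k \<in> {1..K}"
  have "adj (colv (\<psi> k)) * colv (\<psi> k) = adj (colv (\<phi> k)) * (adj U * U) * colv (\<phi> k)"
    using dim\<phi>[OF k] by (simp add: \<psi> mult_colv[symmetric] adj_mult mult_assoc_dim)
  then show ?thesis
    using unit[OF k] U(3) dim\<phi>[OF k] by (simp add: is_unit_vec_iff \<psi>)
qed

lemma dim\<psi>1 [simp]: "dim_vec (\<psi> k) = n"
  by (simp add: \<psi>)

text \<open>One qubit more than in \<open>W_in\<close>: by then \<open>c\<close> has joined the
  register as its last qubit.\<close>

definition W_out :: "nat list \<Rightarrow> nat \<Rightarrow> complex mat" where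
  "W_out ks i = W_op (length ks + 1) i (\<psi> (ks ! i)) (\<psi> 1)"

definition UU :: "nat list \<Rightarrow> complex mat" where
  "UU ks = kron U (1\<^sub>m (2 ^ (length ks + 1)))"

lemma dim_UU [simp]: "dim_row (UU ks) = n * 2 ^ (length ks + 1)" "dim_col (UU ks) = n * 2 ^ (length ks + 1)"
  by (simp_all add: UU_def)

lemma UU_unitary: "adj (UU ks) * UU ks = 1\<^sub>m (n * 2 ^ (length ks + 1))"
  by (simp add: UU_def adj_kron kron_mult U(3))

context
  fixes ks :: "nat list"
  assumes ks: "set ks \<subseteq> {1..K}"
begin

abbreviation "T \<equiv> length ks"

lemma ks_nth: "i < T \<Longrightarrow> ks ! i \<in> {1..K}"
  using ks nth_mem by blast

lemma W_in_unitary: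
  assumes "i < T"
  shows "adj (W_in ks i) * W_in ks i = 1\<^sub>m (n * 2 ^ T)" "W_in ks i * adj (W_in ks i) = 1\<^sub>m (n * 2 ^ T)"
  unfolding W_in_def using W_op_unitary[OF assms unit unit, of "ks ! i" 1] ks_nth[OF assms] K by auto

lemma dim_W_in [simp]: "i < T \<Longrightarrow> dim_row (W_in ks i) = n * 2 ^ T" "i < T \<Longrightarrow> dim_col (W_in ks i) = n * 2 ^ T"
  unfolding W_in_def using dim_W_op[of i T "\<phi> (ks ! i)" n "\<phi> 1"] dim\<phi>[OF ks_nth, of i] dim\<phi>1 by simp_all

lemma dim_W_out [simp]:
  "i < T \<Longrightarrow> dim_row (W_out ks i) = n * 2 ^ (T + 1)" "i < T \<Longrightarrow> dim_col (W_out ks i) = n * 2 ^ (T + 1)"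
  unfolding W_out_def using dim_W_op[of i "T + 1" "\<psi> (ks ! i)" n "\<psi> 1"] by simp_all

lemma W_out_unitary:
  assumes "i < T"
  shows "W_out ks i * adj (W_out ks i) = 1\<^sub>m (n * 2 ^ (T + 1))"
  unfolding W_out_def using W_op_unitary(2)[of i "T + 1", OF _ unit_\<psi> unit_\<psi>, of "ks ! i" 1] ks_nth[OF assms] assms K by simp

text \<open>Moves \<open>U\<close> past one output gate, so that the inverse circuit can be computed
  on the input side, where it undoes known gates.\<close>

lemma W_out_apply:
  assumes i: "i < T" and Y: "dim_row Y = n * 2 ^ T"
  shows "adj (W_out ks i) * (UU ks * kron Y k0) = UU ks * kron (adj (W_in ks i) * Y) k0"
proof -
  have W: "W_out ks i = UU ks * kron (W_in ks i) (1\<^sub>m 2) * adj (UU ks)"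
    unfolding W_out_def \<psi> UU_def adj_kron adj_one W_in_def
    using W_op_image[of i "T + 1" U n "\<phi> (ks ! i)" "\<phi> 1"] W_op_Suc[OF i, of "\<phi> (ks ! i)" n "\<phi> 1"] i U
      dim\<phi>[OF ks_nth[OF i]] dim\<phi>1 by simp
  have "adj (W_out ks i) * (UU ks * kron Y k0) =
      UU ks * (kron (adj (W_in ks i)) (1\<^sub>m 2) * ((adj (UU ks) * UU ks) * kron Y k0))"
    unfolding W using i Y by (simp add: adj_mult adj_kron mult_assoc_dim)
  also have "\<dots> = UU ks * kron (adj (W_in ks i) * Y) k0"
    unfolding UU_unitary using i Y by (simp add: kron_mult)
  finally show ?thesis .
qed

abbreviation "undo_in \<equiv> app (\<lambda>i. adj (W_in ks i)) (rev [0..<T])"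
abbreviation "undo_out \<equiv> app (\<lambda>i. adj (W_out ks i)) (rev [0..<T])"

lemma undo_out_apply:
  assumes Y: "dim_row Y = n * 2 ^ T"
  shows "undo_out (UU ks * kron Y k0) = UU ks * kron (undo_in Y) k0"
proof -
  have "app (\<lambda>i. adj (W_out ks i)) is (UU ks * kron Y k0) = UU ks * kron (app (\<lambda>i. adj (W_in ks i)) is Y) k0"
    if "set is \<subseteq> {..<T}" for "is"
    using that Y
  proof (induction "is" arbitrary: Y)
    case (Cons i "is")
    then show ?case by (auto simp: W_out_apply)
  qed simp
  then show ?thesis by (simp add: subset_iff)
qed

lemma squares_undo:
  "squares (n * 2 ^ T) (\<lambda>i. adj (W_in ks i)) (rev [0..<T])"
  "squares (n * 2 ^ (T + 1)) (\<lambda>i. adj (W_out ks i)) (rev [0..<T])"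
  unfolding squares_def by (auto simp del: add_Suc_right)

lemma frob_undo_in: "dim_row X = n * 2 ^ T \<Longrightarrow> frob (undo_in X) = frob X"
  by (rule frob_app[OF squares_undo(1)]) (auto simp: W_in_unitary)

lemma frob_undo_out: "dim_row X = n * 2 ^ (T + 1) \<Longrightarrow> frob (undo_out X) = frob X"
  by (rule frob_app[OF squares_undo(2)]) (auto simp: W_out_unitary)

abbreviation "h \<equiv> Qf * failed ks V"
abbreviation "o1 \<equiv> qstate k1 T"

lemma dim_h [simp]: "dim_row (failed ks V) = n" "dim_col (failed ks V) = n"
  using dim_failed[OF ks, of V] by auto

text \<open>The test on \<open>c\<close> sends the two orthogonal terms to different outcomes, and
  ignoring the outcome drops their cross terms. The good term stays coherent when the system is
  replaced, as its ensemble index lives on the ancillas; of the failed system only the weight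
  \<open>(frob h)\<^sup>2\<close> survives the partial trace.\<close>

lemma procedure_out_eq:
  assumes \<chi>: "\<chi> \<in> carrier_mat (2 ^ T) n"
    and ev: "app (W_in ks) [0..<T] (kron V (qstate km T)) = kron \<phi>c \<chi> + kron h o1"
  shows "procedure_out n \<phi> \<psi> ks (V * adj V) = ptrace_anc (2 ^ (T + 1))
    (undo_out (kron (colv (\<psi> 1)) (kron \<chi> k0)) * adj (undo_out (kron (colv (\<psi> 1)) (kron \<chi> k0))) +
     undo_out (complex_of_real (frob h) \<cdot>\<^sub>m kron (colv (\<psi> 1)) (kron o1 k1)) *
       adj (undo_out (complex_of_real (frob h) \<cdot>\<^sub>m kron (colv (\<psi> 1)) (kron o1 k1))))"
proof -
  have d\<chi> [simp]: "dim_row \<chi> = 2 ^ T" "dim_col \<chi> = n" using \<chi> by auto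
  let ?\<Psi> = "kron \<phi>c \<chi> + kron h o1"
  define S0 where "S0 = stv \<phi>c \<chi> k0 (1\<^sub>m 1)"
  define S1 where "S1 = stv h o1 k1 (1\<^sub>m 1)"
  have dS [simp]: "dim_row S0 = n * 2 ^ (T + 1)" "dim_col S0 = n" "dim_row S1 = n * 2 ^ (T + 1)" "dim_col S1 = n"
    by (simp_all add: S0_def S1_def)
  have s0: "kron (V * adj V) (minus_pow T) = kron V (qstate km T) * adj (kron V (qstate km T))"
    by (simp add: minus_pow_qstate adj_kron kron_mult)
  have s1: "foldl (\<lambda>\<sigma> i. conj_by (W_op T i (\<phi> (ks ! i)) (\<phi> 1)) \<sigma>) (kron (V * adj V) (minus_pow T)) [0..<T] =
      ?\<Psi> * adj ?\<Psi>"
    unfolding s0 W_in_def[symmetric] foldl_conj[OF squares_W_in[OF ks le_refl], of "kron V (qstate km T)", simplified]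
      ev ..
  have s2: "kron (?\<Psi> * adj ?\<Psi>) (ketbra ket_minus) = kron ?\<Psi> km * adj (kron ?\<Psi> km)"
    by (simp add: ketbra_colv adj_kron kron_mult)
  have "kron ?\<Psi> km = stv \<phi>c \<chi> km (1\<^sub>m 1) + stv h o1 km (1\<^sub>m 1)"
    by (subst kron_add_left) (auto simp: stv_def kron_assoc)
  moreover have "had_on n (T + 1) T * (ctrl_refl (T + 1) T (\<phi> 1) * stv \<phi>c \<chi> km (1\<^sub>m 1)) = S0"
    by (subst had_ctrl) (auto simp: ketbra_\<phi>c Qf_def[symmetric] Qf_\<phi>c S0_def simp del: One_nat_def)
  moreover have "had_on n (T + 1) T * (ctrl_refl (T + 1) T (\<phi> 1) * stv h o1 km (1\<^sub>m 1)) = S1"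
  proof -
    have "ketbra (\<phi> 1) * Qf = 0\<^sub>m n n"
      using ketbra1 by (simp add: Qf_def mult_minus_dim) (auto intro!: eq_matI)
    then have "ketbra (\<phi> 1) * h = 0\<^sub>m n n"
      by (simp add: mult_assoc_dim[symmetric])
    moreover have "Qf * h = h"
      by (intro mult_absorb Qf_idem) auto
    ultimately show ?thesis
      by (subst had_ctrl) (auto simp: Qf_def[symmetric] S1_def simp del: One_nat_def)
  qed
  ultimately have Z: "had_on n (T + 1) T * (ctrl_refl (T + 1) T (\<phi> 1) * kron ?\<Psi> km) = S0 + S1"
    by (simp add: mult_add_dim)
  have s3: "conj_by (had_on n (T + 1) T) (conj_by (ctrl_refl (T + 1) T (\<phi> 1)) (kron ?\<Psi> km * adj (kron ?\<Psi> km))) =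
      (S0 + S1) * adj (S0 + S1)"
    by (subst conj_by_gram, simp, subst conj_by_gram, simp, unfold Z, simp)
  have p0: "on_sys_qubit (T + 1) T (1\<^sub>m n) (ketbra ket0) * (S0 + S1) = S0"
    unfolding S0_def S1_def by (subst mult_add_dim) (auto simp: osq_apply)
  have p1: "on_sys_qubit (T + 1) T (1\<^sub>m n) (ketbra ket1) * (S0 + S1) = S1"
    unfolding S0_def S1_def by (subst mult_add_dim) (auto simp: osq_apply)
  have s4: "conj_by (on_sys_qubit (T + 1) T (1\<^sub>m n) (ketbra ket0)) ((S0 + S1) * adj (S0 + S1)) +
      conj_by (on_sys_qubit (T + 1) T (1\<^sub>m n) (ketbra ket1)) ((S0 + S1) * adj (S0 + S1)) = S0 * adj S0 + S1 * adj S1"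
    by (subst conj_by_gram, simp, subst conj_by_gram, simp, unfold p0 p1, rule refl)
  let ?A = "kron \<chi> k0 * adj (kron \<chi> k0)" and ?B = "kron o1 k1 * adj (kron o1 k1)"
  have "S0 * adj S0 = kron (\<phi>c * adj \<phi>c) ?A" "S1 * adj S1 = kron (h * adj h) ?B"
    by (simp_all add: S0_def S1_def stv_def adj_kron kron_mult)
  moreover have "mtrace (\<phi>c * adj \<phi>c) = 1"
    using colv_unit[OF unit, of 1] K by (subst mtrace_comm) auto
  moreover have "mtrace (h * adj h) = complex_of_real ((frob h)\<^sup>2)"
    unfolding mtrace_adj_self[symmetric] by (rule mtrace_comm) auto
  moreover have "ptrace_sys n (S0 * adj S0 + S1 * adj S1) = ptrace_sys n (S0 * adj S0) + ptrace_sys n (S1 * adj S1)"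
    by (rule ptrace_sys_add[where N = "2 ^ (T + 1)"]) (auto simp: n_pos)
  moreover have "ptrace_sys n (kron (\<phi>c * adj \<phi>c) ?A) = mtrace (\<phi>c * adj \<phi>c) \<cdot>\<^sub>m ?A"
    by (rule ptrace_sys_kron[where N = "2 ^ (T + 1)"]) (auto simp: n_pos intro!: carrier_matI)
  moreover have "ptrace_sys n (kron (h * adj h) ?B) = mtrace (h * adj h) \<cdot>\<^sub>m ?B"
    by (rule ptrace_sys_kron[where N = "2 ^ (T + 1)"]) (auto simp: n_pos intro!: carrier_matI)
  ultimately have s5: "ptrace_sys n (S0 * adj S0 + S1 * adj S1) = 1 \<cdot>\<^sub>m ?A + complex_of_real ((frob h)\<^sup>2) \<cdot>\<^sub>m ?B"
    by simp
  let ?C0 = "kron (colv (\<psi> 1)) (kron \<chi> k0)" and ?C1 = "kron (colv (\<psi> 1)) (kron o1 k1)"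
  have "kron (ketbra (\<psi> 1)) (1 \<cdot>\<^sub>m ?A + complex_of_real ((frob h)\<^sup>2) \<cdot>\<^sub>m ?B) =
      1 \<cdot>\<^sub>m kron (ketbra (\<psi> 1)) ?A + complex_of_real ((frob h)\<^sup>2) \<cdot>\<^sub>m kron (ketbra (\<psi> 1)) ?B"
    by (subst kron_add_right) (auto simp: kron_smult_right)
  also have "1 \<cdot>\<^sub>m kron (ketbra (\<psi> 1)) ?A = ?C0 * adj ?C0"
    by (simp add: ketbra_colv adj_kron kron_mult) (auto intro!: eq_matI)
  also have "kron (ketbra (\<psi> 1)) ?B = ?C1 * adj ?C1"
    by (simp add: ketbra_colv adj_kron kron_mult)
  also have "complex_of_real ((frob h)\<^sup>2) \<cdot>\<^sub>m (?C1 * adj ?C1) =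
      (complex_of_real (frob h) \<cdot>\<^sub>m ?C1) * adj (complex_of_real (frob h) \<cdot>\<^sub>m ?C1)"
  proof -
    have "(complex_of_real (frob h) \<cdot>\<^sub>m ?C1) * adj (complex_of_real (frob h) \<cdot>\<^sub>m ?C1) =
        complex_of_real (frob h) \<cdot>\<^sub>m (complex_of_real (frob h) \<cdot>\<^sub>m (?C1 * adj ?C1))"
      by (subst smult_mult_dim) (simp_all add: adj_smult mult_smult_dim)
    also have "\<dots> = complex_of_real ((frob h)\<^sup>2) \<cdot>\<^sub>m (?C1 * adj ?C1)"
      by (rule eq_matI) (simp_all add: power2_eq_square del: index_mult_mat(1))
    finally show ?thesis ..
  qed
  finally have s6: "kron (ketbra (\<psi> 1)) (1 \<cdot>\<^sub>m ?A + complex_of_real ((frob h)\<^sup>2) \<cdot>\<^sub>m ?B) =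
      ?C0 * adj ?C0 + (complex_of_real (frob h) \<cdot>\<^sub>m ?C1) * adj (complex_of_real (frob h) \<cdot>\<^sub>m ?C1)" .
  have dC: "dim_row ?C0 = n * 2 ^ (T + 1)" "dim_row (complex_of_real (frob h) \<cdot>\<^sub>m ?C1) = n * 2 ^ (T + 1)"
    by simp_all
  show ?thesis
    unfolding procedure_out_def Let_def s1 s2 s3 s4 s5 s6 W_out_def[symmetric] foldl_conj_add[OF squares_undo(2) dC] ..
qed

text \<open>The ideal output is the reduced state of \<open>a\<close>, the input sent through
  \<open>U\<close> beside untouched ancillas. The branch with \<open>c\<close> equal to 0 misses
  \<open>a\<close> exactly by \<open>e\<close>, the failed term after undoing, and the branch with
  \<open>c\<close> equal to 1 adds \<open>Y\<close>; both \<open>e\<close> and \<open>Y\<close> have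
  norm \<open>frob h\<close>.\<close>

lemma estimate:
  assumes Z: "Z \<in> carrier_mat n n" "adj Z * Z = 1\<^sub>m n"
  shows "cmod (mtrace (Z * (U * (V * adj V) * adj U)) - mtrace (Z * procedure_out n \<phi> \<psi> ks (V * adj V)))
    \<le> frob h * sqrt (4 - 3 * (frob h)\<^sup>2) + (frob h)\<^sup>2" (is "?lhs \<le> _")
    "frob h \<le> 1"
    "procedure_out n \<phi> \<psi> ks (V * adj V) \<in> carrier_mat n n"
    "adj (procedure_out n \<phi> \<psi> ks (V * adj V)) = procedure_out n \<phi> \<psi> ks (V * adj V)"
proof -
  let ?N = "2 ^ (T + 1) :: nat"
  let ?\<rho> = "V * adj V"
  obtain \<chi> where \<chi>: "\<chi> \<in> carrier_mat (2 ^ T) n"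
    and ev: "app (W_in ks) [0..<T] (kron V (qstate km T)) = kron \<phi>c \<chi> + kron h o1"
    using final_state[OF ks V(1)] .
  have d\<chi> [simp]: "dim_row \<chi> = 2 ^ T" "dim_col \<chi> = n" using \<chi> by auto
  let ?\<Psi> = "kron \<phi>c \<chi> + kron h o1" and ?X0 = "kron V (qstate km T)"
  define E where "E = undo_in (kron h o1)"
  define X where "X = undo_out (kron (colv (\<psi> 1)) (kron \<chi> k0))"
  define Y where "Y = undo_out (complex_of_real (frob h) \<cdot>\<^sub>m kron (colv (\<psi> 1)) (kron o1 k1))"
  define a where "a = UU ks * kron ?X0 k0"
  define e where "e = UU ks * kron E k0"
  have fo: "frob o1 = 1" "frob k0 = 1" "frob k1 = 1" "frob (qstate km T) = 1" "frob \<phi>c = 1" "frob (colv (\<psi> 1)) = 1"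
    using qstate_unit[OF unit_kets_colv(2)] qstate_unit[OF unit_kets_colv(3)] unit_kets_colv
      colv_unit[OF unit, of 1] colv_unit[OF unit_\<psi>, of 1] K by (auto intro!: frob_unit simp del: One_nat_def)
  have dE [simp]: "dim_row E = n * 2 ^ T" "dim_col E = n"
    unfolding E_def by (simp_all add: dim_app[OF squares_undo(1)])
  have un: "undo_in ?\<Psi> = ?X0"
    unfolding ev[symmetric] by (rule app_undo[OF squares_W_in[OF ks]]) (auto simp: W_in_unitary)
  have dUU: "dim_col (UU ks) = n * ?N" by simp
  \<comment> \<open>Replacing \<open>\<phi> 1\<close> by \<open>\<psi> 1\<close> in the good term is
    the same as applying \<open>U\<close> to it. The good term is the full state minus the failed
    one, and undoing the rounds returns the full state to its start.\<close>
  have X: "X = a - e"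
  proof -
    have "kron (colv (\<psi> 1)) (kron \<chi> k0) = UU ks * kron (kron \<phi>c \<chi>) k0"
      by (simp add: UU_def \<psi> mult_colv[symmetric] kron_assoc kron_mult)
    then have "X = UU ks * kron (undo_in (kron \<phi>c \<chi>)) k0"
      unfolding X_def by (simp add: undo_out_apply)
    also have "kron \<phi>c \<chi> = ?\<Psi> - kron h o1"
      by (rule eq_matI) auto
    also have "undo_in (?\<Psi> - kron h o1) = ?X0 - E"
      unfolding E_def un[symmetric] by (rule app_minus[OF squares_undo(1)]) auto
    also have "UU ks * kron (?X0 - E) k0 = a - e"
      unfolding a_def e_def by (subst kron_minus_left) (auto simp: mult_minus_dim)
    finally show ?thesis .
  qed
  have dims [simp]: "dim_row a = n * ?N" "dim_row e = n * ?N" "dim_col a = n" "dim_col e = n"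
    by (simp_all add: a_def e_def)
  have dY: "dim_row Y = n * ?N" "dim_col Y = 1"
    unfolding Y_def by (simp_all add: dim_app[OF squares_undo(2)])
  have dX: "dim_row X = n * ?N" "dim_col X = n" unfolding X by simp_all
  have out: "procedure_out n \<phi> \<psi> ks ?\<rho> = ptrace_anc ?N (X * adj X + Y * adj Y)"
    unfolding X_def Y_def by (rule procedure_out_eq[OF \<chi> ev])
  have N0: "?N > 0" by simp
  show "procedure_out n \<phi> \<psi> ks ?\<rho> \<in> carrier_mat n n"
    unfolding out using dX dY by (intro carrier_matI) auto
  show "adj (procedure_out n \<phi> \<psi> ks ?\<rho>) = procedure_out n \<phi> \<psi> ks ?\<rho>"
    unfolding out using dX dY
    by (subst adj_ptrace_anc[where n = n]) (auto simp: adj_add adj_mult)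
  have urho: "U * ?\<rho> * adj U = ptrace_anc ?N (a * adj a)"
  proof -
    let ?w = "kron (qstate km T) k0"
    have aw: "a = kron (U * V) ?w"
      by (simp add: a_def UU_def kron_assoc kron_mult)
    have "a * adj a = kron ((U * V) * adj (U * V)) (?w * adj ?w)"
      unfolding aw by (simp add: adj_kron kron_mult)
    moreover have "ptrace_anc ?N (kron ((U * V) * adj (U * V)) (?w * adj ?w)) =
        mtrace (?w * adj ?w) \<cdot>\<^sub>m ((U * V) * adj (U * V))"
      by (rule ptrace_anc_kron[where n = n]) (auto intro!: carrier_matI)
    moreover have "mtrace (?w * adj ?w) = 1"
    proof -
      have "mtrace (?w * adj ?w) = mtrace (adj ?w * ?w)" by (rule mtrace_comm) auto
      also have "\<dots> = 1"
        using qstate_unit[OF unit_kets_colv(3), of T] unit_kets_colv by (simp add: adj_kron kron_mult)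
      finally show ?thesis .
    qed
    moreover have "1 \<cdot>\<^sub>m ((U * V) * adj (U * V)) = U * ?\<rho> * adj U"
      by (simp add: adj_mult mult_assoc_dim) (auto intro!: eq_matI)
    ultimately show ?thesis by simp
  qed
  let ?Z = "kron Z (1\<^sub>m ?N)"
  have dZ [simp]: "dim_row Z = n" "dim_col Z = n" using Z by auto
  have ZZ: "?Z \<in> carrier_mat (n * ?N) (n * ?N)" "adj ?Z * ?Z = 1\<^sub>m (n * ?N)"
    using Z by (auto simp: adj_kron kron_mult intro!: carrier_matI)
  have frobE: "frob E = frob h"
    unfolding E_def by (subst frob_undo_in) (auto simp: frob_kron fo)
  have frobe: "frob e = frob h"
    unfolding e_def by (subst frob_isometry) (auto simp: UU_unitary frob_kron fo frobE)
  have orth: "mtrace (adj (kron \<phi>c \<chi>) * kron h o1) = 0"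
  proof -
    have "adj \<phi>c * h = adj (Qf * \<phi>c) * failed ks V"
      by (simp add: adj_mult mult_assoc_dim del: One_nat_def)
    then have "adj \<phi>c * h = 0\<^sub>m 1 n" unfolding Qf_\<phi>c by simp
    then show ?thesis
      by (simp add: adj_kron kron_mult mtrace_def del: One_nat_def)
  qed
  have nPsi: "(frob \<chi>)\<^sup>2 + (frob h)\<^sup>2 = 1"
  proof -
    have "(frob ?\<Psi>)\<^sup>2 = (frob (kron \<phi>c \<chi>))\<^sup>2 + (frob (kron h o1))\<^sup>2"
      by (rule frob_add_orth[OF _ _ orth]) auto
    moreover have "frob ?\<Psi> = frob ?X0"
      unfolding un[symmetric] by (rule frob_undo_in[symmetric]) auto
    ultimately show ?thesis by (simp add: frob_kron fo V(2) del: One_nat_def)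
  qed
  have "(frob h)\<^sup>2 \<le> 1\<^sup>2" using nPsi by (metis le_add_same_cancel2 one_power2 zero_le_power2)
  then show "frob h \<le> 1" by (rule power2_le_imp_le) simp
  \<comment> \<open>Up to isometries this is twice the full state minus the failed term, that is,
    twice the good term plus the failed one. With \<open>t = (frob h)\<^sup>2\<close> these
    orthogonal terms have squared norms \<open>4 * (1 - t)\<close> and \<open>t\<close>.\<close>
  have frobw: "frob (2 \<cdot>\<^sub>m a - e) = sqrt (4 - 3 * (frob h)\<^sup>2)"
  proof -
    have "2 \<cdot>\<^sub>m a - e = UU ks * kron (2 \<cdot>\<^sub>m ?X0 - E) k0"
      unfolding a_def e_def
      by (subst kron_minus_left) (auto simp: mult_minus_dim mult_smult_dim kron_smult_left)
    also have "2 \<cdot>\<^sub>m ?X0 - E = undo_in (2 \<cdot>\<^sub>m ?\<Psi> - kron h o1)"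
      unfolding E_def un[symmetric]
      by (subst app_minus[OF squares_undo(1)], simp, simp, simp, subst app_smult[OF squares_undo(1)]) auto
    also have "2 \<cdot>\<^sub>m ?\<Psi> - kron h o1 = 2 \<cdot>\<^sub>m kron \<phi>c \<chi> + kron h o1"
      by (rule eq_matI) auto
    finally have "frob (2 \<cdot>\<^sub>m a - e) = frob (2 \<cdot>\<^sub>m kron \<phi>c \<chi> + kron h o1)"
      by (simp add: frob_isometry UU_unitary dim_app[OF squares_undo(1)] frob_kron fo frob_undo_in)
    moreover have "(frob (2 \<cdot>\<^sub>m kron \<phi>c \<chi> + kron h o1))\<^sup>2 = 4 * (frob \<chi>)\<^sup>2 + (frob h)\<^sup>2"
    proof -
      have "mtrace (adj (2 \<cdot>\<^sub>m kron \<phi>c \<chi>) * kron h o1) = 0"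
        using orth by (simp add: adj_smult smult_mult_dim mtrace_smult del: One_nat_def)
      then show ?thesis
        by (subst frob_add_orth) (auto simp: frob_smult frob_kron fo power_mult_distrib simp del: One_nat_def)
    qed
    ultimately have "(frob (2 \<cdot>\<^sub>m a - e))\<^sup>2 = 4 - 3 * (frob h)\<^sup>2" using nPsi by simp
    then show ?thesis by (metis frob_nonneg real_sqrt_unique)
  qed
  have frobY: "frob Y = frob h"
    unfolding Y_def by (subst frob_undo_out) (auto simp: frob_smult frob_kron fo power_add simp del: One_nat_def)
  have m: "mtrace (Z * ptrace_anc ?N \<sigma>) = mtrace (?Z * \<sigma>)" if "\<sigma> \<in> carrier_mat (n * ?N) (n * ?N)" for \<sigma>
    by (rule mtrace_ptrace_anc[OF Z(1) that N0])
  have "mtrace (Z * procedure_out n \<phi> \<psi> ks ?\<rho>) = mtrace (?Z * (X * adj X + Y * adj Y))"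
    unfolding out using dX dY by (intro m carrier_matI) auto
  also have "\<dots> = mtrace (?Z * (X * adj X)) + mtrace (?Z * (Y * adj Y))"
    using dX dY by (simp add: mult_add_dim mtrace_add)
  finally have "mtrace (Z * (U * ?\<rho> * adj U)) - mtrace (Z * procedure_out n \<phi> \<psi> ks ?\<rho>) =
      (mtrace (?Z * (a * adj a)) - mtrace (?Z * (X * adj X))) - mtrace (?Z * (Y * adj Y))"
    unfolding urho by (subst m) (auto intro!: carrier_matI)
  then have "?lhs \<le> cmod (mtrace (?Z * (a * adj a)) - mtrace (?Z * (X * adj X))) + cmod (mtrace (?Z * (Y * adj Y)))"
    by (simp only: norm_triangle_ineq4)
  also have "\<dots> \<le> frob e * frob (2 \<cdot>\<^sub>m a - e) + frob Y * frob Y"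
    unfolding X using dY
    by (intro add_mono rank_one_difference[OF ZZ] cauchy_schwarz_unitary[OF ZZ]) auto
  finally show "?lhs \<le> frob h * sqrt (4 - 3 * (frob h)\<^sup>2) + (frob h)\<^sup>2"
    unfolding frobe frobw frobY by (simp add: power2_eq_square)
qed

end

end

section \<open>Averaging over the choices\<close>

context reflection_mixture
begin

lemma G_carrier: "X \<in> carrier_mat n n \<Longrightarrow> (G ^^ T) X \<in> carrier_mat n n"
  by (induction T) (auto simp: G_def intro!: D_carrier carrier_matI)

text \<open>Heisenberg picture: the last choice acts outermost on the failed state, and its average
  is shifted onto the test operator. This is why the induction needs an arbitrary
  \<open>B\<close>.\<close>

lemma sum_failed:
  assumes V: "V \<in> carrier_mat n c"
  shows "B \<in> carrier_mat n n \<Longrightarrow>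
    (\<Sum>ks | length ks = T \<and> set ks \<subseteq> {1..K}. mtrace (B * (failed ks V * adj (failed ks V)))) =
    of_nat K ^ T * mtrace (B * (G ^^ T) (V * adj V))"
proof (induction T arbitrary: B)
  case 0
  have "{ks. length ks = 0 \<and> set ks \<subseteq> {1..K}} = {[]}" by auto
  then show ?case by (simp add: failed_def)
next
  case (Suc T)
  note B = Suc.prems
  have dBn [simp]: "dim_row B = n" "dim_col B = n" using B by auto
  have dual: "mtrace (B * D (Qf * Y * Qf)) = mtrace ((Qf * D B * Qf) * Y)" if Y: "Y \<in> carrier_mat n n" for Y
  proof -
    have Y': "Qf * Y * Qf \<in> carrier_mat n n" using Y by (auto intro!: carrier_matI)
    have "mtrace (B * D (Qf * Y * Qf)) = mtrace (adj (adj B) * D (Qf * Y * Qf))" by simp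
    also have "\<dots> = mtrace (adj (D (adj B)) * (Qf * Y * Qf))"
      using B by (intro D_selfadj Y') auto
    also have "adj (D (adj B)) = D B"
      using B by (subst adj_D) auto
    also have "mtrace (D B * (Qf * Y * Qf)) = mtrace ((D B * Qf * Y) * Qf)"
      using Y by (simp add: mult_assoc_dim)
    also have "\<dots> = mtrace (Qf * (D B * Qf * Y))"
      using Y by (intro mtrace_comm) auto
    also have "Qf * (D B * Qf * Y) = (Qf * D B * Qf) * Y"
      using Y by (simp add: mult_assoc_dim)
    finally show ?thesis .
  qed
  have QB: "Qf * D B * Qf \<in> carrier_mat n n" by (auto intro!: carrier_matI)
  have step: "(\<Sum>k=1..K. mtrace (B * (failed (ks @ [k]) V * adj (failed (ks @ [k]) V)))) =
      of_nat K * mtrace ((Qf * D B * Qf) * (failed ks V * adj (failed ks V)))" if ks: "set ks \<subseteq> {1..K}" for ks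
  proof -
    let ?Y = "failed ks V * adj (failed ks V)"
    have df: "dim_row (failed ks V) = n" using dim_failed[OF ks] V by auto
    then have Y: "?Y \<in> carrier_mat n n" by (auto intro!: carrier_matI)
    have "failed (ks @ [k]) V * adj (failed (ks @ [k]) V) = R k * (Qf * ?Y * Qf) * R k" if k: "k \<in> {1..K}" for k
      using df dim\<phi>[OF k] by (simp add: failed_snoc adj_mult mult_assoc_dim)
    then have "(\<Sum>k=1..K. mtrace (B * (failed (ks @ [k]) V * adj (failed (ks @ [k]) V)))) =
        (\<Sum>k=1..K. mtrace (B * (R k * (Qf * ?Y * Qf) * R k)))" by simp
    also have "\<dots> = of_nat K * mtrace (B * D (Qf * ?Y * Qf))"
      using K B Y by (subst mtrace_mult_D) (auto intro!: carrier_matI)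
    finally show ?thesis using dual[OF Y] by simp
  qed
  have "(\<Sum>ks | length ks = Suc T \<and> set ks \<subseteq> {1..K}. mtrace (B * (failed ks V * adj (failed ks V)))) =
      (\<Sum>(ks,k)\<in>{ks. length ks = T \<and> set ks \<subseteq> {1..K}} \<times> {1..K}.
        mtrace (B * (failed (ks @ [k]) V * adj (failed (ks @ [k]) V))))"
    by (rule sum.reindex_bij_witness[of _ "\<lambda>(ks,k). ks @ [k]" "\<lambda>ks. (butlast ks, last ks)"])
      (auto simp: length_Suc_conv_rev)
  also have "\<dots> = (\<Sum>ks | length ks = T \<and> set ks \<subseteq> {1..K}. \<Sum>k=1..K.
        mtrace (B * (failed (ks @ [k]) V * adj (failed (ks @ [k]) V))))"
    by (simp add: sum.cartesian_product)
  also have "\<dots> = (\<Sum>ks | length ks = T \<and> set ks \<subseteq> {1..K}.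
      of_nat K * mtrace ((Qf * D B * Qf) * (failed ks V * adj (failed ks V))))"
    by (intro sum.cong refl step) auto
  also have "\<dots> = of_nat K * (of_nat K ^ T * mtrace ((Qf * D B * Qf) * (G ^^ T) (V * adj V)))"
    unfolding sum_distrib_left[symmetric] Suc.IH[OF QB] ..
  also have "mtrace ((Qf * D B * Qf) * (G ^^ T) (V * adj V)) = mtrace (B * (G ^^ Suc T) (V * adj V))"
    using dual[OF G_carrier, of "V * adj V" T] V by (auto simp: G_def)
  finally show ?case by simp
qed

text \<open>The test operator is \<open>Qf\<close>, the projection built into the final failed term;
  idempotence puts it on both sides, as \<open>failure_bound\<close> expects.\<close>

lemma sum_failure:
  assumes V: "V \<in> carrier_mat n c" and \<rho>: "V * adj V \<in> L" "frob (V * adj V) \<le> 1"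
  shows "(\<Sum>ks | length ks = T \<and> set ks \<subseteq> {1..K}. (frob (Qf * failed ks V))\<^sup>2) \<le> real K ^ T * (sqrt (real d) * contr ^ T)"
proof -
  have cyc: "mtrace (Qf * Y * Qf) = mtrace (Qf * Y)" if Y: "Y \<in> carrier_mat n n" for Y
  proof -
    have "mtrace (Qf * Y * Qf) = mtrace (Qf * (Qf * Y))"
      using Y by (intro mtrace_comm) auto
    also have "Qf * (Qf * Y) = Qf * Y"
      using Y by (intro mult_absorb Qf_idem) auto
    finally show ?thesis .
  qed
  have h: "(frob (Qf * failed ks V))\<^sup>2 = Re (mtrace (Qf * (failed ks V * adj (failed ks V))))"
    if ks: "set ks \<subseteq> {1..K}" for ks
  proof -
    have df: "dim_row (failed ks V) = n" using dim_failed[OF ks] V by auto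
    have "mtrace (adj (Qf * failed ks V) * (Qf * failed ks V)) = mtrace ((Qf * failed ks V) * adj (Qf * failed ks V))"
      using df by (intro mtrace_comm) auto
    also have "(Qf * failed ks V) * adj (Qf * failed ks V) = Qf * (failed ks V * adj (failed ks V)) * Qf"
      using df by (simp add: adj_mult mult_assoc_dim)
    also have "mtrace \<dots> = mtrace (Qf * (failed ks V * adj (failed ks V)))"
      using df by (intro cyc carrier_matI) auto
    finally show ?thesis by (simp add: frob_sq)
  qed
  have "(\<Sum>ks | length ks = T \<and> set ks \<subseteq> {1..K}. (frob (Qf * failed ks V))\<^sup>2) =
      Re (\<Sum>ks | length ks = T \<and> set ks \<subseteq> {1..K}. mtrace (Qf * (failed ks V * adj (failed ks V))))"
    unfolding Re_sum by (intro sum.cong refl h) auto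
  also have "\<dots> = Re (of_nat K ^ T * mtrace (Qf * (G ^^ T) (V * adj V)))"
    by (simp only: sum_failed[OF V Qf_carrier])
  also have "\<dots> = real K ^ T * Re (mtrace (Qf * (G ^^ T) (V * adj V) * Qf))"
    unfolding cyc[OF G_carrier[OF L_carrier[OF \<rho>(1)]]]
    by (simp flip: of_nat_power)
  also have "\<dots> \<le> real K ^ T * (sqrt (real d) * contr ^ T)"
    by (intro mult_left_mono failure_bound[OF \<rho>]) auto
  finally show ?thesis .
qed

text \<open>Rests on \<open>1 - x \<le> exp (- x)\<close>. The exponential comes out as
  \<open>eps\<^sup>2 / (8 * d)\<close>, and its spare factor \<open>1 / d\<close> absorbs
  \<open>sqrt d\<close> because \<open>d\<close> is at least 1.\<close>

lemma contr_pow_bound: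
  assumes eps: "eps > 0" and T: "real d * ln (8 * real d / eps\<^sup>2) \<le> real T * (1 - lam)"
  shows "sqrt (real d) * contr ^ T \<le> eps\<^sup>2 / 8"
proof -
  have d: "0 < real d" using d_pos by simp
  have "contr \<le> exp (- ((1 - lam) / real d))"
    unfolding contr_def using exp_ge_add_one_self[of "- ((1 - lam) / real d)"] by simp
  then have "contr ^ T \<le> exp (- ((1 - lam) / real d)) ^ T"
    using contr_nonneg by (rule power_mono)
  also have "\<dots> = exp (- (real T * (1 - lam) / real d))"
    by (simp add: exp_of_nat_mult[symmetric])
  also have "\<dots> \<le> exp (- ln (8 * real d / eps\<^sup>2))"
    using T d by (simp add: field_simps)
  also have "\<dots> = eps\<^sup>2 / (8 * real d)"
    using eps d by (simp add: exp_minus field_simps)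
  finally have "sqrt (real d) * contr ^ T \<le> sqrt (real d) * (eps\<^sup>2 / (8 * real d))"
    by (intro mult_left_mono) auto
  also have "\<dots> \<le> real d * (eps\<^sup>2 / (8 * real d))"
  proof (rule mult_right_mono)
    have "real d \<le> (real d)\<^sup>2" using d_pos by (simp add: power2_eq_square)
    then show "sqrt (real d) \<le> real d" by (rule real_le_lsqrt[rotated -1]) simp_all
  qed simp
  also have "\<dots> = eps\<^sup>2 / 8" using d by simp
  finally show ?thesis .
qed

end

text \<open>The two sides are separated by \<open>sqrt 8 * x\<close>; the right inequality is that of the arithmetic and
  geometric means.\<close>
lemma error_estimate:
  fixes x eps :: real
  assumes x: "0 \<le> x" "x \<le> 1" and eps: "0 < eps"
  shows "x * sqrt (4 - 3 * x\<^sup>2) + x\<^sup>2 \<le> 4 * x\<^sup>2 / eps + eps / 2"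
proof -
  have s2: "sqrt 2 * sqrt 2 = (2::real)" by simp
  have s1: "1 \<le> sqrt (2::real)" by simp
  \<comment> \<open>This is \<open>(2 * sqrt 2 - x)\<^sup>2 - (4 - 3 * x\<^sup>2)\<close> after
    completing the square.\<close>
  have "0 \<le> (2 * x - sqrt 2)\<^sup>2 + 2" by simp
  then have "4 - 3 * x\<^sup>2 \<le> (2 * sqrt 2 - x)\<^sup>2"
    using s2 by (simp add: power2_eq_square algebra_simps)
  then have "sqrt (4 - 3 * x\<^sup>2) \<le> 2 * sqrt 2 - x"
  proof (rule real_le_lsqrt[rotated])
    show "0 \<le> 2 * sqrt 2 - x" using x s1 by linarith
  qed
  then have "x * sqrt (4 - 3 * x\<^sup>2) \<le> x * (2 * sqrt 2 - x)"
    using x by (intro mult_left_mono)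
  then have "x * sqrt (4 - 3 * x\<^sup>2) + x\<^sup>2 \<le> 2 * sqrt 2 * x"
    by (simp add: power2_eq_square algebra_simps)
  also have "\<dots> \<le> 4 * x\<^sup>2 / eps + eps / 2"
  proof -
    have "0 \<le> (2 * sqrt 2 * x - eps)\<^sup>2" by simp
    then have "4 * sqrt 2 * x * eps \<le> 8 * x\<^sup>2 + eps\<^sup>2"
      using s2 by (simp add: power2_eq_square algebra_simps)
    then show ?thesis using eps by (simp add: field_simps power2_eq_square)
  qed
  finally show ?thesis .
qed

theorem theorem2:
  fixes n K T d :: nat and U \<rho> :: "complex mat" and \<phi>in \<phi>out :: "nat \<Rightarrow> complex vec"
    and Hin :: "complex vec set" and L :: "complex mat set" and eps :: real
  assumes U: "unitary_mat n U"
    and K: "K \<ge> 1"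
    and unit: "\<forall>k \<in> {1..K}. is_unit_vec n (\<phi>in k)"
    and Hin: "Hin = cspan_vec n (\<phi>in ` {1..K})"
    and d: "d = cdim_vec n Hin"
    and L: "L = {X. supported_on n Hin X}"
    and full_alg: "gen_algebra n (ketbra ` \<phi>in ` {1..K}) = L"
    and out: "\<forall>k. \<phi>out k = U *\<^sub>v \<phi>in k"
    and eps: "eps > 0"
    and T: "real d * ln (8 * real d / eps\<^sup>2) \<le> real T * (1 - second_eig_mag n L (D_map K \<phi>in))"
    and rho: "density_op n \<rho>"
    and supp: "supported_on n Hin \<rho>"
  shows "trace_norm (U * \<rho> * mat_adjoint U - channel_E n K T \<phi>in \<phi>out \<rho>) \<le> eps"
proof -
  have S: "finite (\<phi>in ` {1..K})" "\<phi>in ` {1..K} \<subseteq> carrier_vec n"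
    using unit by (auto simp: is_unit_vec_def)
  obtain Q where Q: "Q \<in> carrier_mat n n" "adj Q = Q" "Q * Q = Q" "mtrace Q = of_nat d"
    and Qfix: "\<And>v. v \<in> Hin \<Longrightarrow> v \<in> carrier_vec n \<and> Q *\<^sub>v v = v"
    and Qran: "\<And>v. v \<in> carrier_vec n \<Longrightarrow> Q *\<^sub>v v \<in> Hin"
    using span_projector[OF S] unfolding Hin[symmetric] d[symmetric] by blast
  have \<phi>Hin: "\<phi>in k \<in> Hin" if "k \<in> {1..K}" for k
  proof -
    interpret vec_space "TYPE(complex)" n .
    show ?thesis using span_mem[OF S(2)] that by (simp add: Hin cspan_vec_def)
  qed
  interpret reflection_mixture n K d \<phi>in Q
    by unfold_locales (use K unit Q Qfix \<phi>Hin in auto)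
  have L_eq: "L = reflection_mixture.L n Q"
    using supported_on_iff[OF Q(1-3) Qfix Qran] reflection_mixture.L_def[OF reflection_mixture_axioms]
    by (simp add: L)
  have Uc: "U \<in> carrier_mat n n" "U * adj U = 1\<^sub>m n" "adj U * U = 1\<^sub>m n"
    using U by (auto simp: unitary_mat_def)
  have dU [simp]: "dim_row U = n" "dim_col U = n" using Uc by auto
  have \<rho>: "\<rho> \<in> carrier_mat n n" "adj \<rho> = \<rho>" "mtrace \<rho> = 1"
    "\<And>v. v \<in> carrier_vec n \<Longrightarrow> 0 \<le> Re ((\<rho> *\<^sub>v v) \<bullet>c v)"
    using rho by (auto simp: density_op_def)
  obtain V where Vc: "V \<in> carrier_mat n n" and \<rho>V: "\<rho> = V * adj V"
    using psd_factor[OF \<rho>(1,2,4)] .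
  have "mtrace (adj V * V) = mtrace \<rho>"
    unfolding \<rho>V by (rule mtrace_comm) (use Vc in auto)
  then have "(frob V)\<^sup>2 = 1\<^sup>2" by (simp add: frob_sq \<rho>(3))
  then have fV: "frob V = 1" by (rule power2_eq_imp_eq) simp_all
  have \<rho>L: "\<rho> \<in> reflection_mixture.L n Q"
    using supp L L_eq by auto
  have f\<rho>: "frob \<rho> \<le> 1"
    using frob_mult_le[of V "adj V"] Vc unfolding \<rho>V by (simp add: fV)
  interpret emulator n K d \<phi>in Q U V \<phi>out
    by unfold_locales (use Uc Vc fV out in auto)
  let ?S = "{ks. length ks = T \<and> set ks \<subseteq> {1..K}}"
  let ?E = "channel_E n K T \<phi>in \<phi>out \<rho>" and ?P = "\<lambda>ks. procedure_out n \<phi>in \<phi>out ks \<rho>"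
  let ?A = "U * \<rho> * adj U - ?E"
  let ?x = "\<lambda>ks. frob (Qf * failed ks V)"
  have cardS: "card ?S = K ^ T"
    using card_lists_length_eq[of "{1..K}" T] by (simp add: conj_commute)
  have K0: "real K ^ T > 0" using K by simp
  have P: "?P ks \<in> carrier_mat n n" "adj (?P ks) = ?P ks" if "ks \<in> ?S" for ks
    \<comment> \<open>Shape and self-adjointness of the output do not depend on the test unitary, so
      the identity serves.\<close>
    using estimate(3,4)[of ks "1\<^sub>m n"] that unfolding \<rho>V by auto
  have E: "?E \<in> carrier_mat n n" by (simp add: channel_E_def)
  have dE [simp]: "dim_row ?E = n" "dim_col ?E = n" using E by auto
  have Eij: "?E $$ (i,j) = (\<Sum>ks\<in>?S. ?P ks $$ (i,j)) / of_nat K ^ T" if "i < n" "j < n" for i j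
    using that by (simp add: channel_E_def)
  have "adj ?E = ?E"
  proof (rule eq_matI)
    fix i j assume "i < dim_row ?E" "j < dim_col ?E"
    then have ij: "i < n" "j < n" by auto
    have "cnj (?P ks $$ (j,i)) = ?P ks $$ (i,j)" if ks: "ks \<in> ?S" for ks
      using index_adj[of i "?P ks" j] P[OF ks] ij by auto
    then show "adj ?E $$ (i,j) = ?E $$ (i,j)"
      using ij by (simp add: Eij)
  qed auto
  then have "adj ?A = ?A"
    using \<rho>(1,2) by (simp add: adj_minus adj_mult mult_assoc_dim)
  moreover have "?A \<in> carrier_mat n n" using E by (intro carrier_matI) auto
  \<comment> \<open>One unitary is fixed for the averaged difference; from here on the average over
    the choices sits inside a linear functional, and each choice is estimated with the same
    \<open>Z\<close>.\<close>
  ultimately obtain Z where Z: "Z \<in> carrier_mat n n" "adj Z * Z = 1\<^sub>m n"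
    and tn: "trace_norm ?A = Re (mtrace (Z * ?A))"
    by (metis trace_norm_hermitian)
  have dZ [simp]: "dim_row Z = n" "dim_col Z = n" using Z by auto
  have mE: "mtrace (Z * ?E) = (\<Sum>ks\<in>?S. mtrace (Z * ?P ks)) / of_nat K ^ T"
  proof -
    have "mtrace (Z * ?E) = (\<Sum>i<n. \<Sum>k<n. \<Sum>ks\<in>?S. Z $$ (i,k) * ?P ks $$ (k,i) / of_nat K ^ T)"
      by (subst mtrace_mult) (auto simp: Eij sum_distrib_left sum_divide_distrib intro!: sum.cong)
    also have "\<dots> = (\<Sum>i<n. \<Sum>ks\<in>?S. \<Sum>k<n. Z $$ (i,k) * ?P ks $$ (k,i) / of_nat K ^ T)"
      by (rule sum.cong[OF refl], rule sum.swap)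
    also have "\<dots> = (\<Sum>ks\<in>?S. \<Sum>i<n. \<Sum>k<n. Z $$ (i,k) * ?P ks $$ (k,i) / of_nat K ^ T)"
      by (rule sum.swap)
    also have "\<dots> = (\<Sum>ks\<in>?S. mtrace (Z * ?P ks) / of_nat K ^ T)"
    proof (rule sum.cong[OF refl])
      fix ks assume "ks \<in> ?S"
      then show "(\<Sum>i<n. \<Sum>k<n. Z $$ (i,k) * ?P ks $$ (k,i) / of_nat K ^ T) = mtrace (Z * ?P ks) / of_nat K ^ T"
        using P(1)[of ks] by (subst mtrace_mult) (auto simp: sum_divide_distrib)
    qed
    finally show ?thesis by (simp add: sum_divide_distrib)
  qed
  let ?m = "mtrace (Z * (U * \<rho> * adj U))"
  have "mtrace (Z * ?A) = ?m - mtrace (Z * ?E)"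
    using \<rho>(1) by (simp add: mult_minus_dim mtrace_minus)
  also have "\<dots> = (\<Sum>ks\<in>?S. ?m - mtrace (Z * ?P ks)) / of_nat K ^ T"
    using K by (simp add: mE sum_subtractf cardS diff_divide_distrib del: One_nat_def)
  finally have "cmod (mtrace (Z * ?A)) = cmod (\<Sum>ks\<in>?S. ?m - mtrace (Z * ?P ks)) / real K ^ T"
    by (simp add: norm_divide norm_power)
  \<comment> \<open>The bound is affine in the squared norms of the failed terms, so that after
    averaging only their mean matters.\<close>
  also have "\<dots> \<le> (\<Sum>ks\<in>?S. 4 * (?x ks)\<^sup>2 / eps + eps / 2) / real K ^ T"
  proof (intro divide_right_mono order_trans[OF norm_sum] sum_mono)
    fix ks assume "ks \<in> ?S"
    then have ks: "set ks \<subseteq> {1..K}" by auto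
    have "cmod (?m - mtrace (Z * ?P ks)) \<le> ?x ks * sqrt (4 - 3 * (?x ks)\<^sup>2) + (?x ks)\<^sup>2"
      using estimate(1)[OF ks Z] unfolding \<rho>V .
    also have "\<dots> \<le> 4 * (?x ks)\<^sup>2 / eps + eps / 2"
      using estimate(2)[OF ks Z] eps by (intro error_estimate) auto
    finally show "cmod (?m - mtrace (Z * ?P ks)) \<le> 4 * (?x ks)\<^sup>2 / eps + eps / 2" .
  qed (use K0 in simp)
  also have "\<dots> = 4 / eps * ((\<Sum>ks\<in>?S. (?x ks)\<^sup>2) / real K ^ T) + eps / 2"
    using K0 by (simp add: sum.distrib cardS sum_divide_distrib[symmetric] sum_distrib_left[symmetric] add_divide_distrib del: One_nat_def)
  \<comment> \<open>With the mean bounded by \<open>eps\<^sup>2 / 8\<close>, each of the two terms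
    is \<open>eps / 2\<close>.\<close>
  also have "\<dots> \<le> 4 / eps * (eps\<^sup>2 / 8) + eps / 2"
  proof (intro add_right_mono mult_left_mono)
    have "(\<Sum>ks\<in>?S. (?x ks)\<^sup>2) \<le> real K ^ T * (sqrt (real d) * contr ^ T)"
      using sum_failure[OF Vc, of T] \<rho>L f\<rho> unfolding \<rho>V by blast
    then have "(\<Sum>ks\<in>?S. (?x ks)\<^sup>2) / real K ^ T \<le> sqrt (real d) * contr ^ T"
      using K0 by (simp add: field_simps)
    also have "\<dots> \<le> eps\<^sup>2 / 8"
      using contr_pow_bound[OF eps, of T] T unfolding L_eq .
    finally show "(\<Sum>ks\<in>?S. (?x ks)\<^sup>2) / real K ^ T \<le> eps\<^sup>2 / 8" .
  qed (use eps in simp)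
  also have "\<dots> = eps" using eps by (simp add: power2_eq_square)
  finally have "cmod (mtrace (Z * ?A)) \<le> eps" .
  then show ?thesis
    using tn complex_Re_le_cmod[of "mtrace (Z * ?A)"] by linarith
qed

end
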